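(* For every $\tau \in A_0$, the limit set $J_\tau$ of the CIFS $S_\tau$ of generalized complex continued fractions satisfies $\mathcal{H}^{h_\tau}(J_\tau) = 0$ and $0 < \mathcal{P}^{h_\tau}(J_\tau) < \infty$. In particular, for every $\tau \in A_0$, the packing dimension of $J_\tau$ equals the Hausdorff dimension $h_\tau$ of $J_\tau$.
   Context: $\mathbb{N}$ denotes the set of positive integers, and $\mathbb{C}$ is identified with $\mathbb{R}^2$ with the Euclidean distance. Let $A_0 := \{\tau = u + iv \in \mathbb{C} \mid u \geq 0 \text{ and } v \geq 1\}$ and $X := \{z \in \mathbb{C} \mid |z - 1/2| \leq 1/2\}$. For $\tau \in A_0$ let $I_\tau := \{m + n\tau \in \mathbb{C} \mid m, n \in \mathbb{N}\}$. For $b \in I_\tau$ define $\phi_b : X \to X$ by $\phi_b(z) := \frac{1}{z+b}$. The family $S_\tau := \{\phi_b : X \to X \mid b \in I_\tau\}$ is called the CIFS (conformal iterated function system) of generalized complex continued fractions. For each infinite sequence $w = w_1 w_2 w_3 \cdots \in I_\tau^{\mathbb{N}}$, the set $\bigcap_{n \in \mathbb{N}} \phi_{w_1} \circ \cdots \circ \phi_{w_n}(X)$ is a singleton; the limit set of $S_\tau$ is $$J_\tau := \bigcup_{w \in I_\tau^{\mathbb{N}}} \bigcap_{n \in \mathbb{N}} \phi_{w_1} \circ \phi_{w_2} \circ \cdots \circ \phi_{w_n}(X) \subset X.$$ $h_\tau := \dim_{\mathcal{H}} J_\tau$ is the Hausdorff dimension of $J_\tau$ with respect to the Euclidean distance.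 For $s \geq 0$, $\mathcal{H}^s$ denotes the $s$-dimensional Hausdorff measure and $\mathcal{P}^s$ the $s$-dimensional packing measure. *)

theory Defs
  imports "HOL-Analysis.Analysis"
begin

(* The diameter gauge is |U|^s with the conventions |{}|^s = 0 and |U|^0 = 1 for nonempty U;
   the case distinction is needed because 0 powr 0 = 0. *)
definition diam_gauge :: "real \<Rightarrow> 'a::metric_space set \<Rightarrow> ennreal" where
  "diam_gauge s U =
     (if U = {} then 0 else if s = 0 then 1 else ennreal (diameter U powr s))"

(* Covers by sequences of sets include the finite covers, since empty sets contribute 0.
   Boundedness is required because diameter is only meaningful on bounded sets. *)
definition hausdorff_premeasure :: "real \<Rightarrow> real \<Rightarrow> 'a::metric_space set \<Rightarrow> ennreal" where
  "hausdorff_premeasure s \<delta> A =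
     (INF U \<in> {U :: nat \<Rightarrow> 'a set.
                 (\<forall>i. bounded (U i) \<and> diameter (U i) \<le> \<delta>) \<and> A \<subseteq> (\<Union>i. U i)}.
        \<Sum>i. diam_gauge s (U i))"

(* The limit for delta tending to 0 is a supremum by monotonicity. *)
definition hausdorff_measure :: "real \<Rightarrow> 'a::metric_space set \<Rightarrow> ennreal" where
  "hausdorff_measure s A = (SUP \<delta> \<in> {0<..}. hausdorff_premeasure s \<delta> A)"

(* A packing is a set of pairs (centre, radius): closed balls of the ambient space,
   centred in A, of radius at most delta, pairwise disjoint. *)
definition packings :: "real \<Rightarrow> 'a::metric_space set \<Rightarrow> ('a \<times> real) set set" where
  "packings \<delta> A =
     {B. countable B \<and> B \<subseteq> A \<times> {0<..\<delta>} \<and> disjoint_family_on (\<lambda>(x, r). cball x r) B}"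

(* A ball of radius r contributes (2 r)^s. *)
definition packing_premeasure_le :: "real \<Rightarrow> real \<Rightarrow> 'a::metric_space set \<Rightarrow> ennreal" where
  "packing_premeasure_le s \<delta> A =
     (SUP B \<in> packings \<delta> A. \<Sum>\<^sub>\<infinity>(x, r)\<in>B. ennreal ((2 * r) powr s))"

(* The limit for delta tending to 0 is an infimum by monotonicity. *)
definition packing_premeasure :: "real \<Rightarrow> 'a::metric_space set \<Rightarrow> ennreal" where
  "packing_premeasure s A = (INF \<delta> \<in> {0<..}. packing_premeasure_le s \<delta> A)"

(* The premeasure is not countably subadditive, hence the second step. *)
definition packing_measure :: "real \<Rightarrow> 'a::metric_space set \<Rightarrow> ennreal" where
  "packing_measure s A =
     (INF U \<in> {U :: nat \<Rightarrow> 'a set. A \<subseteq> (\<Union>i. U i)}. \<Sum>i. packing_premeasure s (U i))"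

(* The real-valued infimum is over a nonempty set, as both measures of exponent s > DIM('a)
   vanish on every subset of the Euclidean space 'a. *)
definition hausdorff_dim :: "'a::euclidean_space set \<Rightarrow> real" where
  "hausdorff_dim A = Inf {s. 0 \<le> s \<and> hausdorff_measure s A = 0}"

definition packing_dim :: "'a::euclidean_space set \<Rightarrow> real" where
  "packing_dim A = Inf {s. 0 \<le> s \<and> packing_measure s A = 0}"

(* gccf abbreviates generalized complex continued fractions: in the usual notation gccf_param is A_0,
   gccf_disc is X, gccf_index is I_tau, gccf_limit_set is J_tau and gccf_dim is h_tau. *)
definition gccf_param :: "complex set" where
  "gccf_param = {\<tau>. Re \<tau> \<ge> 0 \<and> Im \<tau> \<ge> 1}"

definition gccf_disc :: "complex set" where
  "gccf_disc = {z. cmod (z - 1/2) \<le> 1/2}"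

definition gccf_index :: "complex \<Rightarrow> complex set" where
  "gccf_index \<tau> = {of_nat m + of_nat n * \<tau> | m n :: nat. m \<ge> 1 \<and> n \<ge> 1}"

(* Used on gccf_disc only, where z + b is nonzero for b in gccf_index tau with tau in gccf_param. *)
definition gccf_map :: "complex \<Rightarrow> complex \<Rightarrow> complex" where
  "gccf_map b z = 1 / (z + b)"

(* gccf_word w n is the composition of the maps for w 1, ..., w n, with that of w n innermost. *)
primrec gccf_word :: "(nat \<Rightarrow> complex) \<Rightarrow> nat \<Rightarrow> complex \<Rightarrow> complex" where
  "gccf_word w 0 = id"
| "gccf_word w (Suc n) = gccf_word w n \<circ> gccf_map (w (Suc n))"

(* Infinite words are indexed from 1; the value w 0 is irrelevant. *)
definition gccf_limit_set :: "complex \<Rightarrow> complex set" where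
  "gccf_limit_set \<tau> = (\<Union>w \<in> {1..} \<rightarrow> gccf_index \<tau>. \<Inter>n \<in> {1..}. gccf_word w n ` gccf_disc)"

definition gccf_dim :: "complex \<Rightarrow> real" where
  "gccf_dim \<tau> = hausdorff_dim (gccf_limit_set \<tau>)"

end

theory Submission
  imports Defs "HOL-Library.Sublist"
begin

text \<open>
  The composition \<open>cf w\<close> of the maps of a word \<open>w\<close> is a Moebius map, and
  \<open>\<bar>cf w z - cf w z'\<bar>\<close> is exactly \<open>\<bar>z - z'\<bar>\<close> divided by the moduli of its denominator at the two
  points. As the pole of the map stays away from the disc, all distortion constants are powers of 4, and
  the sum of \<open>\<bar>(cf w)'(0)\<bar> powr s\<close> over words of length \<open>n\<close> is multiplicative in \<open>n\<close> up to \<open>4 powr s\<close>.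
  Its critical exponent \<open>h\<close> satisfies \<open>1 < h < 2\<close>, and at \<open>h\<close> these sums are bounded above and below.

  Measures on the limit set are replaced by a greedy choice of letters: a family of
  cylinders of small total weight is avoided by some infinite word. Lower bounds follow by turning a
  cheap cover (for \<open>s < h\<close>, over a finite set of letters) or a cheap packing (via Vitali's lemma and words
  that return to the interior of the disc) into a cheap family of cylinders. The Hausdorff measure vanishes
  because the images under all letters of modulus at least \<open>M\<close> lie in a disc of radius \<open>2 / M\<close>, whose gauge
  \<open>M powr - h\<close> is small compared with their total weight \<open>M powr (2 - 2 * h)\<close>, as \<open>h < 2\<close>. The packing
  measure is finite because every ball of radius \<open>r\<close> about a limit point carries weight of order at
  least \<open>r powr h\<close>.
\<close>

section \<open>Sums over sets in the extended nonnegative reals\<close>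

text \<open>No conformal measure is constructed: with infinitely many letters a weak limit of
  normalised sums over words could lose mass. The limsup of these sums is only subadditive in the
  word, but subadditivity is exactly what the greedy choice uses.

  The bounds on \<open>h\<close> have concrete sources. The letters fill a planar lattice quadrant,
  so the sum of \<open>|b| powr (- 2 * s)\<close> diverges at \<open>s = 1\<close>, and a finite
  part of it exceeds \<open>4 powr s\<close> for some \<open>s > 1\<close>. At \<open>s = 2\<close>
  the sum of \<open>|z + b| powr (- 2 * s)\<close> is below 1 uniformly in \<open>z\<close> and
  \<tau>, and so it is slightly to the left of 2. In turn, \<open>1 < h\<close> gives finite sums
  just below \<open>h\<close>, hence left continuity there.

  The obstacle for positive packing measure is tangency: the closed discs \<open>X + b\<close> and
  \<open>X + (b + 1)\<close> touch, so a limit point may lie on the boundary of its cylinders, and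
  then no ball about it fits inside. Infinitely many visits to one letter that maps the disc into
  its interior remove this. Words that eventually omit the letter are negligible, because at
  \<open>h\<close> any smaller alphabet has arbitrarily small partition sums.\<close>

definition esum :: "('a \<Rightarrow> ennreal) \<Rightarrow> 'a set \<Rightarrow> ennreal" where
  "esum f A = (\<integral>\<^sup>+x. f x \<partial>count_space A)"

lemma esum_cong: "A = B \<Longrightarrow> (\<And>x. x \<in> B \<Longrightarrow> f x = g x) \<Longrightarrow> esum f A = esum g B"
  unfolding esum_def by (auto intro!: nn_integral_cong)

lemma esum_mono: "(\<And>x. x \<in> A \<Longrightarrow> f x \<le> g x) \<Longrightarrow> esum f A \<le> esum g A"
  unfolding esum_def by (auto intro!: nn_integral_mono)

lemma esum_subset_mono: "A \<subseteq> B \<Longrightarrow> esum f A \<le> esum f B"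
  unfolding esum_def
  by (auto simp: nn_integral_count_space_indicator intro!: nn_integral_mono split: split_indicator)

lemma esum_finite: "finite A \<Longrightarrow> esum f A = sum f A"
  unfolding esum_def by (rule nn_integral_count_space_finite)

lemma esum_cmult: "esum (\<lambda>x. c * f x) A = c * esum f A"
  unfolding esum_def by (rule nn_integral_cmult) auto

lemma esum_multc: "esum (\<lambda>x. f x * c) A = esum f A * c"
  unfolding esum_def by (rule nn_integral_multc) auto

lemma esum_divide: "esum (\<lambda>x. f x / c) A = esum f A / c"
  unfolding esum_def by (rule nn_integral_divide) auto

lemma esum_add: "esum (\<lambda>x. f x + g x) A = esum f A + esum g A"
  unfolding esum_def by (rule nn_integral_add) auto

lemma esum_member_le: "x \<in> A \<Longrightarrow> f x \<le> esum f A"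
  unfolding esum_def by (rule nn_integral_ge_point)

lemma esum_bij_betw: "bij_betw h A B \<Longrightarrow> esum (\<lambda>x. f (h x)) A = esum f B"
  unfolding esum_def by (rule nn_integral_bij_count_space)

lemma esum_image: "inj_on h A \<Longrightarrow> esum f (h ` A) = esum (\<lambda>x. f (h x)) A"
  by (rule esum_bij_betw[symmetric]) (rule inj_on_imp_bij_betw)

lemma esum_nat: "esum f (UNIV :: nat set) = (\<Sum>i. f i)"
  unfolding esum_def by (rule nn_integral_count_space_nat)

lemma esum_Sigma: "esum f (Sigma I A) = esum (\<lambda>i. esum (\<lambda>a. f (i, a)) (A i)) I"
proof -
  have "esum f (Sigma I A) = (\<integral>\<^sup>+p. f p * indicator (Sigma I A) p \<partial>count_space UNIV)"
    unfolding esum_def by (simp add: nn_integral_restrict_space[symmetric] restrict_count_space)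
  also have "\<dots> = (\<integral>\<^sup>+i. \<integral>\<^sup>+a. f (i, a) * indicator (Sigma I A) (i, a) \<partial>count_space UNIV \<partial>count_space UNIV)"
    by (rule nn_integral_fst_count_space[symmetric])
  also have "\<dots> = (\<integral>\<^sup>+i. (\<integral>\<^sup>+a. f (i, a) * indicator (A i) a \<partial>count_space UNIV) * indicator I i \<partial>count_space UNIV)"
    by (intro nn_integral_cong) (auto split: split_indicator simp: indicator_def intro!: nn_integral_cong)
  also have "\<dots> = esum (\<lambda>i. esum (\<lambda>a. f (i, a)) (A i)) I"
    unfolding esum_def by (simp add: nn_integral_restrict_space[symmetric] restrict_count_space)
  finally show ?thesis .
qed

lemma esum_image_le: "esum f (h ` A) \<le> esum (\<lambda>x. f (h x)) A"
proof -
  obtain B where B: "B \<subseteq> A" "inj_on h B" "h ` B = h ` A"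
    using subset_image_inj[of "h ` A" h A] by auto
  have "esum f (h ` A) = esum (\<lambda>x. f (h x)) B"
    using B esum_image[of h B f] by simp
  also have "\<dots> \<le> esum (\<lambda>x. f (h x)) A"
    by (rule esum_subset_mono[OF B(1)])
  finally show ?thesis .
qed

lemma esum_UN_le: "esum f (\<Union>i\<in>I. A i) \<le> esum (\<lambda>i. esum f (A i)) I"
proof -
  have "(\<Union>i\<in>I. A i) = snd ` Sigma I A" by force
  then show ?thesis
    using esum_image_le[of f snd "Sigma I A"] by (simp add: esum_Sigma)
qed

lemma esum_UN_disjoint:
  assumes "disjoint_family_on A I"
  shows "esum f (\<Union>i\<in>I. A i) = esum (\<lambda>i. esum f (A i)) I"
proof -
  have "bij_betw snd (Sigma I A) (\<Union>i\<in>I. A i)"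
    unfolding bij_betw_def
  proof
    show "inj_on snd (Sigma I A)"
      using assms unfolding disjoint_family_on_def inj_on_def by (clarsimp, blast)
  qed force
  then show ?thesis
    using esum_bij_betw[of snd "Sigma I A" _ f] by (simp add: esum_Sigma)
qed

lemma esum_Un_le: "esum f (A \<union> B) \<le> esum f A + esum f B"
proof -
  have "esum f (\<Union>i\<in>{True,False}. if i then A else B) \<le> esum (\<lambda>i. esum f (if i then A else B)) {True,False}"
    by (rule esum_UN_le)
  then show ?thesis by (simp add: esum_finite Un_commute add.commute)
qed

lemma esum_swap: "esum (\<lambda>x. esum (f x) B) A = esum (\<lambda>y. esum (\<lambda>x. f x y) A) B"
proof -
  have "esum (\<lambda>x. esum (f x) B) A = esum (\<lambda>p. f (fst p) (snd p)) (A \<times> B)"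
    by (simp add: esum_Sigma)
  also have "\<dots> = esum (\<lambda>p. f (snd p) (fst p)) (B \<times> A)"
    by (rule esum_bij_betw[of prod.swap "A \<times> B" "B \<times> A" "\<lambda>p. f (snd p) (fst p)", simplified])
       (auto simp: bij_betw_def inj_on_def)
  finally show ?thesis by (simp add: esum_Sigma)
qed

text \<open>Links the integral to \<open>infsum\<close> in the packing premeasure and lets later
  bounds be checked on finite subfamilies. If the supremum is finite, all level sets
  \<open>{f > e}\<close> are finite, so the support is countable and the integral is a
  series.\<close>

lemma esum_SUP_finite: "esum f A = (SUP F\<in>{F. finite F \<and> F \<subseteq> A}. sum f F)"
proof (rule antisym)
  let ?S = "SUP F\<in>{F. finite F \<and> F \<subseteq> A}. sum f F"
  show "?S \<le> esum f A"
    by (auto intro!: SUP_least simp: esum_finite[symmetric] esum_subset_mono)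
  show "esum f A \<le> ?S"
  proof (cases "?S = \<infinity>")
    case False
    define S where "S = ?S"
    have le: "sum f F \<le> S" if "finite F" "F \<subseteq> A" for F
      unfolding S_def using that by (intro SUP_upper) auto
    have fin: "finite {x\<in>A. e < f x}" if e: "0 < e" for e
    proof (rule ccontr)
      assume inf: "infinite {x\<in>A. e < f x}"
      have "of_nat n * e \<le> S" for n :: nat
      proof -
        obtain F where F: "F \<subseteq> {x\<in>A. e < f x}" "finite F" "card F = n"
          using infinite_arbitrarily_large[OF inf] by blast
        have "of_nat n * e = (\<Sum>x\<in>F. e)" using F by simp
        also have "\<dots> \<le> sum f F" using F by (intro sum_mono) (auto intro: less_imp_le)
        also have "\<dots> \<le> S" using F by (intro le) auto
        finally show ?thesis .
      qed
      then have "(SUP n. of_nat n * e) \<le> S" by (rule SUP_least)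
      moreover have "(SUP n. of_nat n * e) = (SUP n::nat. of_nat n) * e"
        by (rule SUP_mult_right_ennreal[symmetric])
      moreover have "(SUP n::nat. of_nat n :: ennreal) = \<infinity>" 
        by (simp add: ennreal_SUP_of_nat_eq_top)
      ultimately have "S = \<infinity>" using e by (auto simp: ennreal_top_mult top_unique split: if_splits)
      then show False using False by (simp add: S_def)
    qed
    have "{x\<in>A. f x \<noteq> 0} = (\<Union>n. {x\<in>A. ennreal (inverse (real (Suc n))) < f x})"
    proof (intro equalityI subsetI)
      fix x assume "x \<in> {x\<in>A. f x \<noteq> 0}"
      then have x: "x \<in> A" "f x \<noteq> 0" by auto
      then have "0 < f x" by (simp add: zero_less_iff_neq_zero)
      then obtain e where e: "0 < e" "e < f x" by (meson dense)
      then obtain r where r: "e = ennreal r" "0 < r"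
        by (cases e) (auto simp: ennreal_less_zero_iff)
      obtain n where "inverse (real (Suc n)) < r" using reals_Archimedean[OF r(2)] by auto
      then have "ennreal (inverse (real (Suc n))) < e"
        unfolding r by (intro ennreal_lessI r) 
      then have "ennreal (inverse (real (Suc n))) < f x"
        using e(2) by (rule less_trans)
      then show "x \<in> (\<Union>n. {x \<in> A. ennreal (inverse (real (Suc n))) < f x})"
        using x by blast
    next
      fix x assume "x \<in> (\<Union>n. {x\<in>A. ennreal (inverse (real (Suc n))) < f x})"
      then show "x \<in> {x\<in>A. f x \<noteq> 0}" by fastforce
    qed
    moreover have "countable (\<Union>n. {x\<in>A. ennreal (inverse (real (Suc n))) < f x})"
      by (rule countable_UN[OF countableI_type], rule countable_finite, rule fin) simp
    ultimately have cnt: "countable {x\<in>A. f x \<noteq> 0}" by simp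
    define B where "B = {x\<in>A. f x \<noteq> 0}"
    have B: "countable B" "B \<subseteq> A" using cnt by (auto simp: B_def)
    define E where "E = to_nat_on B ` B"
    have E: "from_nat_into B (to_nat_on B x) = x" if "x \<in> B" for x
      using B(1) that by simp
    have inj: "inj_on (from_nat_into B) E"
      unfolding E_def by (intro inj_onI) (auto simp: E)
    have BE: "from_nat_into B ` E = B"
      unfolding E_def by (force simp: E)
    have "esum f A = esum f B"
      unfolding esum_def B_def by (rule nn_integral_count_space_eq) auto
    also have "\<dots> = esum (\<lambda>n. f (from_nat_into B n)) E"
      using esum_image[OF inj, of f] by (simp add: BE)
    also have "\<dots> = (\<integral>\<^sup>+n. f (from_nat_into B n) * indicator E n \<partial>count_space UNIV)"
      unfolding esum_def by (simp add: nn_integral_restrict_space[symmetric] restrict_count_space)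
    also have "\<dots> = (\<Sum>n. f (from_nat_into B n) * indicator E n)"
      by (rule nn_integral_count_space_nat)
    also have "\<dots> \<le> S"
    proof (rule suminf_le_const[OF summableI])
      fix n
      have "(\<Sum>i<n. f (from_nat_into B i) * indicator E i) = (\<Sum>i\<in>{..<n} \<inter> E. f (from_nat_into B i))"
        by (intro sum.mono_neutral_cong_right) (auto split: split_indicator)
      also have "\<dots> = sum f (from_nat_into B ` ({..<n} \<inter> E))"
        by (subst sum.reindex) (auto intro: inj_on_subset[OF inj])
      also have "\<dots> \<le> S"
        using BE B(2) by (intro le) auto
      finally show "(\<Sum>i<n. f (from_nat_into B i) * indicator E i) \<le> S" .
    qed
    finally show ?thesis by (simp add: S_def)
  next
    case True
    show ?thesis unfolding True by simp
  qed
qed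

lemma esum_eq_infsum: "(\<Sum>\<^sub>\<infinity>x\<in>A. f x) = esum f A"
  by (simp add: esum_SUP_finite nonneg_infsum_complete)

lemma esum_le_iff: "esum f A \<le> C \<longleftrightarrow> (\<forall>F. finite F \<longrightarrow> F \<subseteq> A \<longrightarrow> sum f F \<le> C)"
  by (auto simp: esum_SUP_finite SUP_le_iff)

lemma less_esum_finite:
  assumes "c < esum f A" obtains F where "finite F" "F \<subseteq> A" "c < sum f F"
  using assms by (auto simp: esum_SUP_finite less_SUP_iff)

section \<open>Left continuity of power sums in the exponent\<close>

lemma powr_convex_combination:
  assumes "0 < x" "0 \<le> \<theta>" "\<theta> \<le> 1"
  shows "x powr ((1 - \<theta>) * s + \<theta> * t) \<le> (1 - \<theta>) * x powr s + \<theta> * x powr (t::real)"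
proof -
  have "exp ((1 - \<theta>) *\<^sub>R (s * ln x) + \<theta> *\<^sub>R (t * ln x)) \<le> (1 - \<theta>) * exp (s * ln x) + \<theta> * exp (t * ln x)"
    by (rule convex_onD[OF exp_convex]) (use assms in auto)
  then show ?thesis using assms by (simp add: powr_def algebra_simps)
qed

text \<open>Convexity of \<open>t \<mapsto> x powr t\<close> bounds the sum at \<open>t\<close> by
  the chord between its values at \<open>r\<close> and \<open>s\<close>. Finiteness at some
  \<open>r < s\<close> is what rules out a jump to infinity.\<close>

lemma esum_powr_less_left:
  fixes x :: "'a \<Rightarrow> real"
  assumes x: "\<And>i. i \<in> A \<Longrightarrow> 0 < x i"
    and less: "esum (\<lambda>i. ennreal (x i powr s)) A < c"
    and fin: "esum (\<lambda>i. ennreal (x i powr r)) A < \<infinity>" and "r < s"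
  shows "\<exists>t. r < t \<and> t < s \<and> esum (\<lambda>i. ennreal (x i powr t)) A < c"
proof -
  obtain c' where c': "esum (\<lambda>i. ennreal (x i powr s)) A < c'" "c' < c"
    using dense[OF less] by blast
  then obtain d where d: "c' = ennreal d" "0 \<le> d" by (cases c') auto
  obtain a where a: "esum (\<lambda>i. ennreal (x i powr s)) A = ennreal a" "0 \<le> a"
    using c' by (cases "esum (\<lambda>i. ennreal (x i powr s)) A") auto
  obtain b where b: "esum (\<lambda>i. ennreal (x i powr r)) A = ennreal b" "0 \<le> b"
    using fin by (cases "esum (\<lambda>i. ennreal (x i powr r)) A") auto
  have ad: "a < d" using c'(1) a d by (simp add: ennreal_less_iff)
  \<comment> \<open>\<open>\<theta> * (b + 1) \<le> d - a\<close> keeps the chord value below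
    \<open>d\<close>; the \<open>+ 1\<close> allows \<open>b = 0\<close>, and the cap
    \<open>1/2\<close> keeps \<open>\<theta> < 1\<close>.\<close>
  define \<theta> where "\<theta> = min (1/2) ((d - a) / (b + 1))"
  have \<theta>: "0 < \<theta>" "\<theta> < 1" using ad b by (auto simp: \<theta>_def)
  have "\<theta> \<le> (d - a) / (b + 1)" by (simp add: \<theta>_def)
  then have \<theta>b: "\<theta> * (b + 1) \<le> d - a" using b by (simp add: pos_le_divide_eq)
  define t where "t = (1 - \<theta>) * s + \<theta> * r"
  have t: "r < t" "t < s"
  proof -
    have "0 < (1 - \<theta>) * (s - r)" "0 < \<theta> * (s - r)" using \<theta> \<open>r < s\<close> by auto
    then show "r < t" "t < s" by (auto simp: t_def algebra_simps)
  qed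
  have "esum (\<lambda>i. ennreal (x i powr t)) A \<le>
      esum (\<lambda>i. ennreal (1 - \<theta>) * ennreal (x i powr s) + ennreal \<theta> * ennreal (x i powr r)) A"
  proof (rule esum_mono)
    fix i assume "i \<in> A"
    then have "x i powr t \<le> (1 - \<theta>) * x i powr s + \<theta> * x i powr r"
      unfolding t_def using \<theta> by (intro powr_convex_combination x) auto
    then show "ennreal (x i powr t) \<le> ennreal (1 - \<theta>) * ennreal (x i powr s) + ennreal \<theta> * ennreal (x i powr r)"
      using \<theta> by (simp add: ennreal_mult' ennreal_plus[symmetric] flip: ennreal_mult' del: ennreal_plus)
  qed
  also have "\<dots> = ennreal ((1 - \<theta>) * a + \<theta> * b)"
    using \<theta> a b by (simp add: esum_add esum_cmult ennreal_mult')
  also have "\<dots> \<le> c'"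
  proof -
    have "(1 - \<theta>) * a + \<theta> * b \<le> a + \<theta> * (b + 1)" using \<theta> a by (simp add: algebra_simps)
    also have "\<dots> \<le> d" using \<theta>b by simp
    finally show ?thesis unfolding d by (rule ennreal_leI)
  qed
  finally show ?thesis using t c' by auto
qed

section \<open>Power sums over pairs of positive integers\<close>

lemma esum_powr_finite:
  assumes "1 < s"
  shows "esum (\<lambda>m. ennreal (real m powr - s)) A < \<infinity>"
proof -
  have sm: "summable (\<lambda>m. real m powr - s)"
    using assms by (subst summable_real_powr_iff) auto
  have "esum (\<lambda>m. ennreal (real m powr - s)) A \<le> esum (\<lambda>m. ennreal (real m powr - s)) UNIV"
    by (rule esum_subset_mono) auto
  also have "\<dots> = ennreal (\<Sum>m. real m powr - s)"
    unfolding esum_nat by (rule suminf_ennreal2[OF _ sm]) auto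
  finally show ?thesis by (simp add: less_top le_less_trans)
qed

lemma esum_powr_prod_finite:
  assumes "1 < s"
  shows "esum (\<lambda>p. ennreal ((1 / (real (fst p) * real (snd p))) powr s)) (A \<times> B) < \<infinity>"
proof -
  have "(1 / (real m * real n)) powr s = real m powr - s * real n powr - s" for m n
    by (simp add: powr_divide powr_mult powr_minus field_simps)
  then have "esum (\<lambda>p. ennreal ((1 / (real (fst p) * real (snd p))) powr s)) (A \<times> B) =
     esum (\<lambda>m. ennreal (real m powr - s)) A * esum (\<lambda>m. ennreal (real m powr - s)) B"
    by (simp add: esum_Sigma esum_cmult esum_multc ennreal_mult)
  also have "\<dots> < \<infinity>"
    using esum_powr_finite[OF assms, of A] esum_powr_finite[OF assms, of B]
    by (simp add: ennreal_mult_less_top less_top)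
  finally show ?thesis .
qed

text \<open>A majorant of the inverse square of \<open>cmod (z + (m + n * \<tau>))\<close> for all
  \<open>z\<close> in the disc and all admissible \<tau>, because \<open>Re z \<ge> 0\<close> and
  \<open>Im z \<ge> - 1/2\<close> there.\<close>

definition grid_weight :: "nat \<Rightarrow> nat \<Rightarrow> real" where
  "grid_weight m n = 1 / ((real m)\<^sup>2 + (real n - 1/2)\<^sup>2)"

lemma grid_weight_pos: "1 \<le> n \<Longrightarrow> 0 < grid_weight m n"
  unfolding grid_weight_def by (auto intro!: divide_pos_pos add_nonneg_pos)

text \<open>On the antidiagonal \<open>m + n = k\<close> the two squared quantities add up to
  \<open>k - 1/2\<close>, so their squares add up to at least half of its square.\<close>

lemma grid_weight_square_le:
  assumes "1 \<le> m" "m < k"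
  shows "(grid_weight m (k - m))\<^sup>2 \<le> 4 / (real k - 1/2) ^ 4"
proof -
  define x y where "x = real m" and "y = real (k - m) - 1/2"
  have k: "real k - 1/2 = x + y" using assms by (simp add: x_def y_def of_nat_diff)
  have "(x + y)\<^sup>2 \<le> 2 * (x\<^sup>2 + y\<^sup>2)"
    using zero_le_power2[of "x - y"] by (simp add: power2_eq_square algebra_simps)
  then have "((x + y)\<^sup>2)\<^sup>2 \<le> (2 * (x\<^sup>2 + y\<^sup>2))\<^sup>2" by (intro power_mono) auto
  moreover have "((x + y)\<^sup>2)\<^sup>2 = (x + y) ^ 4" by (simp flip: power_mult)
  moreover have "(2 * (x\<^sup>2 + y\<^sup>2))\<^sup>2 = 4 * (x\<^sup>2 + y\<^sup>2)\<^sup>2" by (simp only: power_mult_distrib) simp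
  ultimately have le: "(x + y) ^ 4 \<le> 4 * (x\<^sup>2 + y\<^sup>2)\<^sup>2" by (simp only:)
  have "0 < x\<^sup>2" using assms by (simp add: x_def)
  then have p: "0 < (x\<^sup>2 + y\<^sup>2)\<^sup>2" by (auto intro!: add_pos_nonneg zero_less_power)
  have "0 < x + y" using assms by (simp flip: k)
  then have "1 / (x\<^sup>2 + y\<^sup>2)\<^sup>2 \<le> 4 / (x + y) ^ 4"
    using p le by (simp add: divide_simps)
  then show ?thesis
    by (simp add: grid_weight_def k power_divide flip: x_def y_def)
qed

definition antidiagonal_sum :: "nat \<Rightarrow> real" where
  "antidiagonal_sum K = (\<Sum>k<K. \<Sum>m\<in>{1..<k}. (grid_weight m (k - m))\<^sup>2)"

text \<open>The antidiagonal \<open>m + n = K\<close> has \<open>K - 1\<close> terms, hence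
  contributes at most \<open>4 / x ^ 3\<close> with \<open>x = K - 1/2\<close>. This is dominated by
  the telescoping difference of \<open>2 / (K - 1) ^ 2\<close> and \<open>2 / K ^ 2\<close>, so the
  tail from 5 on is at most \<open>2 / 4 ^ 2 = 1/8\<close>.\<close>

lemma antidiagonal_sum_le: "5 \<le> K \<Longrightarrow> antidiagonal_sum K \<le> antidiagonal_sum 5 + 1/8 - 2 / (real K - 1)\<^sup>2"
proof (induction K rule: dec_induct)
  case (step K)
  define x where "x = real K - 1/2"
  have x: "9/2 \<le> x" using step by (simp add: x_def)
  have "(\<Sum>m\<in>{1..<K}. (grid_weight m (K - m))\<^sup>2) \<le> (\<Sum>m\<in>{1..<K}. 4 / x ^ 4)"
    unfolding x_def by (intro sum_mono grid_weight_square_le) auto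
  also have "\<dots> = real (K - 1) * (4 / x ^ 4)" by simp
  also have "\<dots> \<le> x * (4 / x ^ 4)"
    using step by (intro mult_right_mono) (auto simp: x_def)
  also have "\<dots> = 4 / x ^ 3" using x by (simp add: field_simps power_numeral_reduce)
  also have "\<dots> \<le> 2 / (x - 1/2)\<^sup>2 - 2 / (x + 1/2)\<^sup>2"
  proof -
    have nz: "(x - 1/2)\<^sup>2 * (x + 1/2)\<^sup>2 > 0" using x by simp
    have "2 / (x - 1/2)\<^sup>2 - 2 / (x + 1/2)\<^sup>2 = 2 * ((x + 1/2)\<^sup>2 - (x - 1/2)\<^sup>2) / ((x - 1/2)\<^sup>2 * (x + 1/2)\<^sup>2)"
      using x by (simp add: field_simps)
    also have "(x + 1/2)\<^sup>2 - (x - 1/2)\<^sup>2 = 2 * x" by (simp add: power2_eq_square algebra_simps)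
    finally have e: "2 / (x - 1/2)\<^sup>2 - 2 / (x + 1/2)\<^sup>2 = 4 * x / ((x - 1/2)\<^sup>2 * (x + 1/2)\<^sup>2)" by simp
    have "(x - 1/2)\<^sup>2 * (x + 1/2)\<^sup>2 = ((x - 1/2) * (x + 1/2))\<^sup>2" by (simp add: power_mult_distrib)
    also have "\<dots> = (x\<^sup>2 - 1/4)\<^sup>2" by (simp add: power2_eq_square algebra_simps)
    also have "\<dots> \<le> (x\<^sup>2)\<^sup>2"
    proof (rule power_mono)
      have "(9/2)\<^sup>2 \<le> x\<^sup>2" using x by (intro power_mono) auto
      then show "0 \<le> x\<^sup>2 - 1/4" by (simp add: power_divide)
    qed simp
    finally have "(x - 1/2)\<^sup>2 * (x + 1/2)\<^sup>2 \<le> x ^ 4" by simp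
    then have "4 * x / x ^ 4 \<le> 4 * x / ((x - 1/2)\<^sup>2 * (x + 1/2)\<^sup>2)"
      using x nz by (intro divide_left_mono) auto
    moreover have "4 / x ^ 3 = 4 * x / x ^ 4" using x by (simp add: power_numeral_reduce)
    ultimately show ?thesis by (simp add: e)
  qed
  finally have "(\<Sum>m\<in>{1..<K}. (grid_weight m (K - m))\<^sup>2) \<le> 2 / (real K - 1)\<^sup>2 - 2 / (real K)\<^sup>2"
    by (simp add: x_def)
  then show ?case using step.IH by (simp add: antidiagonal_sum_def)
qed (simp add: power2_eq_square)

text \<open>Only the six pairs with \<open>m + n \<le> 4\<close> occur, \<open>(1, 1)\<close> alone
  giving \<open>0.64\<close>. The cut at 5 leaves room for the tail:
  \<open>0.85 + 0.125 < 0.98\<close>.\<close>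

lemma antidiagonal_sum_5: "antidiagonal_sum 5 \<le> 85/100"
  by (simp add: antidiagonal_sum_def grid_weight_def eval_nat_numeral lessThan_Suc atLeastLessThanSuc power2_eq_square)

lemma esum_grid_weight_less_1:
  "esum (\<lambda>p. ennreal (grid_weight (fst p) (snd p) powr 2)) ({1..} \<times> {1..}) < 1"
proof -
  have "esum (\<lambda>p. ennreal (grid_weight (fst p) (snd p) powr 2)) ({1..} \<times> {1..}) \<le> ennreal (98/100)"
    unfolding esum_le_iff
  proof (intro allI impI)
    fix F :: "(nat \<times> nat) set" assume F: "finite F" "F \<subseteq> {1..} \<times> {1..}"
    obtain K where K: "\<And>p. p \<in> F \<Longrightarrow> fst p + snd p < K"
      using finite_nat_set_iff_bounded[of "(\<lambda>p. fst p + snd p) ` F"] F(1) by auto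
    define K' where "K' = max K 5"
    let ?S = "SIGMA k:{..<K'}. {1..<k}"
    let ?h = "\<lambda>(k, m). (m, k - m)"
    have "F \<subseteq> ?h ` ?S"
    proof
      fix p assume p: "p \<in> F"
      then have "(fst p + snd p, fst p) \<in> ?S" using F(2) K[OF p] by (auto simp: K'_def)
      then show "p \<in> ?h ` ?S" by (intro image_eqI[of _ _ "(fst p + snd p, fst p)"]) auto
    qed
    have g: "grid_weight (fst p) (snd p) powr 2 = (grid_weight (fst p) (snd p))\<^sup>2" for p
      by (simp add: grid_weight_def powr_numeral)
    have "(\<Sum>p\<in>F. grid_weight (fst p) (snd p) powr 2) \<le> (\<Sum>p\<in>?h ` ?S. (grid_weight (fst p) (snd p))\<^sup>2)"
      unfolding g using \<open>F \<subseteq> ?h ` ?S\<close> by (intro sum_mono2) auto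
    also have "\<dots> = (\<Sum>q\<in>?S. (grid_weight (fst (?h q)) (snd (?h q)))\<^sup>2)"
      by (subst sum.reindex) (auto simp: inj_on_def o_def)
    also have "\<dots> = antidiagonal_sum K'"
      unfolding antidiagonal_sum_def by (subst sum.Sigma) (auto intro!: sum.cong)
    also have "\<dots> \<le> antidiagonal_sum 5 + 1/8 - 2 / (real K' - 1)\<^sup>2"
      by (rule antidiagonal_sum_le) (simp add: K'_def)
    also have "\<dots> \<le> antidiagonal_sum 5 + 1/8" by simp
    also have "\<dots> \<le> 98/100" using antidiagonal_sum_5 by simp
    finally show "(\<Sum>p\<in>F. ennreal (grid_weight (fst p) (snd p) powr 2)) \<le> ennreal (98/100)"
      by (subst sum_ennreal) (auto intro: ennreal_leI)
  qed
  also have "\<dots> < 1" by (simp add: ennreal_less_iff flip: ennreal_1)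
  finally show ?thesis .
qed

lemma esum_grid_weight_le_1:
  obtains s where "0 < s" "s < 2" "esum (\<lambda>p. ennreal (grid_weight (fst p) (snd p) powr s)) ({1..} \<times> {1..}) \<le> 1"
proof -
  let ?A = "{1..} \<times> {1..} :: (nat \<times> nat) set"
  \<comment> \<open>The comparison exponent has to lie strictly between 1 and 2; the product bound
    then gives a product of two convergent series.\<close>
  have "esum (\<lambda>p. ennreal (grid_weight (fst p) (snd p) powr (3/2))) ?A \<le>
      esum (\<lambda>p. ennreal ((1 / (real (fst p) * real (snd p))) powr (3/2))) ?A"
  proof (rule esum_mono, rule ennreal_leI, rule powr_mono2)
    fix p assume "p \<in> ?A"
    then obtain m n where p: "p = (m, n)" "1 \<le> m" "1 \<le> n" by (cases p) auto
    then show "0 \<le> grid_weight (fst p) (snd p)"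
      using grid_weight_pos[of n m] by (simp add: less_imp_le)
    have "real m * real n \<le> (real m)\<^sup>2 + (real n - 1/2)\<^sup>2"
    proof -
      have "real m * real n \<le> 2 * real m * (real n - 1/2)"
        using p mult_left_mono[of 1 "real n" "real m"] by (simp add: algebra_simps)
      also have "\<dots> \<le> (real m)\<^sup>2 + (real n - 1/2)\<^sup>2"
        using zero_le_power2[of "real m - (real n - 1/2)"] by (simp add: power2_eq_square algebra_simps)
      finally show ?thesis .
    qed
    then show "grid_weight (fst p) (snd p) \<le> 1 / (real (fst p) * real (snd p))"
      using p unfolding grid_weight_def by (auto intro!: divide_left_mono mult_pos_pos add_pos_nonneg)
  qed simp
  also have "\<dots> < \<infinity>" by (rule esum_powr_prod_finite) simp
  finally have fin: "esum (\<lambda>p. ennreal (grid_weight (fst p) (snd p) powr (3/2))) ?A < \<infinity>" .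
  have pos: "0 < grid_weight (fst p) (snd p)" if "p \<in> ?A" for p
    using that by (auto intro: grid_weight_pos)
  obtain t where "3/2 < t" "t < 2" "esum (\<lambda>p. ennreal (grid_weight (fst p) (snd p) powr t)) ?A < 1"
    using esum_powr_less_left[OF pos esum_grid_weight_less_1 fin] by fastforce
  then show ?thesis using that[of t] by simp
qed

section \<open>Hausdorff and packing measures\<close>

lemma hausdorff_premeasure_le:
  fixes U :: "'i \<Rightarrow> 'a::metric_space set"
  assumes K: "countable K" and \<delta>: "0 \<le> \<delta>"
    and U: "\<And>i. i \<in> K \<Longrightarrow> bounded (U i)" "\<And>i. i \<in> K \<Longrightarrow> diameter (U i) \<le> \<delta>"
    and cover: "A \<subseteq> (\<Union>i\<in>K. U i)"
  shows "hausdorff_premeasure s \<delta> A \<le> esum (\<lambda>i. diam_gauge s (U i)) K"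
proof -
  define E where "E = to_nat_on K ` K"
  define V where "V n = (if n \<in> E then U (from_nat_into K n) else {})" for n
  have VE: "V (to_nat_on K i) = U i" if "i \<in> K" for i
    using that K by (simp add: V_def E_def)
  have "V \<in> {U. (\<forall>i. bounded (U i) \<and> diameter (U i) \<le> \<delta>) \<and> A \<subseteq> (\<Union>i. U i)}"
  proof (intro CollectI conjI allI)
    show "bounded (V n)" "diameter (V n) \<le> \<delta>" for n
      using U K \<delta> by (auto simp: V_def E_def)
    show "A \<subseteq> (\<Union>i. V i)"
      using cover VE by blast
  qed
  then have "hausdorff_premeasure s \<delta> A \<le> (\<Sum>i. diam_gauge s (V i))"
    unfolding hausdorff_premeasure_def by (rule INF_lower)
  also have "\<dots> = esum (\<lambda>n. diam_gauge s (V n)) E"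
    unfolding esum_nat[symmetric] esum_def
    by (rule nn_integral_count_space_eq) (auto simp: V_def diam_gauge_def)
  also have "\<dots> = esum (\<lambda>i. diam_gauge s (U i)) K"
    unfolding E_def by (subst esum_image[OF inj_on_to_nat_on[OF K]]) (auto intro!: esum_cong simp: VE)
  finally show ?thesis .
qed

lemma diam_gauge_eq: "0 < s \<Longrightarrow> diam_gauge s U = ennreal (diameter U powr s)"
  by (simp add: diam_gauge_def)

lemma diam_gauge_antimono:
  assumes "bounded U" "diameter U \<le> 1" "0 \<le> s" "s \<le> t"
  shows "diam_gauge t U \<le> diam_gauge s U"
proof -
  have d: "0 \<le> diameter U" using assms by (rule_tac diameter_ge_0)
  have "diameter U powr t \<le> diameter U powr s"
    using assms d by (intro powr_mono') auto
  moreover have "diameter U powr t \<le> 1" using assms d by (intro powr_le1) auto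
  ultimately show ?thesis using assms by (auto simp: diam_gauge_def ennreal_leI)
qed

lemma hausdorff_premeasure_antimono:
  assumes "0 \<le> s" "s \<le> t" "\<delta> \<le> 1"
  shows "hausdorff_premeasure t \<delta> A \<le> hausdorff_premeasure s \<delta> A"
  unfolding hausdorff_premeasure_def
proof (rule INF_mono)
  fix U :: "nat \<Rightarrow> 'a set"
  assume U: "U \<in> {U. (\<forall>i. bounded (U i) \<and> diameter (U i) \<le> \<delta>) \<and> A \<subseteq> (\<Union>i. U i)}"
  then have "(\<Sum>i. diam_gauge t (U i)) \<le> (\<Sum>i. diam_gauge s (U i))"
    using assms by (intro suminf_le diam_gauge_antimono summableI) (auto intro: order_trans)
  then show "\<exists>V\<in>{U. (\<forall>i. bounded (U i) \<and> diameter (U i) \<le> \<delta>) \<and> A \<subseteq> (\<Union>i. U i)}.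
      (\<Sum>i. diam_gauge t (V i)) \<le> (\<Sum>i. diam_gauge s (U i))"
    using U by blast
qed

text \<open>Comparison of areas. It will limit how many incomparable cylinders of similar size can
  meet a small set.\<close>

lemma card_disjoint_balls_le:
  fixes c :: "'i \<Rightarrow> complex"
  assumes "finite S" "disjoint_family_on (\<lambda>i. ball (c i) \<rho>) S" "0 < \<rho>" "0 < R"
    and sub: "\<And>i. i \<in> S \<Longrightarrow> ball (c i) \<rho> \<subseteq> ball x R"
  shows "real (card S) * \<rho>\<^sup>2 \<le> R\<^sup>2"
proof -
  have "of_nat (card S) * ennreal (unit_ball_vol 2 * \<rho>\<^sup>2) = (\<Sum>i\<in>S. emeasure lborel (ball (c i) \<rho>))"
    using assms by (simp add: emeasure_ball)
  also have "\<dots> = emeasure lborel (\<Union>i\<in>S. ball (c i) \<rho>)"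
    using assms by (intro sum_emeasure) auto
  also have "\<dots> \<le> emeasure lborel (ball x R)"
    using sub by (intro emeasure_mono) auto
  also have "\<dots> = ennreal (unit_ball_vol 2 * R\<^sup>2)"
    using assms by (simp add: emeasure_ball)
  finally have "real (card S) * (unit_ball_vol 2 * \<rho>\<^sup>2) \<le> unit_ball_vol 2 * R\<^sup>2"
    by (simp add: ennreal_of_nat_eq_real_of_nat flip: ennreal_mult)
  moreover have "0 < unit_ball_vol (2::real)" by simp
  ultimately show ?thesis by (simp add: mult.left_commute)
qed

lemma packing_premeasure_empty: "packing_premeasure s ({} :: 'a::metric_space set) = 0"
proof -
  have "packings 1 ({} :: 'a set) = {{}}"
    by (auto simp: packings_def disjoint_family_on_def)
  then have "packing_premeasure_le s 1 ({} :: 'a set) = 0"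
    by (simp add: packing_premeasure_le_def)
  moreover have "packing_premeasure s ({} :: 'a set) \<le> packing_premeasure_le s 1 ({} :: 'a set)"
    unfolding packing_premeasure_def by (rule INF_lower) simp
  ultimately show ?thesis by simp
qed

lemma packing_measure_le_premeasure: "packing_measure s A \<le> packing_premeasure s A"
proof -
  define U where "U i = (if i = 0 then A else {})" for i :: nat
  have "packing_measure s A \<le> (\<Sum>i. packing_premeasure s (U i))"
    unfolding packing_measure_def by (rule INF_lower) (auto simp: U_def)
  also have "\<dots> = (\<Sum>i\<in>{0}. packing_premeasure s (U i))"
    by (rule suminf_finite) (auto simp: U_def packing_premeasure_empty)
  finally show ?thesis by (simp add: U_def)
qed

lemma packing_premeasure_le_mono: "\<delta> \<le> \<epsilon> \<Longrightarrow> packing_premeasure_le s \<delta> A \<le> packing_premeasure_le s \<epsilon> A"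
  unfolding packing_premeasure_le_def packings_def
  by (intro SUP_subset_mono) auto

lemma packing_premeasure_antimono:
  assumes "s \<le> t"
  shows "packing_premeasure t A \<le> packing_premeasure s A"
  unfolding packing_premeasure_def[of s]
proof (rule INF_greatest)
  fix \<delta> :: real assume "\<delta> \<in> {0<..}"
  then have "packing_premeasure t A \<le> packing_premeasure_le t (min \<delta> (1/2)) A"
    unfolding packing_premeasure_def by (intro INF_lower) auto
  also have "\<dots> \<le> packing_premeasure_le s (min \<delta> (1/2)) A"
    unfolding packing_premeasure_le_def
  proof (rule SUP_mono)
    fix B assume B: "B \<in> packings (min \<delta> (1/2)) A"
    have "esum (\<lambda>(x, r). ennreal ((2 * r) powr t)) B \<le> esum (\<lambda>(x, r). ennreal ((2 * r) powr s)) B"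
    proof (rule esum_mono)
      fix p assume "p \<in> B"
      then have "0 < snd p" "snd p \<le> 1/2" using B by (auto simp: packings_def)
      then show "(case p of (x, r) \<Rightarrow> ennreal ((2 * r) powr t)) \<le> (case p of (x, r) \<Rightarrow> ennreal ((2 * r) powr s))"
        using assms by (auto simp: split_beta intro!: ennreal_leI powr_mono')
    qed
    then show "\<exists>C\<in>packings (min \<delta> (1/2)) A. (\<Sum>\<^sub>\<infinity>(x, r)\<in>B. ennreal ((2 * r) powr t)) \<le> (\<Sum>\<^sub>\<infinity>(x, r)\<in>C. ennreal ((2 * r) powr s))"
      unfolding esum_eq_infsum using B by blast
  qed
  also have "\<dots> \<le> packing_premeasure_le s \<delta> A"
    by (rule packing_premeasure_le_mono) simp
  finally show "packing_premeasure t A \<le> packing_premeasure_le s \<delta> A" .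
qed

lemma packing_measure_antimono:
  assumes "s \<le> t"
  shows "packing_measure t A \<le> packing_measure s A"
  unfolding packing_measure_def
  by (rule INF_mono) (auto intro!: suminf_le summableI packing_premeasure_antimono assms)

text \<open>For balls of radius at most \<delta>, raising the exponent from \<open>s\<close> to
  \<open>t\<close> gains the factor \<open>(2 * \<delta>) powr (t - s)\<close>, which tends to 0
  with \<delta>.\<close>

lemma packing_premeasure_eq_0:
  assumes fin: "packing_premeasure_le s 1 A < \<infinity>" and "s < t"
  shows "packing_premeasure t A = 0"
proof -
  obtain c where c: "packing_premeasure_le s 1 A = ennreal c" "0 \<le> c"
    using fin by (cases "packing_premeasure_le s 1 A") auto
  have "packing_premeasure t A \<le> 0"
  proof (rule ennreal_le_epsilon)
    fix e :: real assume e: "0 < e"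
    define \<delta> where "\<delta> = min 1 ((e / (c + 1)) powr (1 / (t - s)) / 2)"
    have \<delta>: "0 < \<delta>" "\<delta> \<le> 1" using e c by (auto simp: \<delta>_def)
    have "(2 * \<delta>) powr (t - s) \<le> ((e / (c + 1)) powr (1 / (t - s))) powr (t - s)"
      using \<delta> assms(2) by (intro powr_mono2) (auto simp: \<delta>_def)
    also have "\<dots> = e / (c + 1)" using e c assms(2) by (simp add: powr_powr)
    finally have le: "(2 * \<delta>) powr (t - s) \<le> e / (c + 1)" .
    have "packing_premeasure t A \<le> packing_premeasure_le t \<delta> A"
      unfolding packing_premeasure_def using \<delta> by (intro INF_lower) auto
    also have "\<dots> \<le> ennreal ((2 * \<delta>) powr (t - s)) * ennreal c"
      unfolding packing_premeasure_le_def
    proof (rule SUP_least)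
      fix B assume B: "B \<in> packings \<delta> A"
      have "esum (\<lambda>(x, r). ennreal ((2 * r) powr t)) B \<le>
          esum (\<lambda>p. ennreal ((2 * \<delta>) powr (t - s)) * (case p of (x, r) \<Rightarrow> ennreal ((2 * r) powr s))) B"
      proof (rule esum_mono)
        fix p assume "p \<in> B"
        then have r: "0 < snd p" "snd p \<le> \<delta>" using B by (auto simp: packings_def)
        have "(2 * snd p) powr t = (2 * snd p) powr ((t - s) + s)" by simp
        also have "\<dots> = (2 * snd p) powr (t - s) * (2 * snd p) powr s" by (rule powr_add)
        also have "\<dots> \<le> (2 * \<delta>) powr (t - s) * (2 * snd p) powr s"
          using r assms(2) by (intro mult_right_mono powr_mono2) auto
        finally show "(case p of (x, r) \<Rightarrow> ennreal ((2 * r) powr t))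
          \<le> ennreal ((2 * \<delta>) powr (t - s)) * (case p of (x, r) \<Rightarrow> ennreal ((2 * r) powr s))"
          by (simp add: split_beta ennreal_leI flip: ennreal_mult)
      qed
      also have "\<dots> = ennreal ((2 * \<delta>) powr (t - s)) * (\<Sum>\<^sub>\<infinity>(x, r)\<in>B. ennreal ((2 * r) powr s))"
        by (simp add: esum_cmult esum_eq_infsum)
      also have "\<dots> \<le> ennreal ((2 * \<delta>) powr (t - s)) * ennreal c"
      proof (intro mult_left_mono)
        have "B \<in> packings 1 A" using B \<delta> by (auto simp: packings_def)
        then show "(\<Sum>\<^sub>\<infinity>(x, r)\<in>B. ennreal ((2 * r) powr s)) \<le> ennreal c"
          unfolding c(1)[symmetric] packing_premeasure_le_def by (rule SUP_upper)
      qed simp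
      finally show "(\<Sum>\<^sub>\<infinity>(x, r)\<in>B. ennreal ((2 * r) powr t)) \<le> ennreal ((2 * \<delta>) powr (t - s)) * ennreal c"
        by (simp add: esum_eq_infsum)
    qed
    also have "\<dots> \<le> ennreal e"
    proof -
      have "(2 * \<delta>) powr (t - s) * c \<le> e / (c + 1) * (c + 1)" using le c e by (intro mult_mono) auto
      then show ?thesis using c e by (simp add: ennreal_leI flip: ennreal_mult)
    qed
    finally show "packing_premeasure t A \<le> 0 + ennreal e" by simp
  qed
  then show ?thesis by simp
qed

section \<open>Words and continued fraction maps\<close>

primrec cf :: "complex list \<Rightarrow> complex \<Rightarrow> complex" where
  "cf [] z = z"
| "cf (b # w) z = gccf_map b (cf w z)"

text \<open>The denominator of the Moebius map \<open>cf w\<close>, as the product of the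
  denominators met at the single steps. That this product is affine in \<open>z\<close> is
  \<open>cden_affine\<close>.\<close>

primrec cden :: "complex list \<Rightarrow> complex \<Rightarrow> complex" where
  "cden [] z = 1"
| "cden (b # w) z = (cf w z + b) * cden w z"

text \<open>By \<open>cf_diff\<close> below, the derivative of \<open>cf w\<close> at \<open>z\<close> has modulus \<open>1 / (cmod (cden w z))\<^sup>2\<close>.\<close>

definition deriv0 :: "complex list \<Rightarrow> real" where
  "deriv0 w = 1 / (cmod (cden w 0))\<^sup>2"

lemma cf_append: "cf (u @ v) z = cf u (cf v z)"
  by (induction u) auto

lemma cden_append: "cden (u @ v) z = cden u (cf v z) * cden v z"
  by (induction u) (auto simp: cf_append)

lemma deriv0_Nil [simp]: "deriv0 [] = 1"
  by (simp add: deriv0_def)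

lemma deriv0_singleton: "deriv0 [b] = 1 / (cmod b)\<^sup>2"
  by (simp add: deriv0_def)

section \<open>The disc under inversion\<close>

lemma cmod_minus_half: "(cmod (z - 1/2))\<^sup>2 = (cmod z)\<^sup>2 - Re z + (1/2)\<^sup>2"
  unfolding cmod_power2 by (simp add: power2_eq_square algebra_simps)

text \<open>For \<open>z \<noteq> 0\<close>, division by the squared modulus turns the right-hand
  side into \<open>1 \<le> Re (1 / z)\<close>. So inversion exchanges the disc without 0 and a
  half-plane, into which every letter translates the disc.\<close>

lemma disc_iff: "z \<in> gccf_disc \<longleftrightarrow> (cmod z)\<^sup>2 \<le> Re z"
proof -
  have "z \<in> gccf_disc \<longleftrightarrow> (cmod (z - 1/2))\<^sup>2 \<le> (1/2)\<^sup>2"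
    unfolding gccf_disc_def using abs_le_square_iff[of "cmod (z - 1/2)" "1/2"] by simp
  then show ?thesis unfolding cmod_minus_half by simp
qed

lemma open_disc_iff: "z \<in> ball (1/2) (1/2) \<longleftrightarrow> (cmod z)\<^sup>2 < Re z"
proof -
  have "z \<in> ball (1/2) (1/2) \<longleftrightarrow> (cmod (z - 1/2))\<^sup>2 < (1/2)\<^sup>2"
    using abs_le_square_iff[of "1/2" "cmod (z - 1/2)"]
    by (simp add: dist_norm norm_minus_commute flip: not_le)
  then show ?thesis unfolding cmod_minus_half by simp
qed

lemma open_disc_subset: "ball (1/2) (1/2) \<subseteq> gccf_disc"
  by (auto simp: disc_iff open_disc_iff simp del: mem_ball)

lemma zero_in_disc [simp]: "0 \<in> gccf_disc"
  by (simp add: disc_iff)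

lemma disc_bounds:
  assumes "z \<in> gccf_disc"
  shows "cmod z \<le> 1" "0 \<le> Re z" "Re z \<le> 1" "- (1/2) \<le> Im z" "Im z \<le> 1/2"
proof -
  have *: "(Re z)\<^sup>2 + (Im z)\<^sup>2 \<le> Re z"
    using assms by (simp add: disc_iff cmod_power2)
  then show re0: "0 \<le> Re z" by (smt (verit) zero_le_power2)
  have "(Re z)\<^sup>2 \<le> Re z" using * by (smt (verit) zero_le_power2)
  then show re1: "Re z \<le> 1"
    using power2_le_imp_le[of "Re z" 1] re0 mult_left_le_imp_le[of "Re z" "Re z" 1]
    by (cases "Re z = 0") (auto simp: power2_eq_square)
  have "(cmod z)\<^sup>2 \<le> 1\<^sup>2" using assms re1 by (simp add: disc_iff)
  then show "cmod z \<le> 1" by (rule power2_le_imp_le) simp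
  have "(Im z)\<^sup>2 \<le> (1/2)\<^sup>2"
    using * zero_le_power2[of "Re z - 1/2"] by (simp add: power2_eq_square algebra_simps)
  then have "\<bar>Im z\<bar> \<le> \<bar>1/2\<bar>" by (simp only: abs_le_square_iff)
  then show "- (1/2) \<le> Im z" "Im z \<le> 1/2" by linarith+
qed

lemma Re_one_divide: "Re (1 / z) = Re z / (cmod z)\<^sup>2"
  by (simp add: Re_divide cmod_power2)

lemma Re_inverse_ge_1:
  assumes "z \<in> gccf_disc" "z \<noteq> 0"
  shows "1 \<le> Re (1 / z)"
  using assms unfolding Re_one_divide by (simp add: disc_iff)

lemma inverse_in_disc:
  assumes "1 \<le> Re z"
  shows "1 / z \<in> gccf_disc"
proof -
  have "0 < (cmod z)\<^sup>2" using assms by auto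
  then show ?thesis
    using assms unfolding disc_iff Re_one_divide by (simp add: norm_divide power_divide divide_right_mono)
qed

lemma inverse_in_open_disc:
  assumes "1 < Re z"
  shows "1 / z \<in> ball (1/2) (1/2)"
proof -
  have "0 < (cmod z)\<^sup>2" using assms by auto
  then show ?thesis
    using assms unfolding open_disc_iff Re_one_divide
    by (simp add: norm_divide power_divide divide_strict_right_mono)
qed

text \<open>The modulus is at least \<open>1 - cmod \<xi>\<close> by the triangle inequality, and at
  least \<open>cmod \<xi>\<close> because \<open>1 / \<xi> + z\<close> has real part at least 1; one
  of the two bounds is at least \<open>1/2\<close>. The factors \<open>1/2\<close> and 2 are the
  source of the distortion constants.\<close>

lemma one_plus_mult_disc:
  assumes "\<xi> \<in> gccf_disc" "z \<in> gccf_disc"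
  shows "1/2 \<le> cmod (1 + \<xi> * z)" "cmod (1 + \<xi> * z) \<le> 2"
proof -
  have 1: "cmod (\<xi> * z) \<le> cmod \<xi>"
    using disc_bounds(1)[OF assms(2)] by (simp add: norm_mult mult_left_le)
  have "cmod \<xi> \<le> 1" using disc_bounds(1)[OF assms(1)] .
  then show "cmod (1 + \<xi> * z) \<le> 2"
    using norm_triangle_ineq[of 1 "\<xi> * z"] 1 by simp
  have a: "1 - cmod \<xi> \<le> cmod (1 + \<xi> * z)"
    using norm_diff_ineq[of 1 "\<xi> * z"] 1 by simp
  have "cmod \<xi> \<le> cmod (1 + \<xi> * z)"
  proof (cases "\<xi> = 0")
    case False
    have "1 \<le> Re (1 / \<xi> + z)"
      using Re_inverse_ge_1[OF assms(1) False] disc_bounds(2)[OF assms(2)] by simp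
    then have "1 \<le> cmod (1 / \<xi> + z)" using complex_Re_le_cmod order_trans by blast
    then have "cmod \<xi> * 1 \<le> cmod \<xi> * cmod (1 / \<xi> + z)"
      by (rule mult_left_mono) simp
    also have "\<dots> = cmod (1 + \<xi> * z)"
      using False by (simp add: norm_mult[symmetric] algebra_simps)
    finally show ?thesis by simp
  qed simp
  then show "1/2 \<le> cmod (1 + \<xi> * z)" using a by linarith
qed

lemma gccf_word_eq: "gccf_word w n = cf (map (\<lambda>i. w (Suc i)) [0..<n])"
  by (induction n) (auto simp: cf_append fun_eq_iff)

section \<open>Weighted words and the greedy choice of letters\<close>

definition words :: "'a set \<Rightarrow> nat \<Rightarrow> 'a list set" where
  "words F n = {w \<in> lists F. length w = n}"

lemma words_0 [simp]: "words F 0 = {[]}"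
  by (auto simp: words_def)

lemma words_1: "words F (Suc 0) = (\<lambda>b. [b]) ` F"
  by (auto simp: words_def length_Suc_conv)

lemma bij_betw_words_append:
  "bij_betw (\<lambda>(u, v). u @ v) (words F m \<times> words F n) (words F (m + n))"
  unfolding bij_betw_def
proof
  show "inj_on (\<lambda>(u, v). u @ v) (words F m \<times> words F n)"
    by (auto simp: inj_on_def words_def)
  show "(\<lambda>(u, v). u @ v) ` (words F m \<times> words F n) = words F (m + n)"
  proof (intro equalityI subsetI)
    fix w assume w: "w \<in> words F (m + n)"
    then have "take m w \<in> words F m" "drop m w \<in> words F n"
      by (auto simp: words_def dest: in_set_takeD in_set_dropD)
    then show "w \<in> (\<lambda>(u, v). u @ v) ` (words F m \<times> words F n)"
      by (intro image_eqI[of _ _ "(take m w, drop m w)"]) auto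
  qed (auto simp: words_def)
qed

lemma esum_words_append:
  "esum f (words F (m + n)) = esum (\<lambda>u. esum (\<lambda>v. f (u @ v)) (words F n)) (words F m)"
  using esum_bij_betw[OF bij_betw_words_append, of f F m n] by (simp add: esum_Sigma split_beta)

lemma esum_words_1: "esum f (words F (Suc 0)) = esum (\<lambda>b. f [b]) F"
  by (simp add: words_1 esum_image inj_on_def)

definition weight :: "real \<Rightarrow> complex list \<Rightarrow> ennreal" where
  "weight s w = ennreal (deriv0 w powr s)"

definition part_sum :: "complex set \<Rightarrow> real \<Rightarrow> nat \<Rightarrow> ennreal" where
  "part_sum F s n = esum (weight s) (words F n)"

text \<open>The factor 4 of \<open>deriv0_append\<close>, raised to the exponent
  \<open>s\<close>.\<close>

definition distort :: "real \<Rightarrow> ennreal" where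
  "distort s = ennreal (4 powr s)"

lemma distort_pos [simp]: "0 < distort s" "distort s \<noteq> 0" "distort s < \<infinity>" "distort s \<noteq> \<infinity>"
  "distort s < top" "distort s \<noteq> top"
  by (auto simp: distort_def)

lemma one_le_distort: "0 \<le> s \<Longrightarrow> 1 \<le> distort s"
  unfolding distort_def by (simp add: ge_one_powr_ge_zero)

lemma part_sum_0 [simp]: "part_sum F s 0 = 1"
  by (simp add: part_sum_def esum_finite weight_def)

lemma part_sum_1: "part_sum F s (Suc 0) = esum (\<lambda>b. ennreal ((1 / (cmod b)\<^sup>2) powr s)) F"
  by (simp add: part_sum_def esum_words_1 weight_def deriv0_singleton)

lemma words_mono: "F \<subseteq> G \<Longrightarrow> words F n \<subseteq> words G n"
  by (auto simp: words_def)

lemma part_sum_mono_set: "F \<subseteq> G \<Longrightarrow> part_sum F s n \<le> part_sum G s n"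
  unfolding part_sum_def by (intro esum_subset_mono words_mono)

text \<open>Greedy choice: extend the word so that the words of \<open>W\<close> still ahead keep less total mass than
  the word itself.\<close>

lemma exists_sequence_avoiding:
  fixes a :: "'a list \<Rightarrow> ennreal"
  assumes sub: "\<And>u. u \<in> lists F \<Longrightarrow> a u \<le> esum (\<lambda>b. a (u @ [b])) F"
    and less: "esum a W < a []"
  obtains \<alpha> :: "nat \<Rightarrow> 'a" where "range \<alpha> \<subseteq> F" "\<And>n. map \<alpha> [0..<n] \<notin> W"
proof -
  define bad where "bad u = esum a {w \<in> W. prefix u w}" for u
  have notin: "u \<notin> W" if "bad u < a u" for u
  proof
    assume "u \<in> W"
    then have "a u \<le> bad u" unfolding bad_def by (intro esum_member_le) auto
    then show False using that by simp
  qed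
  have ext: "\<exists>b\<in>F. bad (u @ [b]) < a (u @ [b])" if u: "u \<in> lists F" "bad u < a u" for u
  proof (rule ccontr)
    assume "\<not> ?thesis"
    then have le: "a (u @ [b]) \<le> bad (u @ [b])" if "b \<in> F" for b using that by (simp add: not_less)
    have "a u \<le> esum (\<lambda>b. bad (u @ [b])) F"
      using sub[OF u(1)] by (rule order_trans) (intro esum_mono le)
    also have "\<dots> = esum a (\<Union>b\<in>F. {w \<in> W. prefix (u @ [b]) w})"
      unfolding bad_def
      by (subst esum_UN_disjoint) (auto simp: disjoint_family_on_def prefix_def)
    also have "\<dots> \<le> bad u"
      unfolding bad_def by (intro esum_subset_mono) (auto simp: prefix_def)
    finally show False using u by simp
  qed
  define nxt where "nxt u = (SOME b. b \<in> F \<and> bad (u @ [b]) < a (u @ [b]))" for u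
  have nxt: "nxt u \<in> F" "bad (u @ [nxt u]) < a (u @ [nxt u])" if "u \<in> lists F" "bad u < a u" for u
    using someI_ex[of "\<lambda>b. b \<in> F \<and> bad (u @ [b]) < a (u @ [b])"] ext[OF that]
    unfolding nxt_def by blast+
  define U where "U = rec_nat [] (\<lambda>_ u. u @ [nxt u])"
  have U: "U 0 = []" "U (Suc n) = U n @ [nxt (U n)]" for n by (auto simp: U_def)
  have inv: "U n \<in> lists F \<and> bad (U n) < a (U n)" for n
  proof (induction n)
    case 0
    show ?case using less by (simp add: U bad_def)
  next
    case (Suc n)
    then show ?case using nxt[of "U n"] by (simp add: U)
  qed
  define \<alpha> where "\<alpha> n = nxt (U n)" for n
  have "map \<alpha> [0..<n] = U n" for n
    by (induction n) (auto simp: U \<alpha>_def)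
  moreover have "range \<alpha> \<subseteq> F" using inv nxt by (auto simp: \<alpha>_def)
  ultimately show ?thesis using that[of \<alpha>] inv notin by metis
qed

section \<open>Separation and bounded distortion for a fixed parameter\<close>

locale gccf =
  fixes \<tau> :: complex
  assumes param: "\<tau> \<in> gccf_param"
begin

abbreviation I :: "complex set" where "I \<equiv> gccf_index \<tau>"
abbreviation X :: "complex set" where "X \<equiv> gccf_disc"
abbreviation J :: "complex set" where "J \<equiv> gccf_limit_set \<tau>"

lemma param_bounds: "0 \<le> Re \<tau>" "1 \<le> Im \<tau>"
  using param by (auto simp: gccf_param_def)

lemma index_bounds:
  assumes "b \<in> I"
  shows "1 \<le> Re b" "1 \<le> Im b"
proof -
  obtain m n :: nat where b: "b = of_nat m + of_nat n * \<tau>" "m \<ge> 1" "n \<ge> 1"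
    using assms by (auto simp: gccf_index_def)
  have "1 * 1 \<le> real n * Im \<tau>" using param_bounds b by (intro mult_mono) auto
  moreover have "0 \<le> real n * Re \<tau>" using param_bounds by simp
  ultimately show "1 \<le> Re b" "1 \<le> Im b" using b by auto
qed

text \<open>Different multiples of \<tau> differ by at least \<open>Im \<tau> \<ge> 1\<close> in the
  imaginary part, equal ones leave an integer difference. Since the disc has diameter 1, its open
  translates by distinct letters are disjoint.\<close>

lemma index_separated:
  assumes "a \<in> I" "b \<in> I" "cmod (a - b) < 1"
  shows "a = b"
proof -
  obtain m n :: nat where a: "a = of_nat m + of_nat n * \<tau>"
    using assms by (auto simp: gccf_index_def)
  obtain j k :: nat where b: "b = of_nat j + of_nat k * \<tau>"
    using assms by (auto simp: gccf_index_def)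
  have im: "\<bar>Im (a - b)\<bar> = \<bar>real n - real k\<bar> * Im \<tau>"
    using param_bounds by (simp add: a b abs_mult flip: left_diff_distrib)
  have nk: "n = k"
  proof (rule ccontr)
    assume "n \<noteq> k"
    then have "1 \<le> \<bar>real n - real k\<bar>" by linarith
    then have "1 * 1 \<le> \<bar>Im (a - b)\<bar>"
      unfolding im using param_bounds by (intro mult_mono) auto
    then show False using abs_Im_le_cmod[of "a - b"] assms by linarith
  qed
  then have "\<bar>Re (a - b)\<bar> = \<bar>real m - real j\<bar>" by (simp add: a b)
  then have "\<bar>real m - real j\<bar> < 1" using abs_Re_le_cmod[of "a - b"] assms by linarith
  then have "m = j" by linarith
  then show ?thesis using nk a b by simp
qed

text \<open>\<open>5/4\<close> is the sum of the squares of 1 and \<open>1/2\<close>. The imaginary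
  part makes every map strictly contracting, with rate \<open>4/5\<close>; the real part alone would
  only give the bound 1.\<close>

lemma shift_bounds:
  assumes "b \<in> I" "z \<in> X"
  shows "1 \<le> Re (z + b)" "1/2 \<le> Im (z + b)" "z + b \<noteq> 0" "5/4 \<le> (cmod (z + b))\<^sup>2"
proof -
  show r: "1 \<le> Re (z + b)" and i: "1/2 \<le> Im (z + b)"
    using index_bounds[OF assms(1)] disc_bounds[OF assms(2)] by auto
  from r show "z + b \<noteq> 0" by (metis not_one_le_zero zero_complex.sel(1))
  have "1\<^sup>2 \<le> (Re (z + b))\<^sup>2" "(1/2)\<^sup>2 \<le> (Im (z + b))\<^sup>2"
    using r i by (auto intro!: power_mono simp del: one_power2 plus_complex.sel)
  then show "5/4 \<le> (cmod (z + b))\<^sup>2"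
    unfolding cmod_power2 by (simp add: power_divide del: plus_complex.sel)
qed

lemma cf_in_disc: "w \<in> lists I \<Longrightarrow> z \<in> X \<Longrightarrow> cf w z \<in> X"
  by (induction w) (auto simp: gccf_map_def intro!: inverse_in_disc shift_bounds(1) simp del: plus_complex.sel)

lemma cf_in_open_disc: "w \<in> lists I \<Longrightarrow> z \<in> ball (1/2) (1/2) \<Longrightarrow> cf w z \<in> ball (1/2) (1/2)"
proof (induction w)
  case (Cons b w)
  then have *: "cf w z \<in> ball (1/2) (1/2)" and b: "b \<in> I" by auto
  then have "(cmod (cf w z))\<^sup>2 < Re (cf w z)" by (simp only: open_disc_iff)
  then have "0 < Re (cf w z)" by (smt (verit) zero_le_power2)
  then show ?case
    using index_bounds[OF b] by (auto simp: gccf_map_def simp del: mem_ball intro!: inverse_in_open_disc)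
qed auto

lemma cden_nonzero: "w \<in> lists I \<Longrightarrow> z \<in> X \<Longrightarrow> cden w z \<noteq> 0"
  by (induction w) (auto simp: shift_bounds(3) cf_in_disc)

text \<open>Every step is a Moebius map of determinant -1, so
  \<open>1 / p - 1 / q = - (p - q) / (p * q)\<close> iterates to an exact identity. It replaces
  derivatives in all metric estimates.\<close>

lemma cf_diff:
  assumes "w \<in> lists I" "z \<in> X" "z' \<in> X"
  shows "cf w z - cf w z' = (-1) ^ length w * (z - z') / (cden w z * cden w z')"
  using assms(1)
proof (induction w)
  case (Cons b w)
  then have b: "b \<in> I" and w: "w \<in> lists I" by auto
  have nz: "cf w z + b \<noteq> 0" "cf w z' + b \<noteq> 0" "cden w z \<noteq> 0" "cden w z' \<noteq> 0"
    using b w assms shift_bounds(3) cf_in_disc cden_nonzero by blast+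
  have "cf (b # w) z - cf (b # w) z' = - (cf w z - cf w z') / ((cf w z + b) * (cf w z' + b))"
    using nz by (simp add: gccf_map_def field_simps)
  also have "\<dots> = (-1) ^ length (b # w) * (z - z') / (cden (b # w) z * cden (b # w) z')"
    using nz by (simp add: Cons.IH)
  finally show ?case .
qed auto

text \<open>The coefficient \<xi> is the continued fraction of the reversed word at 0: appending
  \<open>b\<close> to the word replaces \<xi> by \<open>1 / (\<xi> + b)\<close>, so it never leaves
  the disc. Hence the pole \<open>- 1 / \<xi>\<close>, if there is one, has real part at most
  -1.\<close>

lemma cden_affine:
  assumes "w \<in> lists I"
  obtains \<xi> where "\<xi> \<in> X" "\<And>z. z \<in> X \<Longrightarrow> cden w z = cden w 0 * (1 + \<xi> * z)"
  using assms
proof (induction w arbitrary: thesis rule: rev_induct)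
  case Nil
  show ?case by (rule Nil(1)[of 0]) auto
next
  case (snoc b w)
  then have b: "b \<in> I" and w: "w \<in> lists I" by auto
  obtain \<xi> where \<xi>: "\<xi> \<in> X" "\<And>z. z \<in> X \<Longrightarrow> cden w z = cden w 0 * (1 + \<xi> * z)"
    using snoc.IH w by blast
  have nz: "b + \<xi> \<noteq> 0" using shift_bounds(3)[OF b \<xi>(1)] by (simp add: add.commute)
  have *: "cden (w @ [b]) z = cden w 0 * (b + \<xi>) * (1 + 1 / (\<xi> + b) * z)" if z: "z \<in> X" for z
  proof -
    have "1 / (z + b) \<in> X" by (intro inverse_in_disc shift_bounds[OF b z])
    from \<xi>(2)[OF this]
    have "cden (w @ [b]) z = cden w 0 * (1 + \<xi> * (1 / (z + b))) * (z + b)"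
      by (simp add: cden_append gccf_map_def)
    also have "\<dots> = cden w 0 * (b + \<xi>) * (1 + 1 / (\<xi> + b) * z)"
      using nz shift_bounds(3)[OF b z] by (simp add: field_simps)
    finally show ?thesis .
  qed
  show ?case
  proof (rule snoc.prems(1))
    show "1 / (\<xi> + b) \<in> X" by (intro inverse_in_disc shift_bounds[OF b \<xi>(1)])
    have "cden (w @ [b]) 0 = cden w 0 * (b + \<xi>)"
      using *[OF zero_in_disc] by (simp only: mult_zero_right add_0_right mult_1_right)
    then show "cden (w @ [b]) z = cden (w @ [b]) 0 * (1 + 1 / (\<xi> + b) * z)" if "z \<in> X" for z
      using *[OF that] by (simp only:)
  qed
qed

lemma cden_bounds:
  assumes "w \<in> lists I" "z \<in> X"
  shows "cmod (cden w 0) / 2 \<le> cmod (cden w z)" "cmod (cden w z) \<le> 2 * cmod (cden w 0)"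
proof -
  obtain \<xi> where \<xi>: "\<xi> \<in> X" "cden w z = cden w 0 * (1 + \<xi> * z)"
    using cden_affine[OF assms(1)] assms(2) by metis
  have "cmod (cden w 0) * (1/2) \<le> cmod (cden w 0) * cmod (1 + \<xi> * z)"
       "cmod (cden w 0) * cmod (1 + \<xi> * z) \<le> cmod (cden w 0) * 2"
    using one_plus_mult_disc[OF \<xi>(1) assms(2)] by (intro mult_left_mono; simp)+
  then show "cmod (cden w 0) / 2 \<le> cmod (cden w z)" "cmod (cden w z) \<le> 2 * cmod (cden w 0)"
    by (auto simp: \<xi>(2) norm_mult)
qed

lemma deriv0_pos: "w \<in> lists I \<Longrightarrow> 0 < deriv0 w"
  using cden_nonzero[of w 0] by (simp add: deriv0_def)

lemma deriv0_le_power: "w \<in> lists I \<Longrightarrow> deriv0 w \<le> (4/5) ^ length w"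
proof (induction w)
  case (Cons b w)
  then have b: "b \<in> I" and w: "w \<in> lists I" by auto
  have "deriv0 (b # w) = 1 / (cmod (cf w 0 + b))\<^sup>2 * deriv0 w"
    by (simp add: deriv0_def norm_mult power_mult_distrib)
  also have "\<dots> \<le> (4/5) * (4/5) ^ length w"
  proof (intro mult_mono)
    have "5/4 \<le> (cmod (cf w 0 + b))\<^sup>2"
      by (intro shift_bounds(4) b cf_in_disc w zero_in_disc)
    then show "1 / (cmod (cf w 0 + b))\<^sup>2 \<le> 4/5" by (simp add: divide_simps)
  qed (use Cons w deriv0_pos[OF w] in auto)
  finally show ?case by simp
qed auto

lemma deriv0_le_1: "w \<in> lists I \<Longrightarrow> deriv0 w \<le> 1"
  using deriv0_le_power[of w] power_le_one[of "4/5::real" "length w"] by simp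

text \<open>In the chain rule the denominator of \<open>u\<close> is evaluated at
  \<open>cf v 0\<close> in place of 0. This changes its modulus by at most the factor 2, which
  enters squared.\<close>

lemma deriv0_append:
  assumes "u \<in> lists I" "v \<in> lists I"
  shows "deriv0 (u @ v) \<le> 4 * (deriv0 u * deriv0 v)"
        "deriv0 u * deriv0 v \<le> 4 * deriv0 (u @ v)"
proof -
  define p q r where "p = cmod (cden u 0)" and "q = cmod (cden v 0)" and "r = cmod (cden u (cf v 0))"
  have pos: "0 < p" "0 < q" "0 < r"
    unfolding p_def q_def r_def zero_less_norm_iff
    by (intro cden_nonzero cf_in_disc zero_in_disc assms)+
  have b: "p / 2 \<le> r" "r \<le> 2 * p"
    unfolding p_def r_def by (intro cden_bounds cf_in_disc zero_in_disc assms)+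
  have e: "deriv0 (u @ v) = 1 / (r * q)\<^sup>2" "deriv0 u * deriv0 v = 1 / (p * q)\<^sup>2"
    by (auto simp: deriv0_def cden_append p_def q_def r_def norm_mult power_mult_distrib)
  have "p\<^sup>2 \<le> 2\<^sup>2 * r\<^sup>2" "r\<^sup>2 \<le> 2\<^sup>2 * p\<^sup>2"
    unfolding power_mult_distrib[symmetric] using pos b by (intro power_mono; simp)+
  then have "p\<^sup>2 \<le> 4 * r\<^sup>2" "r\<^sup>2 \<le> 4 * p\<^sup>2" by simp_all
  then show "deriv0 (u @ v) \<le> 4 * (deriv0 u * deriv0 v)"
        "deriv0 u * deriv0 v \<le> 4 * deriv0 (u @ v)"
    unfolding e using pos by (auto simp: power_mult_distrib field_simps)
qed

lemma cf_lipschitz: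
  assumes "w \<in> lists I" "z \<in> X" "z' \<in> X"
  shows "dist (cf w z) (cf w z') \<le> 4 * deriv0 w * dist z z'"
proof -
  define q where "q = cmod (cden w 0)"
  have q: "0 < q" unfolding q_def using cden_nonzero[OF assms(1) zero_in_disc] by simp
  have "(q / 2) * (q / 2) \<le> cmod (cden w z) * cmod (cden w z')"
    unfolding q_def using cden_bounds assms by (intro mult_mono) auto
  then have "1 / (cmod (cden w z) * cmod (cden w z')) \<le> 1 / ((q / 2) * (q / 2))"
    using q cden_nonzero[OF assms(1,2)] cden_nonzero[OF assms(1,3)]
    by (intro divide_left_mono) auto
  then have "cmod (z - z') * (1 / (cmod (cden w z) * cmod (cden w z'))) \<le> cmod (z - z') * (4 / q\<^sup>2)"
    by (intro mult_left_mono) (auto simp: power2_eq_square)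
  then show ?thesis
    unfolding dist_norm cf_diff[OF assms]
    by (simp add: norm_divide norm_mult norm_power deriv0_def q_def mult.commute)
qed

text \<open>Proved by solving the Moebius equation for the preimage explicitly. Together with
  \<open>cf_lipschitz\<close> it makes cylinders comparable to balls of size
  \<open>deriv0 w\<close>.\<close>

lemma ball_subset_cf_image:
  assumes w: "w \<in> lists I" and \<eta>: "ball z0 \<eta> \<subseteq> X" "0 < \<eta>" "\<eta> \<le> 1"
  shows "ball (cf w z0) (\<eta> * deriv0 w / 8) \<subseteq> cf w ` ball z0 \<eta>"
proof
  fix y assume y: "y \<in> ball (cf w z0) (\<eta> * deriv0 w / 8)"
  obtain \<xi> where \<xi>: "\<xi> \<in> X" "\<And>z. z \<in> X \<Longrightarrow> cden w z = cden w 0 * (1 + \<xi> * z)"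
    using cden_affine[OF w] by metis
  have z0: "z0 \<in> X" using \<eta> by auto
  \<comment> \<open>With affine denominators in \<open>cf_diff\<close>, the equation
    \<open>y = cf w z\<close> reads \<open>(z - z0) / (1 + \<xi> * z) = t\<close>, and solving it
    gives the point \<open>z\<close> below. The constant 8 yields
    \<open>cmod t < \<eta> / 4\<close>, hence \<open>cmod (z - z0) < \<eta>\<close>.\<close>
  define q s t where "q = cden w 0" and "s = ((-1) ^ length w :: complex)"
    and "t = s * (y - cf w z0) * q\<^sup>2 * (1 + \<xi> * z0)"
  have q: "q \<noteq> 0" unfolding q_def by (rule cden_nonzero[OF w zero_in_disc])
  have s: "s * s = 1" unfolding s_def by (simp flip: power_mult_distrib)
  have s1: "cmod s = 1" by (simp add: s_def norm_power)
  have nz: "1 + \<xi> * z0 \<noteq> 0" and le2: "cmod (1 + \<xi> * z0) \<le> 2"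
    using one_plus_mult_disc[OF \<xi>(1) z0] by auto
  have "cmod t = cmod (y - cf w z0) * (cmod q)\<^sup>2 * cmod (1 + \<xi> * z0)"
    by (simp add: t_def norm_mult norm_power s1)
  also have "\<dots> \<le> cmod (y - cf w z0) * (cmod q)\<^sup>2 * 2"
    using le2 by (intro mult_left_mono) auto
  also have "\<dots> < (\<eta> * deriv0 w / 8) * (cmod q)\<^sup>2 * 2"
    using y q by (intro mult_strict_right_mono) (auto simp: dist_norm norm_minus_commute)
  also have "\<dots> = \<eta> / 4" using q by (simp add: deriv0_def q_def)
  finally have t: "cmod t < \<eta> / 4" .
  have "cmod (t * \<xi>) \<le> cmod t" using disc_bounds(1)[OF \<xi>(1)] by (simp add: norm_mult mult_left_le)
  then have "cmod (t * \<xi>) \<le> 1/4" using t \<eta> by linarith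
  then have d: "3/4 \<le> cmod (1 - t * \<xi>)" using norm_triangle_ineq2[of 1 "t * \<xi>"] by simp
  then have d0: "1 - t * \<xi> \<noteq> 0" by auto
  define z where "z = (z0 + t) / (1 - t * \<xi>)"
  have zz0: "z - z0 = t * (1 + \<xi> * z0) / (1 - t * \<xi>)"
    using d0 by (simp add: z_def field_simps)
  have "cmod (z - z0) = cmod t * cmod (1 + \<xi> * z0) / cmod (1 - t * \<xi>)"
    by (simp add: zz0 norm_mult norm_divide)
  also have "\<dots> \<le> (cmod t * 2) / (3/4)"
    using le2 d by (intro frac_le mult_left_mono) auto
  also have "\<dots> < \<eta>" using t \<eta> by simp
  finally have zb: "z \<in> ball z0 \<eta>" by (simp add: dist_norm norm_minus_commute)
  then have z: "z \<in> X" using \<eta> by auto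
  have "1 + \<xi> * z = (1 + \<xi> * z0) / (1 - t * \<xi>)"
    using d0 by (simp add: z_def field_simps)
  then have "(z - z0) / (1 + \<xi> * z) = t" using d0 nz by (simp add: zz0)
  moreover have "cf w z - cf w z0 = s * ((z - z0) / (1 + \<xi> * z)) / (q\<^sup>2 * (1 + \<xi> * z0))"
    unfolding cf_diff[OF w z z0] \<xi>(2)[OF z] \<xi>(2)[OF z0]
    by (simp add: s_def q_def power2_eq_square field_simps)
  ultimately have "cf w z - cf w z0 = (s * s) * (y - cf w z0)"
    using q nz by (simp add: t_def)
  then have "y = cf w z" using s by simp
  then show "y \<in> cf w ` ball z0 \<eta>" using zb by auto
qed

text \<open>If \<open>p + a = q + b\<close> with \<open>p\<close> and \<open>q\<close> in the open
  disc of diameter 1, then \<open>a\<close> and \<open>b\<close> are closer than 1 and agree, so the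
  first letter cancels. Openness matters, since closed translates of the disc can touch.\<close>

lemma cf_eq_imp_comparable:
  assumes "u \<in> lists I" "v \<in> lists I" "cf u z = cf v z'"
    and "z \<in> ball (1/2) (1/2)" "z' \<in> ball (1/2) (1/2)"
  shows "prefix u v \<or> prefix v u"
  using assms(1-3)
proof (induction u arbitrary: v rule: list.induct)
  case (Cons a u)
  note prems = Cons.prems and IH = Cons.IH
  show ?case
  proof (cases v)
    case (Cons b v')
    have a: "a \<in> I" "u \<in> lists I" and b: "b \<in> I" "v' \<in> lists I"
      using prems \<open>v = b # v'\<close> by auto
    define p q where "p = cf u z" and "q = cf v' z'"
    have p: "p \<in> ball (1/2) (1/2)" and q: "q \<in> ball (1/2) (1/2)"
      unfolding p_def q_def using a b assms by (auto intro!: cf_in_open_disc simp del: mem_ball)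
    have "p + a \<noteq> 0" "q + b \<noteq> 0"
      using p q a b open_disc_subset shift_bounds(3) by blast+
    moreover have "1 / (p + a) = 1 / (q + b)"
      using prems \<open>v = b # v'\<close> by (simp add: p_def q_def gccf_map_def)
    ultimately have e: "p + a = q + b" by simp
    then have "a - b = q - p" by (simp add: algebra_simps)
    moreover have "dist q p < 1"
      using dist_triangle_less_add[of q "1/2" "1/2" p "1/2"] p q by (simp add: dist_commute)
    ultimately have "a = b"
      using index_separated a b by (simp add: dist_norm)
    then have "cf u z = cf v' z'" using e by (simp add: p_def q_def)
    then show ?thesis using IH a b \<open>v = b # v'\<close> \<open>a = b\<close> by auto
  qed auto
qed auto

section \<open>Partition sums and the critical exponent\<close>

lemma words_lists: "F \<subseteq> I \<Longrightarrow> w \<in> words F n \<Longrightarrow> w \<in> lists I"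
  by (auto simp: words_def)

lemma weight_append:
  assumes "u \<in> lists I" "v \<in> lists I" "0 \<le> s"
  shows "weight s (u @ v) \<le> distort s * (weight s u * weight s v)"
        "weight s u * weight s v \<le> distort s * weight s (u @ v)"
proof -
  note pos = deriv0_pos[OF assms(1)] deriv0_pos[OF assms(2)] deriv0_pos[of "u @ v"]
  have "deriv0 (u @ v) powr s \<le> (4 * (deriv0 u * deriv0 v)) powr s"
    using assms pos by (intro powr_mono2 deriv0_append) auto
  then show "weight s (u @ v) \<le> distort s * (weight s u * weight s v)"
    using pos by (simp add: weight_def distort_def powr_mult flip: ennreal_mult)
  have "(deriv0 u * deriv0 v) powr s \<le> (4 * deriv0 (u @ v)) powr s"
    using assms pos by (intro powr_mono2 deriv0_append) auto
  then show "weight s u * weight s v \<le> distort s * weight s (u @ v)"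
    using pos assms by (simp add: weight_def distort_def powr_mult flip: ennreal_mult)
qed

lemma weight_append_Cons:
  assumes "u \<in> lists I" "b \<in> I" "v \<in> lists I" "0 \<le> s"
  shows "weight s u * (weight s [b] * weight s v) \<le> distort s * (distort s * weight s (u @ b # v))"
proof -
  have "weight s u * (weight s [b] * weight s v) \<le> weight s u * (distort s * weight s (b # v))"
    using weight_append(2)[of "[b]" v s] assms by (intro mult_left_mono) auto
  also have "\<dots> = distort s * (weight s u * weight s (b # v))" by (simp add: ac_simps)
  also have "\<dots> \<le> distort s * (distort s * weight s (u @ b # v))"
    using assms by (intro mult_left_mono weight_append) auto
  finally show ?thesis .
qed

lemma weight_antimono: "w \<in> lists I \<Longrightarrow> s \<le> t \<Longrightarrow> weight t w \<le> weight s w"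
  unfolding weight_def
  by (intro ennreal_leI powr_mono' deriv0_le_1) (auto intro: less_imp_le deriv0_pos)

lemma part_sum_antimono:
  "F \<subseteq> I \<Longrightarrow> s \<le> t \<Longrightarrow> part_sum F t n \<le> part_sum F s n"
  unfolding part_sum_def by (intro esum_mono weight_antimono words_lists)

lemma weight_pos: "w \<in> lists I \<Longrightarrow> 0 < weight s w"
  using deriv0_pos[of w] by (simp add: weight_def)

lemma part_sum_add:
  assumes "F \<subseteq> I" "0 \<le> s"
  shows "part_sum F s (m + n) \<le> distort s * (part_sum F s m * part_sum F s n)"
        "part_sum F s m * part_sum F s n \<le> distort s * part_sum F s (m + n)"
proof -
  have *: "part_sum F s m * part_sum F s n
      = esum (\<lambda>u. esum (\<lambda>v. weight s u * weight s v) (words F n)) (words F m)"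
    by (simp add: part_sum_def esum_cmult esum_multc)
  have "part_sum F s (m + n) \<le>
      esum (\<lambda>u. esum (\<lambda>v. distort s * (weight s u * weight s v)) (words F n)) (words F m)"
    unfolding part_sum_def esum_words_append
    by (intro esum_mono weight_append words_lists[OF assms(1)] assms(2))
  then show "part_sum F s (m + n) \<le> distort s * (part_sum F s m * part_sum F s n)"
    unfolding * by (simp add: esum_cmult)
  have "part_sum F s m * part_sum F s n \<le>
      esum (\<lambda>u. esum (\<lambda>v. distort s * weight s (u @ v)) (words F n)) (words F m)"
    unfolding * by (intro esum_mono weight_append words_lists[OF assms(1)] assms(2))
  also have "\<dots> = distort s * part_sum F s (m + n)"
    unfolding part_sum_def esum_words_append by (simp add: esum_cmult)
  finally show "part_sum F s m * part_sum F s n \<le> distort s * part_sum F s (m + n)" .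
qed

lemma part_sum_finite:
  assumes "F \<subseteq> I" "0 \<le> s" "part_sum F s 1 < \<infinity>"
  shows "part_sum F s n < \<infinity>"
proof (induction n)
  case (Suc n)
  have "part_sum F s (Suc n) \<le> distort s * (part_sum F s 1 * part_sum F s n)"
    using part_sum_add(1)[OF assms(1,2), of 1 n] by simp
  also have "\<dots> < \<infinity>" using Suc assms(3) distort_pos(3)[of s]
    by (simp add: ennreal_mult_less_top less_top)
  finally show ?case .
qed simp

text \<open>\<open>part_sum / distort\<close> is supermultiplicative, so a value of at least 1
  persists along multiples. Dually \<open>distort * part_sum\<close> is submultiplicative, which
  gives \<open>part_sum_multiple_le\<close>.\<close>

lemma part_sum_multiple_ge:
  assumes "F \<subseteq> I" "0 \<le> s" "distort s \<le> part_sum F s k" "0 < j"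
  shows "distort s \<le> part_sum F s (k * j)"
  using assms(4)
proof (induction j rule: nat_induct_non_zero)
  case (Suc j)
  have "distort s * distort s \<le> part_sum F s k * part_sum F s (k * j)"
    using Suc assms by (intro mult_mono) auto
  also have "\<dots> \<le> distort s * part_sum F s (k * Suc j)"
    using part_sum_add(2)[OF assms(1,2), of k "k * j"] by simp
  finally show ?case by (subst (asm) ennreal_mult_le_mult_iff) (auto simp: distort_def)
qed (use assms in simp)

lemma part_sum_multiple_le:
  assumes "F \<subseteq> I" "0 \<le> s" "distort s * part_sum F s k \<le> 1" "0 < j"
  shows "distort s * part_sum F s (k * j) \<le> 1"
  using assms(4)
proof (induction j rule: nat_induct_non_zero)
  case (Suc j)
  have "distort s * part_sum F s (k * Suc j)
      \<le> distort s * (distort s * (part_sum F s k * part_sum F s (k * j)))"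
    using part_sum_add(1)[OF assms(1,2), of k "k * j"] by (simp add: mult_left_mono)
  also have "\<dots> = (distort s * part_sum F s k) * (distort s * part_sum F s (k * j))"
    by (simp add: ac_simps)
  also have "\<dots> \<le> 1 * 1" using Suc assms by (intro mult_mono) auto
  finally show ?case by simp
qed (use assms in simp)

lemma part_sum_lower_bound:
  assumes "F \<subseteq> I" "0 \<le> s" "distort s \<le> part_sum F s k" "0 < k" "part_sum F s 1 < \<infinity>"
  obtains c :: real where "0 < c" "\<And>n. ennreal c \<le> part_sum F s n"
proof -
  define B where "B = (\<Sum>r<k. part_sum F s r)"
  have "B < \<infinity>" unfolding B_def using part_sum_finite[OF assms(1,2,5)] by simp
  then obtain b where b: "B = ennreal b" "0 \<le> b" by (cases B) auto
  have "part_sum F s 0 \<le> B"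
    unfolding B_def using \<open>0 < k\<close> by (intro member_le_sum) auto
  then have b1: "1 \<le> b" by (simp add: b)
  have "ennreal (1 / b) \<le> part_sum F s n" for n
  proof -
    \<comment> \<open>\<open>k * j\<close> is the next multiple of \<open>k\<close> beyond
      \<open>n\<close>, and the gap \<open>k * j - n\<close> equals \<open>k\<close> exactly when
      \<open>k\<close> divides \<open>n\<close>. That case is not covered by \<open>B\<close>, which
      sums over lengths below \<open>k\<close>, and is treated directly.\<close>
    define j where "j = Suc (n div k)"
    have "n = k * (n div k) + n mod k" "k * j = k * (n div k) + k" by (simp_all add: j_def)
    then have jn: "n \<le> k * j" "k * j - n \<le> k"
      using mod_less_divisor[OF \<open>0 < k\<close>, of n] by linarith+
    show ?thesis
    proof (cases "k * j - n = k")
      case True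
      then have "n = k * (n div k)" using jn unfolding j_def by simp
      show ?thesis
      proof (cases "n div k = 0")
        case True
        then have "n = 0" using \<open>n = k * (n div k)\<close> by simp
        then show ?thesis using b1 by simp
      next
        case False
        then have "distort s \<le> part_sum F s n"
          using part_sum_multiple_ge[OF assms(1-3), of "n div k"] \<open>n = k * (n div k)\<close> by simp
        moreover have "ennreal (1 / b) \<le> 1" using b1 by simp
        ultimately show ?thesis using one_le_distort[OF assms(2)] by (meson order_trans)
      qed
    next
      case False
      then have "k * j - n < k" using jn by simp
      then have le: "part_sum F s (k * j - n) \<le> B"
        unfolding B_def by (intro member_le_sum) auto
      have "distort s \<le> part_sum F s (n + (k * j - n))"
        using part_sum_multiple_ge[OF assms(1-3), of j] jn(1) unfolding j_def by simp
      also have "\<dots> \<le> distort s * (part_sum F s n * part_sum F s (k * j - n))"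
        by (rule part_sum_add(1)[OF assms(1,2)])
      also have "\<dots> \<le> distort s * (part_sum F s n * B)"
        using le by (intro mult_left_mono) auto
      finally have "distort s * 1 \<le> distort s * (part_sum F s n * B)" by simp
      then have *: "1 \<le> part_sum F s n * B"
        by (subst (asm) ennreal_mult_le_mult_iff) auto
      show ?thesis
      proof (cases "part_sum F s n")
        case (real z)
        then have "1 \<le> z * b" using * b by (simp flip: ennreal_mult)
        then show ?thesis using real b1 by (simp add: field_simps)
      qed simp
    qed
  qed
  then show ?thesis using that[of "1 / b"] b1 by simp
qed

section \<open>Lattice sums and bounds for the partition sums\<close>

definition lattice :: "nat \<times> nat \<Rightarrow> complex" where
  "lattice p = of_nat (fst p) + of_nat (snd p) * \<tau>"

lemma inj_lattice: "inj_on lattice A"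
proof (rule inj_onI)
  fix p q assume e: "lattice p = lattice q"
  then have "real (snd p) * Im \<tau> = real (snd q) * Im \<tau>"
    by (auto simp: lattice_def complex_eq_iff)
  then have "snd p = snd q" using param_bounds by simp
  then show "p = q" using e by (auto simp: lattice_def prod_eq_iff)
qed

lemma index_eq: "I = lattice ` ({1..} \<times> {1..})"
  by (force simp: gccf_index_def lattice_def)

lemma lattice_bounds:
  "real (fst p) \<le> Re (lattice p)" "real (snd p) \<le> Im (lattice p)"
  using param_bounds mult_left_mono[of 1 "Im \<tau>" "real (snd p)"] by (auto simp: lattice_def)

lemma cmod_lattice_ge: "real (fst p) * real (snd p) \<le> (cmod (lattice p))\<^sup>2"
proof -
  let ?m = "real (fst p)" and ?n = "real (snd p)"
  have "?m * ?n \<le> ?m\<^sup>2 + ?n\<^sup>2"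
  proof -
    have "0 \<le> ?m\<^sup>2 + ?n\<^sup>2 - 2 * (?m * ?n)"
      using zero_le_power2[of "?m - ?n"] by (simp add: power2_eq_square algebra_simps)
    moreover have "0 \<le> ?m * ?n" by simp
    ultimately show ?thesis by linarith
  qed
  also have "\<dots> \<le> (Re (lattice p))\<^sup>2 + (Im (lattice p))\<^sup>2"
    by (intro add_mono power_mono lattice_bounds) auto
  finally show ?thesis by (simp add: cmod_power2)
qed

definition scale :: real where "scale = 1 + cmod \<tau>"

lemma scale_ge_1: "1 \<le> scale"
  by (simp add: scale_def)

lemma cmod_lattice_le:
  assumes "real (fst p) \<le> x" "real (snd p) \<le> x"
  shows "cmod (lattice p) \<le> x * scale"
proof -
  have "cmod (lattice p) \<le> real (fst p) + real (snd p) * cmod \<tau>"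
    unfolding lattice_def by (rule order_trans[OF norm_triangle_ineq]) (simp add: norm_mult)
  also have "\<dots> \<le> x + x * cmod \<tau>" using assms by (intro add_mono mult_right_mono) auto
  finally show ?thesis by (simp add: scale_def algebra_simps)
qed

lemma part_sum_1_finite:
  assumes "1 < s"
  shows "part_sum I s 1 < \<infinity>"
proof -
  have "part_sum I s 1 = esum (\<lambda>p. ennreal ((1 / (cmod (lattice p))\<^sup>2) powr s)) ({1..} \<times> {1..})"
    by (simp add: part_sum_1 index_eq esum_image inj_lattice)
  also have "\<dots> \<le> esum (\<lambda>p. ennreal ((1 / (real (fst p) * real (snd p))) powr s)) ({1..} \<times> {1..})"
  proof (rule esum_mono, rule ennreal_leI, rule powr_mono2)
    fix p :: "nat \<times> nat" assume "p \<in> {1..} \<times> {1..}"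
    then have "0 < real (fst p) * real (snd p)" by auto
    moreover from this have "0 < (cmod (lattice p))\<^sup>2"
      using cmod_lattice_ge[of p] by linarith
    ultimately show "1 / (cmod (lattice p))\<^sup>2 \<le> 1 / (real (fst p) * real (snd p))"
      using cmod_lattice_ge[of p] by (intro frac_le) auto
  qed (use assms in auto)
  also have "\<dots> < \<infinity>" by (rule esum_powr_prod_finite[OF assms])
  finally show ?thesis .
qed

text \<open>Peeling off the first letter is exact, \<open>deriv0 (b # v)\<close> being
  \<open>deriv0 v\<close> divided by the square of \<open>cmod (cf v 0 + b)\<close>, and the sum
  over \<open>b\<close> is at most 1 uniformly in the point \<open>cf v 0\<close>. Going through
  \<open>weight_append\<close> would cost \<open>4 powr s\<close> for each letter.\<close>

lemma part_sum_le_1: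
  obtains s where "0 < s" "s < 2" "\<And>n. part_sum I s n \<le> 1"
proof -
  obtain s where s: "0 < s" "s < 2"
    and le: "esum (\<lambda>p. ennreal (grid_weight (fst p) (snd p) powr s)) ({1..} \<times> {1..}) \<le> 1"
    by (rule esum_grid_weight_le_1)
  have step: "esum (\<lambda>b. ennreal ((1 / (cmod (z + b))\<^sup>2) powr s)) I \<le> 1" if z: "z \<in> X" for z
  proof -
    have "esum (\<lambda>b. ennreal ((1 / (cmod (z + b))\<^sup>2) powr s)) I =
        esum (\<lambda>p. ennreal ((1 / (cmod (z + lattice p))\<^sup>2) powr s)) ({1..} \<times> {1..})"
      by (simp add: index_eq esum_image inj_lattice)
    also have "\<dots> \<le> esum (\<lambda>p. ennreal (grid_weight (fst p) (snd p) powr s)) ({1..} \<times> {1..})"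
    proof (rule esum_mono, rule ennreal_leI, rule powr_mono2)
      fix p :: "nat \<times> nat" assume p: "p \<in> {1..} \<times> {1..}"
      have "(real (fst p))\<^sup>2 + (real (snd p) - 1/2)\<^sup>2 \<le> (Re (z + lattice p))\<^sup>2 + (Im (z + lattice p))\<^sup>2"
        using disc_bounds[OF z] lattice_bounds[of p] p by (intro add_mono power_mono) auto
      moreover have "0 < (real (fst p))\<^sup>2 + (real (snd p) - 1/2)\<^sup>2"
        using p by (auto intro!: add_pos_nonneg)
      ultimately show "1 / (cmod (z + lattice p))\<^sup>2 \<le> grid_weight (fst p) (snd p)"
        unfolding grid_weight_def cmod_power2 by (intro divide_left_mono mult_pos_pos) auto
    qed (use s in auto)
    finally show ?thesis using le by (rule order_trans)
  qed
  have "part_sum I s n \<le> 1" for n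
  proof (induction n)
    case (Suc n)
    have "deriv0 (b # v) = 1 / (cmod (cf v 0 + b))\<^sup>2 * deriv0 v" for b v
      by (simp add: deriv0_def norm_mult power_mult_distrib)
    then have eq: "weight s (b # v) = ennreal ((1 / (cmod (cf v 0 + b))\<^sup>2) powr s) * weight s v" for b v
      by (simp only: weight_def powr_mult ennreal_mult powr_ge_zero)
    have "part_sum I s (Suc n) = esum (\<lambda>b. esum (\<lambda>v. weight s (b # v)) (words I n)) I"
      using esum_words_append[of "weight s" I 1 n] by (simp add: part_sum_def esum_words_1)
    also have "\<dots> = esum (\<lambda>v. esum (\<lambda>b. weight s (b # v)) I) (words I n)"
      by (rule esum_swap)
    also have "\<dots> \<le> esum (\<lambda>v. 1 * weight s v) (words I n)"
      unfolding eq esum_multc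
      by (intro esum_mono mult_right_mono step cf_in_disc) (auto simp: words_def)
    also have "\<dots> \<le> 1" using Suc by (simp add: part_sum_def)
    finally show ?case .
  qed simp
  then show ?thesis using that s by blast
qed

text \<open>\<open>M ^ 2\<close> letters of modulus comparable to \<open>M\<close>; their total
  weight is therefore of order at least \<open>M powr (2 - 2 * s)\<close>.\<close>

definition block :: "nat \<Rightarrow> complex set" where
  "block M = lattice ` ({M..<2 * M} \<times> {M..<2 * M})"

lemma finite_block: "finite (block M)"
  and card_block: "card (block M) = M\<^sup>2"
  unfolding block_def by (auto simp: card_image inj_lattice power2_eq_square)

lemma block_subset: "0 < M \<Longrightarrow> block M \<subseteq> I"
  unfolding block_def index_eq by (intro image_mono) auto

lemma block_bounds:
  assumes "b \<in> block M"
  shows "real M \<le> cmod b" "cmod b \<le> 2 * real M * scale"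
proof -
  obtain p where p: "b = lattice p" "p \<in> {M..<2 * M} \<times> {M..<2 * M}"
    using assms by (auto simp: block_def)
  have "real M \<le> Re b" using lattice_bounds(1)[of p] p by auto
  then show "real M \<le> cmod b" using complex_Re_le_cmod order_trans by blast
  show "cmod b \<le> 2 * real M * scale"
    unfolding p(1) by (rule cmod_lattice_le) (use p in auto)
qed

lemma block_sum_ge:
  assumes "0 < M" "0 \<le> s"
  shows "(real M)\<^sup>2 * (1 / (2 * real M * scale)\<^sup>2) powr s \<le> (\<Sum>b\<in>block M. (1 / (cmod b)\<^sup>2) powr s)"
proof -
  have "(\<Sum>b\<in>block M. (1 / (2 * real M * scale)\<^sup>2) powr s) \<le> (\<Sum>b\<in>block M. (1 / (cmod b)\<^sup>2) powr s)"
  proof (intro sum_mono powr_mono2)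
    fix b assume b: "b \<in> block M"
    have "0 < real M" using assms by simp
    moreover from this have "0 < cmod b" using block_bounds(1)[OF b] by linarith
    ultimately show "1 / (2 * real M * scale)\<^sup>2 \<le> 1 / (cmod b)\<^sup>2"
      using block_bounds(2)[OF b] scale_ge_1 by (intro divide_left_mono power_mono mult_pos_pos zero_less_power) auto
  qed (use assms in auto)
  then show ?thesis by (simp add: card_block)
qed

text \<open>At \<open>s = 1\<close> each dyadic block contributes at least
  \<open>1 / (4 * scale ^ 2)\<close>, whatever its position. So \<open>20 * scale ^ 2\<close> blocks
  reach 5, above \<open>4 powr 1\<close>, and a finite sum still exceeds \<open>4 powr s\<close> for
  \<open>s\<close> slightly above 1.\<close>

lemma part_sum_1_unbounded:
  obtains s where "1 < s" "distort s < part_sum I s 1"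
proof -
  define K where "K = nat \<lceil>20 * scale\<^sup>2\<rceil>"
  define F where "F = (\<Union>k<K. block (2 ^ k))"
  have "block (2 ^ k) \<subseteq> I" for k by (rule block_subset) simp
  then have F: "finite F" "F \<subseteq> I" by (auto simp: F_def finite_block)
  have "5 \<le> (\<Sum>b\<in>F. (1 / (cmod b)\<^sup>2) powr 1)"
  proof -
    have disj: "block (2 ^ j) \<inter> block (2 ^ k) = {}" if "j < k" for j k :: nat
    proof -
      have "(2::nat) * 2 ^ j \<le> 2 ^ k"
        using that power_increasing[of "Suc j" k "2::nat"] by simp
      then have "({2 ^ j..<2 * 2 ^ j} \<times> {2 ^ j..<2 * 2 ^ j}) \<inter> ({2 ^ k..<2 * 2 ^ k} \<times> {2 ^ k..<2 * 2 ^ k :: nat}) = {}"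
        by auto
      then show ?thesis
        unfolding block_def by (subst inj_on_image_Int[OF inj_lattice[of UNIV], symmetric]) auto
    qed
    have disj': "block (2 ^ j) \<inter> block (2 ^ k) = {}" if "j \<noteq> k" for j k :: nat
      using that disj[of j k] disj[of k j] by (metis Int_commute linorder_neqE_nat)
    have "5 \<le> real K / (4 * scale\<^sup>2)"
    proof -
      have "20 * scale\<^sup>2 \<le> real K" unfolding K_def by linarith
      then show ?thesis using scale_ge_1 by (simp add: field_simps)
    qed
    also have "\<dots> = (\<Sum>k<K. 1 / (4 * scale\<^sup>2))" by simp
    also have "\<dots> \<le> (\<Sum>k<K. \<Sum>b\<in>block (2 ^ k). (1 / (cmod b)\<^sup>2) powr 1)"
    proof (rule sum_mono)
      fix k
      have "1 / (4 * scale\<^sup>2) = (real (2 ^ k))\<^sup>2 * (1 / (2 * real (2 ^ k) * scale)\<^sup>2) powr 1"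
        using scale_ge_1 by (simp add: power_mult_distrib)
      also have "\<dots> \<le> (\<Sum>b\<in>block (2 ^ k). (1 / (cmod b)\<^sup>2) powr 1)"
        by (rule block_sum_ge) auto
      finally show "1 / (4 * scale\<^sup>2) \<le> (\<Sum>b\<in>block (2 ^ k). (1 / (cmod b)\<^sup>2) powr 1)" .
    qed
    also have "\<dots> = (\<Sum>b\<in>F. (1 / (cmod b)\<^sup>2) powr 1)"
      unfolding F_def using disj' by (subst sum.UNION_disjoint) (auto simp: finite_block)
    finally show ?thesis .
  qed
  moreover have "((\<lambda>s. (\<Sum>b\<in>F. (1 / (cmod b)\<^sup>2) powr s) - 4 powr s) \<longlongrightarrow>
      (\<Sum>b\<in>F. (1 / (cmod b)\<^sup>2) powr 1) - 4 powr 1) (at_right 1)"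
    using index_bounds(1) F by (intro tendsto_intros) force+
  ultimately have "\<forall>\<^sub>F s in at_right 1. 0 < (\<Sum>b\<in>F. (1 / (cmod b)\<^sup>2) powr s) - 4 powr s"
    by (intro order_tendstoD) auto
  moreover have "\<forall>\<^sub>F s::real in at_right 1. 1 < s" by (simp add: eventually_at_right_less)
  ultimately have "\<forall>\<^sub>F s in at_right 1. 1 < s \<and> 0 < (\<Sum>b\<in>F. (1 / (cmod b)\<^sup>2) powr s) - 4 powr s"
    by eventually_elim auto
  then obtain s where s: "1 < s" "0 < (\<Sum>b\<in>F. (1 / (cmod b)\<^sup>2) powr s) - 4 powr s"
    using eventually_happens[of _ "at_right (1::real)"] by auto
  have "distort s < ennreal (\<Sum>b\<in>F. (1 / (cmod b)\<^sup>2) powr s)"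
    using s by (simp add: distort_def ennreal_less_iff)
  also have "\<dots> = esum (\<lambda>b. ennreal ((1 / (cmod b)\<^sup>2) powr s)) F"
    using F by (simp add: esum_finite sum_ennreal)
  also have "\<dots> \<le> part_sum I s 1"
    using F by (simp add: part_sum_1 esum_subset_mono)
  finally show ?thesis using that s by blast
qed

text \<open>By supermultiplicativity of \<open>part_sum / distort\<close>, exceeding
  \<open>distort s\<close> once forces exponential growth along multiples. Membership thus expresses
  positive pressure, and \<open>crit\<close> is the exponent at which the pressure changes
  sign.\<close>

definition crit_set :: "real set" where
  "crit_set = {s. 0 \<le> s \<and> (\<exists>n. distort s < part_sum I s n)}"

definition crit :: real where
  "crit = Sup crit_set"

lemma crit_set_bound: "\<exists>t<2. \<forall>s\<in>crit_set. s \<le> t"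
proof -
  obtain t where t: "0 < t" "t < 2" "\<And>n. part_sum I t n \<le> 1"
    using part_sum_le_1 by blast
  have "s \<le> t" if s: "s \<in> crit_set" for s
  proof (rule ccontr)
    obtain n where n: "0 \<le> s" "distort s < part_sum I s n"
      using s by (auto simp: crit_set_def)
    assume "\<not> s \<le> t"
    then have "part_sum I s n \<le> 1"
      using part_sum_antimono[of I t s n] t(3)[of n] by simp
    then show False using n one_le_distort[of s] by simp
  qed
  then show ?thesis using t by auto
qed

lemma crit_set_bdd: "bdd_above crit_set"
  using crit_set_bound by (auto intro: bdd_aboveI)

lemma crit_upper: "0 \<le> s \<Longrightarrow> distort s < part_sum I s n \<Longrightarrow> s \<le> crit"
  unfolding crit_def by (rule cSup_upper[OF _ crit_set_bdd]) (auto simp: crit_set_def)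

lemma crit_gt_1: "1 < crit" and crit_set_nonempty: "crit_set \<noteq> {}"
proof -
  obtain s where s: "1 < s" "distort s < part_sum I s 1"
    by (rule part_sum_1_unbounded)
  then show "1 < crit" using crit_upper[of s 1] by simp
  have "s \<in> crit_set" using s by (auto simp: crit_set_def)
  then show "crit_set \<noteq> {}" by blast
qed

lemma crit_lt_2: "crit < 2"
proof -
  obtain t where t: "t < 2" "\<forall>s\<in>crit_set. s \<le> t"
    using crit_set_bound by auto
  have "crit \<le> t" unfolding crit_def
    by (rule cSup_least[OF crit_set_nonempty]) (use t in auto)
  then show ?thesis using t by simp
qed

lemma less_crit:
  assumes "0 \<le> s" "s < crit"
  obtains n where "0 < n" "distort s < part_sum I s n"
proof -
  obtain u n where u: "0 \<le> u" "s < u" and n: "distort u < part_sum I u n"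
    using assms(2) less_cSup_iff[OF crit_set_nonempty crit_set_bdd, of s] unfolding crit_def crit_set_def by auto
  have "distort s \<le> distort u" using u by (simp add: distort_def)
  also note n
  also have "part_sum I u n \<le> part_sum I s n" using u by (intro part_sum_antimono) auto
  finally have *: "distort s < part_sum I s n" .
  then have "0 < n" using one_le_distort[OF assms(1)] by (cases n) auto
  then show ?thesis using that * by blast
qed

text \<open>To the right of \<open>crit\<close> the bound holds by definition; it passes to
  \<open>crit\<close> on finite sets of words, where the sum is continuous in the exponent, and then
  to their supremum.\<close>

lemma part_sum_crit_le: "part_sum I crit n \<le> distort crit"
  unfolding part_sum_def esum_le_iff
proof (intro allI impI)
  fix F assume F: "finite F" "F \<subseteq> words I n"
  then have pos: "0 < deriv0 w" if "w \<in> F" for w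
    using that by (auto intro!: deriv0_pos simp: words_def)
  have "(\<Sum>w\<in>F. deriv0 w powr s) \<le> 4 powr s" if "crit < s" for s
  proof -
    have "\<not> distort s < part_sum I s n"
    proof
      assume "distort s < part_sum I s n"
      moreover have "0 \<le> s" using that crit_gt_1 by simp
      ultimately have "s \<le> crit" by (intro crit_upper)
      then show False using that by simp
    qed
    moreover have "esum (weight s) F \<le> part_sum I s n"
      unfolding part_sum_def by (rule esum_subset_mono[OF F(2)])
    ultimately have "sum (weight s) F \<le> distort s"
      using F(1) by (simp add: esum_finite)
    then have "ennreal (\<Sum>w\<in>F. deriv0 w powr s) \<le> ennreal (4 powr s)"
      by (simp add: weight_def sum_ennreal distort_def)
    then show ?thesis by simp
  qed
  then have "\<forall>\<^sub>F s in at_right crit. (\<Sum>w\<in>F. deriv0 w powr s) \<le> 4 powr s"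
    using eventually_at_right_less[of crit] by (rule eventually_mono[rotated])
  moreover have "((\<lambda>s. \<Sum>w\<in>F. deriv0 w powr s) \<longlongrightarrow> (\<Sum>w\<in>F. deriv0 w powr crit)) (at_right crit)"
    by (intro tendsto_intros) (use pos in force)
  moreover have "((\<lambda>s. 4 powr s) \<longlongrightarrow> (4::real) powr crit) (at_right crit)"
    by (intro tendsto_intros) auto
  ultimately have "(\<Sum>w\<in>F. deriv0 w powr crit) \<le> 4 powr crit"
    by (intro tendsto_le[of "at_right crit"]) auto
  then show "sum (weight crit) F \<le> distort crit"
    by (simp add: weight_def sum_ennreal distort_def)
qed

text \<open>If this failed for \<open>n\<close>, left continuity (available because
  \<open>1 < crit\<close>) would give some \<open>t < crit\<close> with
  \<open>distort t * part_sum I t n \<le> 1\<close>, which persists along multiples of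
  \<open>n\<close>. But \<open>t < crit\<close> makes the sums at least \<open>distort t > 1\<close>
  along multiples of some \<open>k\<close>, a contradiction at \<open>k * n\<close>.\<close>

lemma part_sum_crit_ge: "1 \<le> distort crit * part_sum I crit n"
proof (rule ccontr)
  assume "\<not> 1 \<le> distort crit * part_sum I crit n"
  then have less: "distort crit * part_sum I crit n < 1" by simp
  have "n \<noteq> 0"
  proof
    assume "n = 0"
    then show False using less one_le_distort[of crit] crit_gt_1 by simp
  qed
  obtain c where c: "part_sum I crit n < c" "distort crit * c \<le> 1"
  proof -
    have "(4::real) powr crit * (1 / 4 powr crit) = 1" by simp
    then have e: "distort crit * ennreal (1 / 4 powr crit) = 1"
      unfolding distort_def by (subst ennreal_mult[symmetric]) (simp_all only: powr_ge_zero ennreal_1 divide_nonneg_nonneg zero_le_one)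
    then have "part_sum I crit n < ennreal (1 / 4 powr crit)"
      using less mult_left_mono[of "ennreal (1 / 4 powr crit)" "part_sum I crit n" "distort crit"]
      by (metis not_le order_refl zero_le)
    then show ?thesis using that e by simp
  qed
  define r where "r = (1 + crit) / 2"
  have r: "1 < r" "r < crit" using crit_gt_1 by (auto simp: r_def)
  have fin: "part_sum I r n < \<infinity>"
    using r by (intro part_sum_finite[OF _ _ part_sum_1_finite]) auto
  have pos: "0 < deriv0 w" if "w \<in> words I n" for w
    using that by (auto intro!: deriv0_pos simp: words_def)
  have eq: "part_sum I t n = esum (\<lambda>w. ennreal (deriv0 w powr t)) (words I n)" for t
    by (simp add: part_sum_def weight_def[abs_def])
  obtain t where t: "r < t" "t < crit" "part_sum I t n < c"
    using esum_powr_less_left[OF pos c(1)[unfolded eq] fin[unfolded eq] r(2)] unfolding eq by blast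
  have t0: "0 \<le> t" "0 < t" using t r by auto
  have "distort t * part_sum I t n \<le> distort crit * c"
    using t by (intro mult_mono) (auto simp: distort_def)
  then have le: "distort t * part_sum I t n \<le> 1" using c by simp
  obtain k where k: "0 < k" "distort t < part_sum I t k"
    using less_crit[OF t0(1) t(2)] by blast
  have "distort t \<le> part_sum I t (k * n)"
    using k \<open>n \<noteq> 0\<close> t0 by (intro part_sum_multiple_ge) auto
  moreover have "distort t * part_sum I t (n * k) \<le> 1"
    using le k t0 by (intro part_sum_multiple_le) auto
  ultimately have "distort t * distort t \<le> 1"
    by (metis mult.commute mult_left_mono order_trans zero_le)
  then have "4 powr t * 4 powr t \<le> (1::real)"
    by (simp add: distort_def flip: ennreal_mult)
  moreover have "1 < (4::real) powr t" using t0 by simp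
  ultimately show False using mult_strict_mono[of 1 "4 powr t" 1 "4 powr t :: real"] by simp
qed

section \<open>Avoiding cylinders of small weight\<close>

text \<open>A substitute for the mass of a cylinder is the weighted share, among words of length
  \<open>N\<close>, of those extending \<open>u\<close>, in the limit superior over
  \<open>N\<close>. It is 1 for the empty word and at most a multiple of \<open>weight s u\<close>,
  since partition sums are bounded below. The limsup loses additivity but keeps the subadditivity
  that the greedy choice uses.\<close>

lemma exists_sequence_avoiding_small:
  assumes F: "F \<subseteq> I" and s: "0 \<le> s" and c: "0 < c" "\<And>n. ennreal c \<le> part_sum F s n"
    and fin: "part_sum F s 1 < \<infinity>"
  obtains \<kappa> where "0 < \<kappa>"
    "\<And>W. W \<subseteq> lists F \<Longrightarrow> esum (weight s) W < ennreal \<kappa> \<Longrightarrow>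
        \<exists>\<alpha>. range \<alpha> \<subseteq> F \<and> (\<forall>n. map \<alpha> [0..<n] \<notin> W)"
proof -
  let ?Z = "part_sum F s" and ?D = "distort s"
  define A where "A N u = esum (\<lambda>v. weight s (u @ v)) (words F (N - length u)) / ?Z N" for N u
  define a where "a u = limsup (\<lambda>N. A N u)" for u
  define k where "k = 4 powr s * 4 powr s / c"
  have k: "0 < k" using c by (simp add: k_def)
  have Zfin: "?Z n < \<infinity>" for n by (rule part_sum_finite[OF F s fin])
  have Zpos: "0 < ?Z n" for n using c(2)[of n] c(1) by (simp add: less_le_trans[of 0 "ennreal c"])
  have A_le: "A N u \<le> ennreal k * weight s u" if u: "u \<in> lists F" for N u
  proof -
    have "esum (\<lambda>v. weight s (u @ v)) (words F (N - length u)) \<le>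
        esum (\<lambda>v. ?D * (weight s u * weight s v)) (words F (N - length u))"
      using u F s by (intro esum_mono weight_append) (auto simp: words_def)
    then have 1: "esum (\<lambda>v. weight s (u @ v)) (words F (N - length u)) \<le> ?D * weight s u * ?Z (N - length u)"
      by (simp add: esum_cmult part_sum_def mult.assoc)
    have 2: "ennreal c * ?Z (N - length u) \<le> ?D * ?Z N"
    proof (cases "length u \<le> N")
      case True
      have "ennreal c * ?Z (N - length u) \<le> ?Z (length u) * ?Z (N - length u)"
        by (intro mult_right_mono c) auto
      also have "\<dots> \<le> ?D * ?Z N"
        using part_sum_add(2)[OF F s, of "length u" "N - length u"] True by simp
      finally show ?thesis .
    next
      case False
      \<comment> \<open>For \<open>N < length u\<close> truncated subtraction gives length 0, where
        the partition sum is 1.\<close>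
      then have "ennreal c * ?Z (N - length u) = 1 * ennreal c" by simp
      also have "\<dots> \<le> ?D * ?Z N" using one_le_distort[OF s] c by (intro mult_mono) auto
      finally show ?thesis .
    qed
    have cc: "ennreal (1 / c) * ennreal c = 1" using c by (simp flip: ennreal_mult)
    have kk: "ennreal k = ennreal (1 / c) * (?D * ?D)"
      using c by (simp add: k_def distort_def flip: ennreal_mult)
    have "?D * weight s u * ?Z (N - length u) =
        ennreal (1 / c) * (?D * weight s u) * (ennreal c * ?Z (N - length u))"
      using cc by (metis mult.assoc mult.commute mult.left_commute mult_1)
    also have "\<dots> \<le> ennreal (1 / c) * (?D * weight s u) * (?D * ?Z N)"
      using 2 by (rule mult_left_mono) simp
    also have "\<dots> = (ennreal k * weight s u) * ?Z N"
      unfolding kk by (simp add: ac_simps)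
    finally have "esum (\<lambda>v. weight s (u @ v)) (words F (N - length u)) \<le> (ennreal k * weight s u) * ?Z N"
      using 1 by (rule order_trans[rotated])
    then have "A N u \<le> (ennreal k * weight s u) * ?Z N / ?Z N"
      unfolding A_def by (rule divide_right_mono_ennreal)
    also have "\<dots> = ennreal k * weight s u"
      using Zpos[of N] Zfin[of N] by (subst ennreal_mult_divide_eq) auto
    finally show ?thesis .
  qed
  have a_le: "a u \<le> ennreal k * weight s u" if "u \<in> lists F" for u
    unfolding a_def by (intro Limsup_bounded always_eventually allI A_le that)
  have "A N [] = 1" for N
    using Zpos[of N] Zfin[of N] by (simp add: A_def flip: part_sum_def)
  then have a_Nil: "a [] = 1" by (simp add: a_def Limsup_const)
  have sub: "a u \<le> esum (\<lambda>b. a (u @ [b])) F" if u: "u \<in> lists F" for u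
  proof -
    have "A N u = esum (\<lambda>b. A N (u @ [b])) F" if "length u < N" for N
    proof -
      have "N - length u = Suc 0 + (N - length (u @ [b]))" for b :: complex using that by simp
      then have "esum (\<lambda>v. weight s (u @ v)) (words F (N - length u)) =
        esum (\<lambda>b. esum (\<lambda>v. weight s (u @ b # v)) (words F (N - Suc (length u)))) F"
        using that esum_words_append[of "\<lambda>v. weight s (u @ v)" F "Suc 0" "N - Suc (length u)"]
        by (simp add: esum_words_1)
      then show ?thesis by (simp add: A_def esum_divide)
    qed
    then have "\<forall>\<^sub>F N in sequentially. A N u \<le> esum (\<lambda>b. A N (u @ [b])) F"
      by (intro eventually_mono[OF eventually_gt_at_top[of "length u"]]) simp
    then have "a u \<le> limsup (\<lambda>N. esum (\<lambda>b. A N (u @ [b])) F)"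
      unfolding a_def by (rule Limsup_mono)
    also have "\<dots> \<le> esum (\<lambda>b. a (u @ [b])) F"
      unfolding esum_def a_def
    \<comment> \<open>Reverse Fatou over the letters: the majorant
      \<open>k * weight s (u @ [b])\<close> has a finite sum because \<open>part_sum F s 1\<close>
      is finite.\<close>
    proof (rule nn_integral_limsup)
      show "AE b in count_space F. A N (u @ [b]) \<le> ennreal k * weight s (u @ [b])" for N
        unfolding AE_count_space using A_le u by auto
      have "esum (\<lambda>b. ennreal k * weight s (u @ [b])) F \<le> esum (\<lambda>b. ennreal k * (?D * (weight s u * weight s [b]))) F"
        using u F s by (intro esum_mono mult_left_mono weight_append) auto
      also have "\<dots> = ennreal k * (?D * (weight s u * ?Z 1))"
        by (simp add: esum_cmult part_sum_def esum_words_1)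
      also have "\<dots> < \<infinity>"
        using fin distort_pos(3)[of s] by (simp add: ennreal_mult_less_top less_top weight_def)
      finally show "(\<integral>\<^sup>+ b. ennreal k * weight s (u @ [b]) \<partial>count_space F) < \<infinity>"
        by (simp add: esum_def)
    qed auto
    finally show ?thesis .
  qed
  show ?thesis
  proof (rule that[of "1 / k"])
    fix W assume W: "W \<subseteq> lists F" "esum (weight s) W < ennreal (1 / k)"
    have kk: "ennreal k * ennreal (1 / k) = 1" using k by (simp flip: ennreal_mult)
    have "esum a W \<le> esum (\<lambda>w. ennreal k * weight s w) W"
      using W by (intro esum_mono a_le) auto
    also have "\<dots> = ennreal k * esum (weight s) W" by (rule esum_cmult)
    also have "\<dots> < ennreal k * ennreal (1 / k)"
      using W(2) k by (intro ennreal_mult_strict_left_mono) auto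
    finally have "esum a W < a []" by (simp add: kk a_Nil)
    then show "\<exists>\<alpha>. range \<alpha> \<subseteq> F \<and> (\<forall>n. map \<alpha> [0..<n] \<notin> W)"
      using exists_sequence_avoiding[of F a W] sub by metis
  qed (use k in simp)
qed

text \<open>Words are sorted by the position of their first letter outside \<open>F\<close>.\<close>

lemma subsystem_sum_le:
  assumes F: "F \<subseteq> I"
  shows "(\<Sum>n<N. part_sum F crit n) * esum (\<lambda>b. weight crit [b]) (I - F) \<le> distort crit ^ 4"
proof -
  let ?D = "distort crit" and ?t = "esum (\<lambda>b. weight crit [b]) (I - F)"
  define P where "P n = words F n \<times> (I - F) \<times> words I (N - Suc n)" for n
  define h where "h = (\<lambda>(u, b, v). u @ b # v :: complex list)"
  have inj: "inj_on h (P n)" for n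
    by (auto simp: inj_on_def P_def h_def words_def)
  have crit0: "0 \<le> crit" using crit_gt_1 by simp
  have disj: "disjoint_family_on (\<lambda>n. h ` P n) {..<N}"
  proof -
    have "h ` P m \<inter> h ` P n = {}" if "m < n" for m n
    proof (intro equals0I)
      fix w assume "w \<in> h ` P m \<inter> h ` P n"
      then have "w \<in> h ` P m" "w \<in> h ` P n" by auto
      then obtain p q where pq: "p \<in> P m" "w = h p" "q \<in> P n" "w = h q" by blast
      obtain u b v where p: "p = (u, b, v)" by (cases p) auto
      obtain u' b' v' where q: "q = (u', b', v')" by (cases q) auto
      have w: "w = u @ b # v" "w = u' @ b' # v'"
        and u: "length u = m" "b \<notin> F" and u': "length u' = n" "u' \<in> lists F"
        using pq by (auto simp: p q P_def h_def words_def)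
      have "w ! m = b" using w(1) u by (simp add: nth_append)
      moreover have "w ! m = u' ! m" using w(2) u' that by (simp add: nth_append)
      moreover have "u' ! m \<in> F" using u' that by (auto simp: in_lists_conv_set)
      ultimately show False using u by simp
    qed
    then show ?thesis
      unfolding disjoint_family_on_def by (metis Int_commute linorder_neqE_nat)
  qed
  have sub: "h ` P n \<subseteq> words I N" if "n < N" for n
    using F that by (auto simp: P_def h_def words_def) blast
  have "part_sum F crit n * ?t \<le> ?D * (?D * (?D * esum (weight crit) (h ` P n)))" if n: "n < N" for n
  proof -
    \<comment> \<open>Completing the words to length \<open>N\<close> costs one factor
      \<open>distort crit\<close>, gluing the three pieces two more; the fourth comes from the bound
      for all words of length \<open>N\<close>.\<close>
    have "part_sum F crit n * ?t * 1 \<le> part_sum F crit n * ?t * (?D * part_sum I crit (N - Suc n))"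
      by (intro mult_left_mono part_sum_crit_ge) auto
    also have "\<dots> = ?D * esum (\<lambda>u. esum (\<lambda>b. esum (\<lambda>v. weight crit u * (weight crit [b] * weight crit v))
        (words I (N - Suc n))) (I - F)) (words F n)"
      by (simp add: part_sum_def esum_cmult esum_multc ac_simps)
    also have "\<dots> \<le> ?D * esum (\<lambda>u. esum (\<lambda>b. esum (\<lambda>v. ?D * (?D * weight crit (h (u, b, v))))
        (words I (N - Suc n))) (I - F)) (words F n)"
    proof (intro mult_left_mono esum_mono)
      fix u b v assume u: "u \<in> words F n" and b: "b \<in> I - F" and v: "v \<in> words I (N - Suc n)"
      then show "weight crit u * (weight crit [b] * weight crit v) \<le> ?D * (?D * weight crit (h (u, b, v)))"
        unfolding h_def split_conv using F crit0 by (intro weight_append_Cons) (auto simp: words_def)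
    qed auto
    also have "\<dots> = ?D * (?D * (?D * esum (weight crit) (h ` P n)))"
    proof -
      have "esum (weight crit) (h ` P n) = esum (\<lambda>u. esum (\<lambda>b. esum (\<lambda>v. weight crit (h (u, b, v)))
          (words I (N - Suc n))) (I - F)) (words F n)"
        unfolding esum_image[OF inj] by (simp add: P_def esum_Sigma)
      then show ?thesis by (simp add: esum_cmult)
    qed
    finally show ?thesis by simp
  qed
  then have "(\<Sum>n<N. part_sum F crit n * ?t) \<le> (\<Sum>n<N. ?D * (?D * (?D * esum (weight crit) (h ` P n))))"
    by (intro sum_mono) auto
  also have "\<dots> = ?D * (?D * (?D * esum (weight crit) (\<Union>n<N. h ` P n)))"
    by (simp add: esum_UN_disjoint[OF disj] esum_finite sum_distrib_left)
  also have "\<dots> \<le> ?D * (?D * (?D * part_sum I crit N))"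
    unfolding part_sum_def using sub by (intro mult_left_mono esum_subset_mono) auto
  also have "\<dots> \<le> ?D * (?D * (?D * ?D))"
    by (intro mult_left_mono part_sum_crit_le) auto
  finally show ?thesis by (simp add: sum_distrib_right power4_eq_xxxx mult.assoc)
qed

text \<open>Omitting even one letter destroys the lower bound at \<open>crit\<close>: sums bounded
  below by \<open>e\<close> would add up to at least \<open>N * e\<close>, against the bound of
  \<open>subsystem_sum_le\<close>, which is independent of \<open>N\<close>.\<close>

lemma subsystem_partition_sum_small:
  assumes F: "F \<subseteq> I" "F \<noteq> I" and e: "0 < e"
  obtains n where "part_sum F crit n < e"
proof (rule ccontr)
  let ?t = "esum (\<lambda>b. weight crit [b]) (I - F)"
  assume "\<not> thesis"
  then have ge: "e \<le> part_sum F crit n" for n using that by (meson not_less)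
  obtain b where b: "b \<in> I - F" using F by auto
  then have "0 < weight crit [b]" by (intro weight_pos) auto
  also have "\<dots> \<le> ?t" using b by (rule esum_member_le)
  finally have t: "0 < ?t" .
  have "of_nat N * (e * ?t) \<le> distort crit ^ 4" for N
  proof -
    have "of_nat N * e \<le> (\<Sum>n<N. part_sum F crit n)"
      using sum_mono[of "{..<N}" "\<lambda>_. e" "part_sum F crit"] ge by simp
    then have "of_nat N * e * ?t \<le> (\<Sum>n<N. part_sum F crit n) * ?t" by (rule mult_right_mono) simp
    then show ?thesis using subsystem_sum_le[OF F(1), of N] by (simp add: mult.assoc)
  qed
  then have "(SUP N. of_nat N * (e * ?t)) \<le> distort crit ^ 4" by (rule SUP_least)
  moreover have "(SUP N. of_nat N * (e * ?t)) = (SUP N::nat. of_nat N) * (e * ?t)"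
    by (rule SUP_mult_right_ennreal[symmetric])
  moreover have "(SUP N::nat. of_nat N :: ennreal) = top"
    by (rule ennreal_SUP_of_nat_eq_top)
  moreover have "top * (e * ?t) = top" using e t by (simp add: ennreal_top_mult zero_less_iff_neq_zero)
  ultimately have "distort crit ^ 4 = top" by (simp add: top_unique)
  moreover have "distort crit ^ 4 < top" by (simp add: distort_def ennreal_power)
  ultimately show False by simp
qed

section \<open>Hausdorff measure of the limit set\<close>

lemma prefix_in_lists: "range \<alpha> \<subseteq> F \<Longrightarrow> map \<alpha> [0..<n] \<in> lists F"
  by (auto simp: image_subset_iff)

text \<open>Shifts the index of words from 1 to 0 and adds the level \<open>n = 0\<close>. That
  level only states \<open>x \<in> X\<close>, which the first level implies.\<close>

lemma mem_limit_set_iff: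
  "x \<in> J \<longleftrightarrow> (\<exists>\<alpha>. range \<alpha> \<subseteq> I \<and> (\<forall>n. x \<in> cf (map \<alpha> [0..<n]) ` X))"
proof
  assume "x \<in> J"
  then obtain w where w: "w \<in> {1..} \<rightarrow> I" "\<And>n. 1 \<le> n \<Longrightarrow> x \<in> gccf_word w n ` X"
    by (auto simp: gccf_limit_set_def)
  define \<alpha> where "\<alpha> i = w (Suc i)" for i
  have \<alpha>: "range \<alpha> \<subseteq> I" using w(1) by (auto simp: \<alpha>_def)
  have n1: "x \<in> cf (map \<alpha> [0..<n]) ` X" if "1 \<le> n" for n
    using w(2)[OF that] unfolding \<alpha>_def by (simp add: gccf_word_eq)
  have "x \<in> X" using n1[of 1] cf_in_disc[of "map \<alpha> [0..<1]"] \<alpha> by auto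
  then have "x \<in> cf (map \<alpha> [0..<n]) ` X" for n
    using n1[of n] by (cases "n = 0") auto
  then show "\<exists>\<alpha>. range \<alpha> \<subseteq> I \<and> (\<forall>n. x \<in> cf (map \<alpha> [0..<n]) ` X)"
    using \<alpha> by blast
next
  assume "\<exists>\<alpha>. range \<alpha> \<subseteq> I \<and> (\<forall>n. x \<in> cf (map \<alpha> [0..<n]) ` X)"
  then obtain \<alpha> where \<alpha>: "range \<alpha> \<subseteq> I" "\<And>n. x \<in> cf (map \<alpha> [0..<n]) ` X" by blast
  define w where "w i = \<alpha> (i - 1)" for i
  have "w \<in> {1..} \<rightarrow> I" using \<alpha> by (auto simp: w_def)
  moreover have "gccf_word w n = cf (map \<alpha> [0..<n])" for n by (simp add: gccf_word_eq w_def)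
  ultimately show "x \<in> J"
    using \<alpha>(2) unfolding gccf_limit_set_def by (intro UN_I[of w]) auto
qed

lemma continuous_on_cf: "w \<in> lists I \<Longrightarrow> continuous_on X (cf w)"
proof (rule lipschitz_on_continuous_on)
  show "w \<in> lists I \<Longrightarrow> (4 * deriv0 w)-lipschitz_on X (cf w)"
    using cf_lipschitz deriv0_pos[of w] by (intro lipschitz_onI) auto
qed

lemma compact_disc: "compact X"
proof -
  have "X = cball (1/2) (1/2)"
    by (auto simp: gccf_disc_def dist_norm norm_minus_commute)
  then show ?thesis by (metis compact_cball)
qed

lemma cf_image_append_subset: "u \<in> lists I \<Longrightarrow> v \<in> lists I \<Longrightarrow> cf (u @ v) ` X \<subseteq> cf u ` X"
  by (auto simp: cf_append intro!: imageI cf_in_disc)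

lemma limit_point_exists:
  assumes "range \<alpha> \<subseteq> I"
  obtains x where "\<And>n. x \<in> cf (map \<alpha> [0..<n]) ` X"
proof -
  have "\<Inter>(range (\<lambda>n. cf (map \<alpha> [0..<n]) ` X)) \<noteq> {}"
  proof (rule compact_nest)
    show "compact (cf (map \<alpha> [0..<n]) ` X)" for n
      by (intro compact_continuous_image continuous_on_cf compact_disc prefix_in_lists assms)
    show "cf (map \<alpha> [0..<n]) ` X \<noteq> {}" for n using zero_in_disc by blast
    fix m n :: nat assume "m \<le> n"
    then have "map \<alpha> [0..<n] = map \<alpha> [0..<m] @ map \<alpha> [m..<n]"
      by (metis le0 le_add_diff_inverse map_append upt_add_eq_append)
    then show "cf (map \<alpha> [0..<n]) ` X \<subseteq> cf (map \<alpha> [0..<m]) ` X"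
      using assms by (simp only:) (rule cf_image_append_subset; auto simp: image_subset_iff)
  qed
  then show ?thesis using that by auto
qed

lemma cf_dist_le: "w \<in> lists I \<Longrightarrow> x \<in> cf w ` X \<Longrightarrow> y \<in> cf w ` X \<Longrightarrow> dist x y \<le> 4 * deriv0 w"
proof -
  assume w: "w \<in> lists I" and "x \<in> cf w ` X" "y \<in> cf w ` X"
  then obtain z z' where z: "z \<in> X" "z' \<in> X" "x = cf w z" "y = cf w z'" by blast
  have "dist z z' \<le> 1"
    using z dist_triangle2[of z z' "1/2"] by (simp add: gccf_disc_def dist_norm)
  then have "4 * deriv0 w * dist z z' \<le> 4 * deriv0 w * 1"
    using deriv0_pos[OF w] by (intro mult_left_mono) auto
  then show ?thesis using cf_lipschitz[OF w z(1,2)] z by simp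
qed

section \<open>Cut sets and the lower bound for the dimension\<close>

lemma half_in_disc: "1/2 \<in> X"
  by (simp add: gccf_disc_def)

text \<open>Around the centre of the disc \<open>ball_subset_cf_image\<close> applies with radius
  \<open>1/2\<close>, which turns its constant 8 into 16.\<close>

lemma cf_ball_disjoint:
  assumes "u \<in> lists I" "v \<in> lists I" "\<not> prefix u v" "\<not> prefix v u"
    and "\<rho> \<le> deriv0 u / 16" "\<rho> \<le> deriv0 v / 16"
  shows "ball (cf u (1/2)) \<rho> \<inter> ball (cf v (1/2)) \<rho> = {}"
proof -
  have sub: "ball (cf w (1/2)) \<rho> \<subseteq> cf w ` ball (1/2) (1/2)"
    if "w \<in> lists I" "\<rho> \<le> deriv0 w / 16" for w
    using ball_subset_cf_image[OF that(1) open_disc_subset] that(2) subset_ball[of \<rho>] by fastforce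
  have "cf u ` ball (1/2) (1/2) \<inter> cf v ` ball (1/2) (1/2) = {}"
    using cf_eq_imp_comparable[OF assms(1,2)] assms(3,4) by blast
  then show ?thesis using sub[OF assms(1,5)] sub[OF assms(2,6)] by blast
qed

text \<open>The Moran cut at scale \<open>r\<close>: every infinite word over \<open>F\<close>
  passes through it exactly once, and over a finite alphabet its cylinders have size comparable to
  \<open>r\<close>.\<close>

definition stopping_words :: "complex set \<Rightarrow> real \<Rightarrow> complex list set" where
  "stopping_words F r = {w \<in> lists F. deriv0 w < r \<and> (\<forall>n<length w. r \<le> deriv0 (take n w))}"

lemma stopping_words_antichain:
  assumes "u \<in> stopping_words F r" "v \<in> stopping_words F r" "prefix u v"
  shows "u = v"
proof (rule ccontr)
  assume "u \<noteq> v"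
  then have "length u < length v" "take (length u) v = u"
    using assms(3) by (auto simp: prefix_def)
  then show False using assms(1,2) by (auto simp: stopping_words_def)
qed

lemma stopping_prefix_exists:
  assumes "range \<alpha> \<subseteq> F" "F \<subseteq> I" "0 < r"
  obtains n where "map \<alpha> [0..<n] \<in> stopping_words F r"
proof -
  have "\<exists>n. (4/5) ^ n < r" using assms(3) by (intro real_arch_pow_inv) auto
  moreover have "deriv0 (map \<alpha> [0..<n]) \<le> (4/5) ^ n" for n
    using deriv0_le_power[OF prefix_in_lists[of \<alpha> I n]] assms by simp
  ultimately have ex: "\<exists>n. deriv0 (map \<alpha> [0..<n]) < r" by (meson le_less_trans)
  define n where "n = (LEAST n. deriv0 (map \<alpha> [0..<n]) < r)"
  have "deriv0 (map \<alpha> [0..<n]) < r" unfolding n_def by (rule LeastI_ex[OF ex])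
  moreover have "r \<le> deriv0 (take m (map \<alpha> [0..<n]))" if "m < n" for m
    using not_less_Least[of m "\<lambda>n. deriv0 (map \<alpha> [0..<n]) < r"] that
    by (simp add: n_def take_map)
  ultimately show ?thesis
    using that[of n] prefix_in_lists[OF assms(1), of n] by (auto simp: stopping_words_def)
qed

lemma stopping_words_size_ge:
  assumes "w \<in> stopping_words F r" "F \<subseteq> I" "r \<le> 1" "\<And>b. b \<in> F \<Longrightarrow> q \<le> deriv0 [b]" "0 < q"
  shows "q * r / 4 \<le> deriv0 w"
proof -
  have w: "w \<in> lists F" "deriv0 w < r" using assms(1) by (auto simp: stopping_words_def)
  have "w \<noteq> []" using w(2) assms(3) by auto
  then obtain u b where ub: "w = u @ [b]" by (metis append_butlast_last_id)
  have "r \<le> deriv0 (take (length u) w)" using assms(1) unfolding stopping_words_def ub by auto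
  then have r: "r \<le> deriv0 u" by (simp add: ub)
  have l: "u \<in> lists I" "[b] \<in> lists I" "b \<in> F" using w(1) assms(2) by (auto simp: ub)
  have "r * q \<le> deriv0 u * deriv0 [b]"
    using r assms(4)[OF l(3)] assms(5) deriv0_pos[OF l(1)] by (intro mult_mono) auto
  also have "\<dots> \<le> 4 * deriv0 w" unfolding ub by (rule deriv0_append(2)[OF l(1,2)])
  finally show ?thesis by (simp add: mult.commute)
qed

lemma card_stopping_words_le:
  assumes F: "F \<subseteq> I" and q: "\<And>b. b \<in> F \<Longrightarrow> q \<le> deriv0 [b]" "0 < q" "q \<le> 1"
    and r: "0 < r" "r \<le> 1" and U: "bounded U" "diameter U \<le> r"
    and S: "finite S" "S \<subseteq> {w \<in> stopping_words F r. cf w ` X \<inter> U \<noteq> {}}"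
  shows "real (card S) \<le> (384 / q)\<^sup>2"
proof (cases "S = {}")
  case False
  then obtain w0 where "w0 \<in> S" by blast
  then obtain x where x: "x \<in> U" using S(2) by auto
  \<comment> \<open>Stopping words have derivative at least \<open>q * r / 4\<close>, and
    \<open>cf_ball_disjoint\<close> asks for a sixteenth of it. The disjoint balls lie within
    \<open>6 * r\<close> of \<open>x\<close>: \<open>r\<close> for the diameter of \<open>U\<close>,
    \<open>4 * r\<close> for the cylinder and at most \<open>r\<close> for \<rho>. Hence
    \<open>384 = 6 * 64\<close>.\<close>
  define \<rho> where "\<rho> = q * r / 64"
  have \<rho>: "0 < \<rho>" "\<rho> \<le> r" using q r by (auto simp: \<rho>_def)
  have lists: "w \<in> lists I" and le: "\<rho> \<le> deriv0 w / 16" and less: "deriv0 w < r" if "w \<in> S" for w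
  proof -
    have w: "w \<in> stopping_words F r" using that S(2) by auto
    show "w \<in> lists I" "deriv0 w < r" using w F by (auto simp: stopping_words_def)
    show "\<rho> \<le> deriv0 w / 16"
      using stopping_words_size_ge[OF w F r(2) q(1,2)] by (simp add: \<rho>_def)
  qed
  have "real (card S) * \<rho>\<^sup>2 \<le> (6 * r)\<^sup>2"
  proof (rule card_disjoint_balls_le[OF S(1)])
    show "disjoint_family_on (\<lambda>w. ball (cf w (1/2)) \<rho>) S"
    proof (unfold disjoint_family_on_def, intro ballI impI)
      fix u v assume uv: "u \<in> S" "v \<in> S" "u \<noteq> v"
      then have "\<not> prefix u v" "\<not> prefix v u"
        using S(2) stopping_words_antichain by blast+
      then show "ball (cf u (1/2)) \<rho> \<inter> ball (cf v (1/2)) \<rho> = {}"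
        by (intro cf_ball_disjoint lists le uv)
    qed
    fix w assume w: "w \<in> S"
    then have "cf w ` X \<inter> U \<noteq> {}" using S(2) by auto
    then obtain y where y: "y \<in> cf w ` X" "y \<in> U" by blast
    have "dist x y \<le> r" using diameter_bounded_bound[OF U(1) x y(2)] U(2) by simp
    moreover have "dist y (cf w (1/2)) \<le> 4 * deriv0 w"
      by (intro cf_dist_le lists w y imageI half_in_disc)
    ultimately have d: "dist x (cf w (1/2)) < 5 * r"
      using less[OF w] dist_triangle[of x "cf w (1/2)" y] by simp
    show "ball (cf w (1/2)) \<rho> \<subseteq> ball x (6 * r)"
    proof
      fix z assume "z \<in> ball (cf w (1/2)) \<rho>"
      then show "z \<in> ball x (6 * r)"
        using d \<rho> dist_triangle[of x z "cf w (1/2)"] by simp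
    qed
  qed (use \<rho> r in auto)
  then have "real (card S) \<le> (6 * r / \<rho>)\<^sup>2"
    using \<rho> by (simp add: power_divide field_simps)
  also have "6 * r / \<rho> = 384 / q" using r q by (simp add: \<rho>_def)
  finally show ?thesis .
qed simp

text \<open>A finite alphabet \<open>F\<close> already has supercritical sums at some
  \<open>t < crit\<close>, and its least derivative \<open>q\<close> is positive. So each set of a
  cheap cover meets boundedly many cylinders of its own size; avoiding all of these yields a limit
  point outside the cover.\<close>

lemma hausdorff_measure_below_crit:
  assumes s: "0 \<le> s" "s < crit"
  shows "hausdorff_measure s (J) \<noteq> 0"
proof
  assume zero: "hausdorff_measure s J = 0"
  define t where "t = (max s 1 + crit) / 2"
  have t: "s \<le> t" "1 < t" "t < crit" using s crit_gt_1 by (auto simp: t_def)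
  have t0: "0 \<le> t" "0 < t" using t by auto
  obtain n where n: "0 < n" "distort t < part_sum I t n"
    using less_crit[OF t0(1) t(3)] by blast
  obtain W0 where W0: "finite W0" "W0 \<subseteq> words I n" "distort t < sum (weight t) W0"
    using less_esum_finite[OF n(2)[unfolded part_sum_def]] by blast
  define F where "F = (\<Union>w\<in>W0. set w)"
  have F: "finite F" "F \<subseteq> I" using W0 by (auto simp: F_def words_def)
  have "W0 \<subseteq> words F n" using W0 by (auto simp: F_def words_def)
  then have "sum (weight t) W0 \<le> part_sum F t n"
    unfolding part_sum_def esum_finite[OF W0(1), symmetric] by (rule esum_subset_mono)
  then have ZF: "distort t \<le> part_sum F t n" using W0(3) by simp
  have fin: "part_sum F t 1 < \<infinity>"
    using part_sum_mono_set[OF F(2), of t 1] part_sum_1_finite[OF t(2)] by (simp add: le_less_trans)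
  obtain c where c: "0 < c" "\<And>n. ennreal c \<le> part_sum F t n"
    using part_sum_lower_bound[OF F(2) t0(1) ZF n(1) fin] by metis
  obtain \<kappa> where \<kappa>: "0 < \<kappa>"
    "\<And>W. W \<subseteq> lists F \<Longrightarrow> esum (weight t) W < ennreal \<kappa> \<Longrightarrow>
        \<exists>\<alpha>. range \<alpha> \<subseteq> F \<and> (\<forall>n. map \<alpha> [0..<n] \<notin> W)"
    using exists_sequence_avoiding_small[OF F(2) t0(1) c fin] by blast
  define q where "q = Min (insert 1 ((\<lambda>b. deriv0 [b]) ` F))"
  have q: "\<And>b. b \<in> F \<Longrightarrow> q \<le> deriv0 [b]" "q \<le> 1"
    unfolding q_def using F(1) by (auto intro!: Min_le)
  have "q \<in> insert 1 ((\<lambda>b. deriv0 [b]) ` F)" unfolding q_def using F(1) by (intro Min_in) auto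
  then have q0: "0 < q" using F(2) by (auto intro!: deriv0_pos)
  define M where "M = (384 / q)\<^sup>2"
  have M: "0 < M" using q0 by (simp add: M_def)
  \<comment> \<open>Gauges and slack each total at most \<open>e\<close>, and every set meets at
    most \<open>M\<close> stopping words, so the weight is at most
    \<open>2 * M * e \<le> \<kappa> / 2\<close>. The cap \<open>1/2\<close> ensures
    \<open>r i \<le> 1\<close>.\<close>
  define e where "e = min (1/2) (\<kappa> / (4 * M))"
  have e: "0 < e" "e \<le> 1/2" using \<kappa>(1) M by (auto simp: e_def)
  have "e * (4 * M) \<le> \<kappa>" using M by (simp add: e_def min_def field_simps)
  then have eM: "M * (2 * e) < \<kappa>" using \<kappa>(1) M e by (simp add: algebra_simps)
  have "hausdorff_premeasure t 1 J \<le> hausdorff_premeasure s 1 J"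
    using s t by (intro hausdorff_premeasure_antimono) auto
  also have "\<dots> \<le> hausdorff_measure s J"
    unfolding hausdorff_measure_def by (rule SUP_upper) auto
  finally have "hausdorff_premeasure t 1 J < ennreal e" using zero e by simp
  then obtain U :: "nat \<Rightarrow> complex set" where U: "\<And>i. bounded (U i)" "\<And>i. diameter (U i) \<le> 1"
    and cover: "J \<subseteq> (\<Union>i. U i)" and sumU: "(\<Sum>i. diam_gauge t (U i)) < ennreal e"
    unfolding hausdorff_premeasure_def by (auto simp: INF_less_iff)
  \<comment> \<open>The geometric slack keeps the scale \<open>r i\<close> positive even when
    \<open>U i\<close> has diameter 0, since stopping words exist only at positive scales.\<close>
  define p where "p i = diameter (U i) powr t + e * (1/2) ^ Suc i" for i
  define r where "r i = p i powr (1 / t)" for i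
  have p0: "0 < p i" for i using e by (auto simp: p_def intro!: add_nonneg_pos)
  have r0: "0 < r i" for i using p0[of i] by (simp add: r_def)
  have rt: "r i powr t = p i" for i using p0[of i] t0 by (simp add: r_def powr_powr)
  have dr: "diameter (U i) \<le> r i" for i
  proof -
    have "diameter (U i) = (diameter (U i) powr t) powr (1 / t)"
      using diameter_ge_0[OF U(1)[of i]] t0 by (simp add: powr_powr)
    also have "\<dots> \<le> r i" unfolding r_def p_def using t0 e by (intro powr_mono2) auto
    finally show ?thesis .
  qed
  have psum: "(\<Sum>i. ennreal (p i)) \<le> ennreal (2 * e)"
  proof -
    have "(\<Sum>i. ennreal (p i)) = (\<Sum>i. ennreal (diameter (U i) powr t) + ennreal (e * (1/2) ^ Suc i))"
      using e by (simp add: p_def)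
    also have "\<dots> = (\<Sum>i. ennreal (diameter (U i) powr t)) + (\<Sum>i. ennreal (e * (1/2) ^ Suc i))"
      by (rule suminf_add[symmetric]) auto
    also have "\<dots> \<le> ennreal e + ennreal e"
    proof (rule add_mono)
      have "(\<Sum>i. diam_gauge t (U i)) \<le> ennreal e" using sumU by (rule less_imp_le)
      then show "(\<Sum>i. ennreal (diameter (U i) powr t)) \<le> ennreal e"
        by (simp only: diam_gauge_eq[OF t0(2)])
      have "(\<lambda>i. e * (1/2) ^ Suc i) sums e"
        using sums_mult[OF power_half_series, of e] by simp
      then have "(\<Sum>i. ennreal (e * (1/2) ^ Suc i)) = ennreal e"
        using e by (intro suminf_ennreal_eq) auto
      then show "(\<Sum>i. ennreal (e * (1/2) ^ Suc i)) \<le> ennreal e" by (simp only: order_refl)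
    qed
    also have "\<dots> = ennreal (2 * e)" using e by (simp flip: ennreal_plus)
    finally show ?thesis .
  qed
  have r1: "r i \<le> 1" for i
  proof -
    have "ennreal (p i) \<le> (\<Sum>i. ennreal (p i))"
      unfolding esum_nat[symmetric] by (rule esum_member_le) simp
    also have "\<dots> \<le> 1" using psum by (rule order_trans) (use e in simp)
    finally have "p i \<le> 1" by simp
    then show ?thesis unfolding r_def using p0[of i] t0 by (intro powr_le1) auto
  qed
  define W where "W i = {w \<in> stopping_words F (r i). cf w ` X \<inter> U i \<noteq> {}}" for i
  have "esum (weight t) (W i) \<le> ennreal (M * p i)" for i
    unfolding esum_le_iff
  proof (intro allI impI)
    fix S assume S: "finite S" "S \<subseteq> W i"
    have "weight t w \<le> ennreal (p i)" if "w \<in> S" for w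
    proof -
      have "deriv0 w < r i" "w \<in> lists I" using that S F by (auto simp: W_def stopping_words_def)
      then have "deriv0 w powr t \<le> r i powr t"
        using deriv0_pos[of w] t0 by (intro powr_mono2) auto
      then show ?thesis unfolding weight_def rt by (rule ennreal_leI)
    qed
    then have "sum (weight t) S \<le> of_nat (card S) * ennreal (p i)"
      by (rule sum_bounded_above)
    also have "\<dots> = ennreal (real (card S) * p i)"
      using p0[of i] by (simp add: ennreal_of_nat_eq_real_of_nat ennreal_mult less_imp_le)
    also have "\<dots> \<le> ennreal (M * p i)"
      unfolding M_def using p0[of i] S W_def
      by (intro ennreal_leI mult_right_mono card_stopping_words_le[OF F(2) q(1) q0 q(2) r0 r1 U(1) dr]) auto
    finally show "sum (weight t) S \<le> ennreal (M * p i)" .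
  qed
  then have "esum (\<lambda>i. esum (weight t) (W i)) UNIV \<le> esum (\<lambda>i. ennreal (M * p i)) UNIV"
    by (rule esum_mono)
  then have "esum (weight t) (\<Union>i. W i) \<le> esum (\<lambda>i. ennreal (M * p i)) UNIV"
    using esum_UN_le[of "weight t" W UNIV] by (rule order_trans[rotated])
  also have "\<dots> = ennreal M * (\<Sum>i. ennreal (p i))"
    using M p0 by (simp add: ennreal_mult' esum_cmult esum_nat)
  also have "\<dots> \<le> ennreal M * ennreal (2 * e)" using psum by (rule mult_left_mono) simp
  also have "\<dots> = ennreal (M * (2 * e))" using M e by (simp add: ennreal_mult)
  also have "\<dots> < ennreal \<kappa>" using eM M e by (simp add: ennreal_less_iff)
  finally have small: "esum (weight t) (\<Union>i. W i) < ennreal \<kappa>" .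
  have "(\<Union>i. W i) \<subseteq> lists F" by (auto simp: W_def stopping_words_def)
  then obtain \<alpha> where \<alpha>: "range \<alpha> \<subseteq> F" "\<And>n. map \<alpha> [0..<n] \<notin> (\<Union>i. W i)"
    using \<kappa>(2)[OF _ small] by blast
  have \<alpha>I: "range \<alpha> \<subseteq> I" using \<alpha>(1) F(2) by blast
  obtain x where x: "\<And>n. x \<in> cf (map \<alpha> [0..<n]) ` X"
    using limit_point_exists[OF \<alpha>I] by blast
  then have "x \<in> J" using \<alpha>I mem_limit_set_iff by blast
  then obtain i where i: "x \<in> U i" using cover by blast
  obtain m where m: "map \<alpha> [0..<m] \<in> stopping_words F (r i)"
    using stopping_prefix_exists[OF \<alpha>(1) F(2) r0] by blast
  have "map \<alpha> [0..<m] \<in> W i" using m x[of m] i by (auto simp: W_def)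
  then show False using \<alpha>(2)[of m] by blast
qed

section \<open>The Hausdorff measure at the critical exponent\<close>

lemma countable_index: "countable I"
  unfolding index_eq by (rule countable_image) auto

lemma countable_lists_index: "W \<subseteq> lists I \<Longrightarrow> countable W"
  using countable_lists[OF countable_index] countable_subset by blast

text \<open>Since \<open>Re b \<ge> 1\<close>, the point \<open>1 / b\<close> lies in the disc, so
  \<open>one_plus_mult_disc\<close> applies to \<open>z + b = b * (1 + 1 / b * z)\<close>.\<close>

lemma cmod_shift_ge:
  assumes "b \<in> I" "z \<in> X"
  shows "cmod b / 2 \<le> cmod (z + b)"
proof -
  have "1 \<le> Re b" using index_bounds[OF assms(1)] by simp
  then have b: "1 / b \<in> X" "b \<noteq> 0" by (auto intro: inverse_in_disc)
  have "cmod b * (1/2) \<le> cmod b * cmod (1 + 1 / b * z)"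
    using one_plus_mult_disc(1)[OF b(1) assms(2)] by (rule mult_left_mono) simp
  also have "\<dots> = cmod (z + b)"
  proof -
    have "b * (1 + 1 / b * z) = z + b" using b(2) by (simp add: distrib_left)
    then show ?thesis by (metis norm_mult)
  qed
  finally show ?thesis by simp
qed

lemma cmod_gccf_map_le:
  assumes "b \<in> I" "z \<in> X"
  shows "cmod (gccf_map b z) \<le> 2 / cmod b"
proof -
  have "0 < cmod b" using index_bounds[OF assms(1)] by auto
  then have "1 / cmod (z + b) \<le> 1 / (cmod b / 2)"
    using cmod_shift_ge[OF assms] by (intro frac_le) auto
  then show ?thesis by (simp add: gccf_map_def norm_divide)
qed

lemma block_weight_ge:
  assumes "0 < M" "0 \<le> s"
  shows "ennreal (real M powr (2 - 2 * s) * (2 * scale) powr (- (2 * s))) \<le> esum (\<lambda>b. weight s [b]) (block M)"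
proof -
  have "(1 / (2 * real M * scale)\<^sup>2) powr s = real M powr (- (2 * s)) * (2 * scale) powr (- (2 * s))"
  proof -
    have pos: "0 < 2 * scale" "0 < real M" using scale_ge_1 assms by auto
    have "(1 / (2 * real M * scale)\<^sup>2) powr s = ((real M * (2 * scale)) powr (- 2)) powr s"
      using pos by (simp add: powr_minus powr_numeral inverse_eq_divide mult.commute mult.left_commute)
    also have "\<dots> = (real M * (2 * scale)) powr (- (2 * s))" by (simp add: powr_powr)
    also have "\<dots> = real M powr (- (2 * s)) * (2 * scale) powr (- (2 * s))"
      by (rule powr_mult)
    finally show ?thesis .
  qed
  moreover have "(real M)\<^sup>2 * real M powr (- (2 * s)) = real M powr (2 - 2 * s)"
    using assms by (simp add: powr_diff powr_minus powr_numeral divide_inverse)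
  ultimately have "real M powr (2 - 2 * s) * (2 * scale) powr (- (2 * s)) \<le> (\<Sum>b\<in>block M. (1 / (cmod b)\<^sup>2) powr s)"
    using block_sum_ge[OF assms] by (simp add: mult.assoc[symmetric])
  then show ?thesis
    by (simp add: esum_finite finite_block weight_def deriv0_singleton ennreal_leI sum_ennreal)
qed

lemma esum_weight_concat_le:
  assumes "F \<subseteq> I" "0 \<le> s"
  shows "esum (weight s) ((\<lambda>(u, v). u @ v) ` (words I m \<times> words F n))
    \<le> distort s * (part_sum I s m * part_sum F s n)"
proof -
  have "esum (weight s) ((\<lambda>(u, v). u @ v) ` (words I m \<times> words F n))
      \<le> esum (\<lambda>u. esum (\<lambda>v. weight s (u @ v)) (words F n)) (words I m)"
    using esum_image_le[of "weight s" "\<lambda>(u, v). u @ v" "words I m \<times> words F n"] by (simp add: esum_Sigma)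
  also have "\<dots> \<le> esum (\<lambda>u. esum (\<lambda>v. distort s * (weight s u * weight s v)) (words F n)) (words I m)"
    using assms by (intro esum_mono weight_append) (auto simp: words_def)
  also have "\<dots> = distort s * (part_sum I s m * part_sum F s n)"
    by (simp add: part_sum_def esum_cmult esum_multc)
  finally show ?thesis .
qed

text \<open>A word is followed until its next letter has modulus at least \<open>M\<close>; all images under such letters
  are then covered together by the image of a single small disc. This is cheaper than the mass of these
  cylinders by the factor \<open>M powr (crit - 2)\<close>.\<close>

lemma hausdorff_premeasure_crit_le:
  assumes \<delta>: "16 * (4/5) ^ m \<le> \<delta>" and M: "0 < M" and F: "F = {b \<in> I. cmod b < real M}"
  shows "hausdorff_premeasure crit \<delta> (J) \<le>
    ennreal ((16 / real M) powr crit) * (distort crit * distort crit * (\<Sum>n<N. part_sum F crit n))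
    + distort crit ^ 3 * part_sum F crit N"
proof -
  let ?D = "distort crit"
  have crit0: "0 \<le> crit" "0 < crit" using crit_gt_1 by auto
  have FI: "F \<subseteq> I" using F by auto
  define K where "K n = (\<lambda>(u, v). u @ v) ` (words I m \<times> words F n)" for n
  have KI: "K n \<subseteq> lists I" for n using FI by (auto simp: K_def words_def)
  have Klen: "length w = m + n" if "w \<in> K n" for w n using that by (auto simp: K_def words_def)
  \<comment> \<open>The first \<open>m\<close> letters only serve to push diameters below \<delta>.
    Shorter words cover the points whose next letter has modulus at least \<open>M\<close>; words of
    full length cover the points still following letters of \<open>F\<close>, and their total weight
    is controlled by \<open>part_sum F crit N\<close>.\<close>
  define U where "U w = (if length w < m + N then cf w ` (X \<inter> cball 0 (2 / real M)) else cf w ` X)" for w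
  have small: "16 * deriv0 w \<le> \<delta>" if "w \<in> K n" for w n
  proof -
    have "deriv0 w \<le> (4/5) ^ length w" using that KI by (intro deriv0_le_power) auto
    also have "\<dots> \<le> (4/5) ^ m" using Klen[OF that] by (intro power_decreasing) auto
    finally show ?thesis using \<delta> by simp
  qed
  have dist1: "dist x y \<le> 16 / real M * deriv0 w" if w: "w \<in> K n" "n < N" and xy: "x \<in> U w" "y \<in> U w" for w n x y
  proof -
    have wI: "w \<in> lists I" using w KI by auto
    obtain z z' where z: "z \<in> X" "z' \<in> X" "cmod z \<le> 2 / real M" "cmod z' \<le> 2 / real M"
      "x = cf w z" "y = cf w z'"
      using xy Klen[OF w(1)] w(2) by (auto simp: U_def)
    have "dist z z' \<le> 4 / real M"
      using norm_triangle_ineq4[of z z'] z(3,4) by (simp add: dist_norm)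
    then have "4 * deriv0 w * dist z z' \<le> 4 * deriv0 w * (4 / real M)"
      using deriv0_pos[OF wI] by (intro mult_left_mono) auto
    then show ?thesis using cf_lipschitz[OF wI z(1,2)] z(5,6) by (simp add: mult.commute)
  qed
  have dist2: "dist x y \<le> 4 * deriv0 w" if w: "w \<in> K n" and xy: "x \<in> U w" "y \<in> U w" for w n x y
    using w KI xy by (intro cf_dist_le) (auto simp: U_def split: if_splits)
  have nonempty: "U w \<noteq> {}" for w
  proof -
    have "cf w 0 \<in> U w" by (auto simp: U_def)
    then show ?thesis by blast
  qed
  have diam1: "diameter (U w) \<le> 16 / real M * deriv0 w" if "w \<in> K n" "n < N" for w n
    using dist1[OF that] nonempty by (intro diameter_le) (auto simp: dist_norm)
  have diam2: "diameter (U w) \<le> 4 * deriv0 w" if "w \<in> K n" for w n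
    using dist2[OF that] nonempty by (intro diameter_le) (auto simp: dist_norm)
  have bdd: "bounded (U w)" if "w \<in> K n" for w n
  proof -
    have "w \<in> lists I" using that KI by auto
    then have "U w \<subseteq> X" by (auto simp: U_def intro: cf_in_disc)
    then show ?thesis using compact_imp_bounded[OF compact_disc] bounded_subset by blast
  qed
  have cover: "J \<subseteq> (\<Union>w\<in>(\<Union>n\<le>N. K n). U w)"
  proof
    fix x assume "x \<in> J"
    then obtain \<alpha> where \<alpha>: "range \<alpha> \<subseteq> I" "\<And>n. x \<in> cf (map \<alpha> [0..<n]) ` X"
      using mem_limit_set_iff by blast
    have split: "map \<alpha> [0..<m + n] = map \<alpha> [0..<m] @ map \<alpha> [m..<m + n]" for n
      using upt_add_eq_append[of 0 m n] by simp
    have inK: "map \<alpha> [0..<m + n] \<in> K n" if "\<And>i. m \<le> i \<Longrightarrow> i < m + n \<Longrightarrow> \<alpha> i \<in> F" for n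
      unfolding K_def split using that \<alpha>(1)
      by (intro image_eqI[of _ _ "(map \<alpha> [0..<m], map \<alpha> [m..<m + n])"])
        (auto simp: words_def image_subset_iff)
    show "x \<in> (\<Union>w\<in>(\<Union>n\<le>N. K n). U w)"
    proof (cases "\<exists>n<N. \<alpha> (m + n) \<notin> F")
      case True
      define n where "n = (LEAST n. \<alpha> (m + n) \<notin> F)"
      obtain k where k: "k < N" "\<alpha> (m + k) \<notin> F" using True by blast
      then have n: "\<alpha> (m + n) \<notin> F"
        unfolding n_def by (intro LeastI[of "\<lambda>n. \<alpha> (m + n) \<notin> F" k])
      have least: "\<alpha> (m + i) \<in> F" if "i < n" for i
        using not_less_Least[of i "\<lambda>n. \<alpha> (m + n) \<notin> F"] that by (auto simp: n_def)
      have nN: "n < N" using k Least_le[of "\<lambda>n. \<alpha> (m + n) \<notin> F" k] by (simp add: n_def)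
      have "\<alpha> i \<in> F" if "m \<le> i" "i < m + n" for i using least[of "i - m"] that by simp
      then have wK: "map \<alpha> [0..<m + n] \<in> K n" by (rule inK)
      obtain z where z: "z \<in> X" "x = cf (map \<alpha> [0..<Suc (m + n)]) z" using \<alpha>(2)[of "Suc (m + n)"] by auto
      define b where "b = \<alpha> (m + n)"
      have b: "b \<in> I" "real M \<le> cmod b" using n \<alpha>(1) by (auto simp: b_def F)
      have "cmod (gccf_map b z) \<le> 2 / cmod b" by (rule cmod_gccf_map_le[OF b(1) z(1)])
      also have "\<dots> \<le> 2 / real M" using b(2) M by (intro frac_le) auto
      finally have "gccf_map b z \<in> X \<inter> cball 0 (2 / real M)"
        using cf_in_disc[of "[b]" z] b z by simp
      moreover have "x = cf (map \<alpha> [0..<m + n]) (gccf_map b z)" using z(2) by (simp add: cf_append b_def)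
      ultimately have "x \<in> U (map \<alpha> [0..<m + n])" using nN by (auto simp: U_def)
      then show ?thesis using wK nN by (intro UN_I[of "map \<alpha> [0..<m + n]"] UN_I[of n]) auto
    next
      case False
      have "\<alpha> i \<in> F" if "m \<le> i" "i < m + N" for i
        using False that by (metis le_add_diff_inverse nat_add_left_cancel_less)
      then have "map \<alpha> [0..<m + N] \<in> K N" by (rule inK)
      moreover have "x \<in> U (map \<alpha> [0..<m + N])" using \<alpha>(2)[of "m + N"] by (simp add: U_def)
      ultimately show ?thesis by blast
    qed
  qed
  have le\<delta>: "diameter (U w) \<le> \<delta>" if "w \<in> K n" for w n
    using diam2[OF that] small[OF that] deriv0_pos[of w] that KI by fastforce
  have "0 \<le> \<delta>" using \<delta> by (rule order_trans[rotated]) simp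
  have "hausdorff_premeasure crit \<delta> J \<le> esum (\<lambda>w. diam_gauge crit (U w)) (\<Union>n\<le>N. K n)"
  proof (rule hausdorff_premeasure_le[OF _ \<open>0 \<le> \<delta>\<close> _ _ cover])
    show "countable (\<Union>n\<le>N. K n)" using KI by (intro countable_UN countable_lists_index) auto
  qed (use bdd le\<delta> in auto)
  also have "\<dots> \<le> esum (\<lambda>n. esum (\<lambda>w. diam_gauge crit (U w)) (K n)) {..N}"
    by (rule esum_UN_le)
  also have "\<dots> = (\<Sum>n<N. esum (\<lambda>w. diam_gauge crit (U w)) (K n)) + esum (\<lambda>w. diam_gauge crit (U w)) (K N)"
    by (simp add: esum_finite lessThan_Suc_atMost[symmetric])
  also have "\<dots> \<le> (\<Sum>n<N. ennreal ((16 / real M) powr crit) * esum (weight crit) (K n)) + ?D * esum (weight crit) (K N)"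
  proof (rule add_mono)
    show "(\<Sum>n<N. esum (\<lambda>w. diam_gauge crit (U w)) (K n))
        \<le> (\<Sum>n<N. ennreal ((16 / real M) powr crit) * esum (weight crit) (K n))"
      unfolding esum_cmult[symmetric]
    proof (intro sum_mono esum_mono)
      fix n w assume n: "n \<in> {..<N}" and w: "w \<in> K n"
      have "diameter (U w) powr crit \<le> (16 / real M * deriv0 w) powr crit"
        using diam1[OF w] n crit0 diameter_ge_0[OF bdd[OF w]] by (intro powr_mono2) auto
      also have "\<dots> = (16 / real M) powr crit * deriv0 w powr crit"
        by (rule powr_mult)
      finally show "diam_gauge crit (U w) \<le> ennreal ((16 / real M) powr crit) * weight crit w"
        using crit0 by (simp add: diam_gauge_eq weight_def ennreal_leI flip: ennreal_mult)
    qed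
    show "esum (\<lambda>w. diam_gauge crit (U w)) (K N) \<le> ?D * esum (weight crit) (K N)"
      unfolding esum_cmult[symmetric]
    proof (intro esum_mono)
      fix w assume w: "w \<in> K N"
      have "diameter (U w) powr crit \<le> (4 * deriv0 w) powr crit"
        using diam2[OF w] crit0 diameter_ge_0[OF bdd[OF w]] by (intro powr_mono2) auto
      also have "\<dots> = 4 powr crit * deriv0 w powr crit"
        by (rule powr_mult)
      finally show "diam_gauge crit (U w) \<le> ?D * weight crit w"
        using crit0 by (simp add: diam_gauge_eq weight_def distort_def ennreal_leI flip: ennreal_mult)
    qed
  qed
  also have "\<dots> \<le> (\<Sum>n<N. ennreal ((16 / real M) powr crit) * (?D * (?D * part_sum F crit n)))
      + ?D * (?D * (?D * part_sum F crit N))"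
  proof -
    have "esum (weight crit) (K n) \<le> ?D * (?D * part_sum F crit n)" for n
    proof -
      have "esum (weight crit) (K n) \<le> ?D * (part_sum I crit m * part_sum F crit n)"
        unfolding K_def by (rule esum_weight_concat_le[OF FI crit0(1)])
      also have "\<dots> \<le> ?D * (?D * part_sum F crit n)"
        by (intro mult_left_mono mult_right_mono part_sum_crit_le) auto
      finally show ?thesis .
    qed
    then show ?thesis by (intro add_mono sum_mono mult_left_mono) auto
  qed
  finally show ?thesis
    by (simp add: sum_distrib_left power3_eq_cube mult.assoc)
qed

lemma hausdorff_measure_crit: "hausdorff_measure crit (J) = 0"
proof -
  let ?D = "distort crit"
  have crit0: "0 \<le> crit" "0 < crit" "1 < crit" "crit < 2" using crit_gt_1 crit_lt_2 by auto
  have "hausdorff_premeasure crit \<delta> J \<le> 0" if \<delta>: "0 < \<delta>" for \<delta>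
  proof (rule ennreal_le_epsilon)
    fix e :: real assume e: "0 < e"
    have "\<exists>m. (4/5) ^ m < \<delta> / 16" using \<delta> by (intro real_arch_pow_inv) auto
    then obtain m where m: "16 * (4/5) ^ m \<le> \<delta>" by (auto simp: field_simps intro: less_imp_le)
    \<comment> \<open>Six factors \<open>4 powr crit\<close>: two from
      \<open>hausdorff_premeasure_crit_le\<close>, four from \<open>subsystem_sum_le\<close>. The
      other factors come from the diameter of the small disc and from
      \<open>block_weight_ge\<close>. As \<open>crit < 2\<close>, the power of \<open>M\<close>
      below tends to 0.\<close>
    define C where "C = (4 powr crit) ^ 6 * 16 powr crit * (2 * scale) powr (2 * crit)"
    have C: "0 < C" using scale_ge_1 by (simp add: C_def)
    have "((\<lambda>M. C * real M powr (crit - 2)) \<longlongrightarrow> C * 0) sequentially"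
      using crit0 by (intro tendsto_mult tendsto_const tendsto_neg_powr filterlim_real_sequentially) auto
    then have "\<forall>\<^sub>F M in sequentially. C * real M powr (crit - 2) < e / 2"
      using e by (intro order_tendstoD(2)[where y = 0]) auto
    then obtain M where M: "0 < M" "C * real M powr (crit - 2) < e / 2"
      using eventually_conj[OF eventually_gt_at_top[of 0]] by (metis (no_types, lifting) eventually_happens sequentially_bot)
    define F where "F = {b \<in> I. cmod b < real M}"
    have block: "block M \<subseteq> I - F" using block_subset[OF M(1)] block_bounds(1) by (force simp: F_def)
    have "card (block M) \<noteq> 0" using M by (simp add: card_block)
    then have "block M \<noteq> {}" by auto
    then have FI: "F \<subseteq> I" "F \<noteq> I" using block by (auto simp: F_def)
    have "0 < ennreal (e / (2 * (4 powr crit) ^ 3))" using e by simp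
    then obtain N where N: "part_sum F crit N < ennreal (e / (2 * (4 powr crit) ^ 3))"
      using subsystem_partition_sum_small[OF FI] by blast
    have 1: "?D ^ 3 * part_sum F crit N \<le> ennreal (e / 2)"
    proof -
      have "?D ^ 3 * part_sum F crit N \<le> ?D ^ 3 * ennreal (e / (2 * (4 powr crit) ^ 3))"
        using N by (intro mult_left_mono) auto
      also have "\<dots> = ennreal (e / 2)"
        using e by (simp add: distort_def ennreal_power flip: ennreal_mult)
      finally show ?thesis .
    qed
    define t where "t = real M powr (2 - 2 * crit) * (2 * scale) powr (- (2 * crit))"
    have t0: "0 < t" using M scale_ge_1 by (simp add: t_def)
    \<comment> \<open>The bound obtained for \<open>S\<close> does not depend on \<open>N\<close>,
      which had to be chosen after \<open>M\<close> and may be large.\<close>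
    define S where "S = (\<Sum>n<N. part_sum F crit n)"
    have "S * ennreal t \<le> S * esum (\<lambda>b. weight crit [b]) (I - F)"
      unfolding t_def using block_weight_ge[OF M(1) crit0(1)] esum_subset_mono[OF block, of "\<lambda>b. weight crit [b]"]
      by (intro mult_left_mono) (auto intro: order_trans)
    also have "\<dots> \<le> ?D ^ 4" unfolding S_def by (rule subsystem_sum_le[OF FI(1)])
    finally have St: "S * ennreal t \<le> ?D ^ 4" .
    have "S = (S * ennreal t) * ennreal (1 / t)"
      using t0 by (simp add: mult.assoc flip: ennreal_mult)
    also have "\<dots> \<le> ?D ^ 4 * ennreal (1 / t)" using St by (rule mult_right_mono) simp
    finally have S: "S \<le> ?D ^ 4 * ennreal (1 / t)" .
    have 2: "ennreal ((16 / real M) powr crit) * (?D * ?D * S) \<le> ennreal (e / 2)"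
    proof -
      have "ennreal ((16 / real M) powr crit) * (?D * ?D * S) \<le>
          ennreal ((16 / real M) powr crit) * (?D * ?D * (?D ^ 4 * ennreal (1 / t)))"
        using S by (intro mult_left_mono) auto
      also have "\<dots> = ennreal ((16 / real M) powr crit * ((4 powr crit) ^ 6 * (1 / t)))"
        using t0 by (simp add: distort_def ennreal_power power_numeral_reduce mult.assoc flip: ennreal_mult)
      also have "(16 / real M) powr crit * ((4 powr crit) ^ 6 * (1 / t)) = C * real M powr (crit - 2)"
      proof -
        have "(16 / real M) powr crit / t = 16 powr crit * (2 * scale) powr (2 * crit) * (real M powr (crit - 2))"
        proof -
          have M0: "0 < real M" using M by simp
          have "real M powr (crit - 2) = real M powr (- crit - (2 - 2 * crit))" by simp
          also have "\<dots> = real M powr (- crit) / real M powr (2 - 2 * crit)" by (rule powr_diff)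
          finally have "real M powr (crit - 2) = real M powr (- crit) / real M powr (2 - 2 * crit)" .
          then show ?thesis
            using M0 scale_ge_1 by (simp add: t_def powr_divide powr_minus field_simps)
        qed
        moreover have "(16 / real M) powr crit * ((4 powr crit) ^ 6 * (1 / t)) = (4 powr crit) ^ 6 * ((16 / real M) powr crit / t)"
          by simp
        ultimately show ?thesis by (simp only: C_def mult.assoc)
      qed
      also have "ennreal (C * real M powr (crit - 2)) \<le> ennreal (e / 2)" using M(2) by (intro ennreal_leI) simp
      finally show ?thesis .
    qed
    have "hausdorff_premeasure crit \<delta> J \<le> ennreal (e / 2) + ennreal (e / 2)"
      using hausdorff_premeasure_crit_le[OF m M(1) F_def, of N] 1 2 unfolding S_def
      by (meson add_mono order_trans)
    also have "\<dots> = 0 + ennreal e" using e by (simp flip: ennreal_plus)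
    finally show "hausdorff_premeasure crit \<delta> J \<le> 0 + ennreal e" .
  qed
  then show ?thesis by (simp add: hausdorff_measure_def)
qed

lemma gccf_dim_eq_crit: "gccf_dim \<tau> = crit"
  unfolding gccf_dim_def hausdorff_dim_def
proof (rule cInf_eq_minimum)
  show "crit \<in> {s. 0 \<le> s \<and> hausdorff_measure s (J) = 0}"
    using hausdorff_measure_crit crit_gt_1 by simp
  fix s assume "s \<in> {s. 0 \<le> s \<and> hausdorff_measure s (J) = 0}"
  then show "crit \<le> s" using hausdorff_measure_below_crit[of s] by (auto simp: not_less[symmetric])
qed

section \<open>Packing measure of the limit set\<close>

lemma disc_diff_le: "z \<in> X \<Longrightarrow> z' \<in> X \<Longrightarrow> cmod (z - z') \<le> 1"
  using norm_triangle_ineq4[of "z - 1/2" "z' - 1/2"] by (simp add: gccf_disc_def)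

lemma dist_gccf_map_le:
  assumes "b \<in> I" "c \<in> I" "z \<in> X" "z' \<in> X" "cmod b \<le> cmod c"
  shows "dist (gccf_map b z) (gccf_map c z') \<le> 4 * (1 + cmod (c - b)) / (cmod b)\<^sup>2"
proof -
  have nz: "z + b \<noteq> 0" "z' + c \<noteq> 0" using assms shift_bounds(3) by blast+
  have b0: "0 < cmod b" using index_bounds[OF assms(1)] by auto
  have "gccf_map b z - gccf_map c z' = ((z' - z) + (c - b)) / ((z + b) * (z' + c))"
    using nz by (simp add: gccf_map_def field_simps)
  then have "dist (gccf_map b z) (gccf_map c z') = cmod ((z' - z) + (c - b)) / (cmod (z + b) * cmod (z' + c))"
    by (simp add: dist_norm norm_divide norm_mult)
  also have "\<dots> \<le> (1 + cmod (c - b)) / (cmod b / 2 * (cmod b / 2))"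
  proof (rule frac_le)
    show "cmod ((z' - z) + (c - b)) \<le> 1 + cmod (c - b)"
      using norm_triangle_ineq[of "z' - z" "c - b"] disc_diff_le[OF assms(4,3)] by linarith
    have "cmod b / 2 \<le> cmod (z' + c)" using cmod_shift_ge[OF assms(2,4)] assms(5) by simp
    then show "cmod b / 2 * (cmod b / 2) \<le> cmod (z + b) * cmod (z' + c)"
      using cmod_shift_ge[OF assms(1,3)] by (intro mult_mono) auto
  qed (use b0 in auto)
  also have "\<dots> = 4 * (1 + cmod (c - b)) / (cmod b)\<^sup>2"
    by (simp add: power2_eq_square)
  finally show ?thesis .
qed

text \<open>Letters near \<open>b\<close> suffice as long as \<open>\<rho>\<close> is below the distance scale \<open>1 / cmod b\<close> of the point
  to the origin.\<close>

lemma letters_in_ball_near: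
  assumes b: "b \<in> I" and z: "z \<in> X" and \<rho>: "0 < \<rho>" "\<rho> * cmod b \<le> 4" "8 * scale \<le> \<rho> * (cmod b)\<^sup>2"
  obtains C where "C \<subseteq> I" "\<And>c. c \<in> C \<Longrightarrow> gccf_map c ` X \<subseteq> cball (gccf_map b z) \<rho>"
    "ennreal ((32 * scale) powr - crit * \<rho> powr crit) \<le> esum (\<lambda>c. weight crit [c]) C"
proof -
  \<comment> \<open>Solves \<open>4 * (1 + x * scale) / (cmod b)^2 = \<rho>\<close>, so that by
    \<open>dist_gccf_map_le\<close> letters at distance up to \<open>x * scale\<close> from
    \<open>b\<close> still map into the ball.\<close>
  define x where "x = (\<rho> * (cmod b)\<^sup>2 / 4 - 1) / scale"
  define M where "M = nat \<lfloor>x\<rfloor>"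
  \<comment> \<open>Only nonnegative lattice vectors are added to \<open>b\<close>: the sums remain
    letters, and their modulus is at least that of \<open>b\<close>.\<close>
  define C where "C = (\<lambda>p. b + lattice p) ` ({..M} \<times> {..M})"
  have T: "1 \<le> scale" by (rule scale_ge_1)
  have b1: "1 \<le> Re b" "1 \<le> Im b" using index_bounds[OF b] by auto
  then have b0: "0 < cmod b" by auto
  have x1: "\<rho> * (cmod b)\<^sup>2 / (8 * scale) \<le> x"
    using \<rho>(3) T by (simp add: x_def field_simps)
  have "1 \<le> \<rho> * (cmod b)\<^sup>2 / (8 * scale)" using \<rho>(3) T by simp
  then have "0 \<le> x" using x1 by linarith
  then have M: "real M \<le> x" "x < real M + 1" unfolding M_def by linarith+
  have Ms: "real M * scale \<le> \<rho> * (cmod b)\<^sup>2 / 4 - 1"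
    using M(1) T by (simp add: x_def pos_le_divide_eq)
  obtain q where q: "b = lattice q" "1 \<le> fst q" "1 \<le> snd q"
    using b unfolding index_eq by auto
  have c: "c \<in> I" "cmod (c - b) \<le> real M * scale" "cmod b \<le> cmod c" if cC: "c \<in> C" for c
  proof -
    obtain p where p: "c = b + lattice p" "fst p \<le> M" "snd p \<le> M"
      using cC by (auto simp: C_def)
    have "c = lattice (fst q + fst p, snd q + snd p)"
      by (simp add: p q lattice_def algebra_simps)
    then show "c \<in> I" using q unfolding index_eq by auto
    show "cmod (c - b) \<le> real M * scale"
      unfolding p(1) add_diff_cancel_left' by (rule cmod_lattice_le) (use p in auto)
    have "0 \<le> Re (lattice p)" "0 \<le> Im (lattice p)"
      using lattice_bounds[of p] by (auto intro: order_trans[rotated])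
    then have "(Re b)\<^sup>2 + (Im b)\<^sup>2 \<le> (Re c)\<^sup>2 + (Im c)\<^sup>2"
      using b1 by (intro add_mono power_mono) (auto simp: p)
    then show "cmod b \<le> cmod c" by (simp add: cmod_def)
  qed
  have sub: "gccf_map c ` X \<subseteq> cball (gccf_map b z) \<rho>" if cC: "c \<in> C" for c
  proof
    fix y assume "y \<in> gccf_map c ` X"
    then obtain z' where z': "z' \<in> X" "y = gccf_map c z'" by blast
    have "dist (gccf_map b z) y \<le> 4 * (1 + cmod (c - b)) / (cmod b)\<^sup>2"
      unfolding z'(2) by (rule dist_gccf_map_le[OF b c(1)[OF cC] z z'(1) c(3)[OF cC]])
    also have "\<dots> \<le> 4 * (\<rho> * (cmod b)\<^sup>2 / 4) / (cmod b)\<^sup>2"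
      using c(2)[OF cC] Ms by (intro divide_right_mono) auto
    also have "\<dots> = \<rho>" using b0 by simp
    finally show "y \<in> cball (gccf_map b z) \<rho>" by simp
  qed
  have crit0: "0 \<le> crit" "crit < 2" using crit_gt_1 crit_lt_2 by auto
  have "inj_on (\<lambda>p. b + lattice p) ({..M} \<times> {..M})"
    using inj_lattice[of "{..M} \<times> {..M}"] by (auto simp: inj_on_def)
  then have card: "card C = (M + 1)\<^sup>2" by (simp add: C_def card_image power2_eq_square)
  have fin: "finite C" by (simp add: C_def)
  have "(32 * scale) powr - crit * \<rho> powr crit \<le> real (card C) * (1 / (2 * cmod b)\<^sup>2) powr crit"
  proof -
    define B where "B = (cmod b)\<^sup>2"
    have B: "0 < B" using b0 by (simp add: B_def)
    \<comment> \<open>There are at least \<open>(\<rho> * B / (8 * scale)) ^ 2\<close> letters, each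
      of weight at least \<open>(4 * B) powr - crit\<close>. Comparing with
      \<open>\<rho> powr crit\<close> leaves a surplus \<open>(\<rho> * B) powr (2 - crit)\<close>,
      bounded below because \<open>crit < 2\<close> and
      \<open>8 * scale \<le> \<rho> * B\<close>.\<close>
    have "(32 * scale) powr - crit * \<rho> powr crit =
        (8 * scale) powr (2 - crit) * ((8 * scale) powr - 2 * 4 powr - crit * \<rho> powr crit)"
    proof -
      have "(32 * scale) powr - crit = (8 * scale) powr - crit * 4 powr - crit"
        using T by (simp flip: powr_mult)
      moreover have "(8 * scale) powr - crit = (8 * scale) powr ((2 - crit) + - 2)" by simp
      ultimately show ?thesis by (simp only: powr_add mult.assoc)
    qed
    also have "\<dots> \<le> (\<rho> * B) powr (2 - crit) * ((8 * scale) powr - 2 * 4 powr - crit * \<rho> powr crit)"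
      using \<rho>(3) T crit0 by (intro mult_right_mono powr_mono2) (auto simp: B_def)
    also have "\<dots> = (\<rho> * B / (8 * scale)) powr 2 * (4 * B) powr - crit"
    proof -
      have "(\<rho> * B) powr (2 - crit) = (\<rho> * B) powr (2 + - crit)" by simp
      then have e1: "(\<rho> * B) powr (2 - crit) = (\<rho> * B) powr 2 * (\<rho> * B) powr - crit"
        by (simp only: powr_add)
      have e2: "(\<rho> * B) powr - crit * \<rho> powr crit = B powr - crit"
        using \<rho>(1) B by (simp add: powr_mult powr_minus)
      have e3: "(\<rho> * B / (8 * scale)) powr 2 = (\<rho> * B) powr 2 * (8 * scale) powr - 2"
        unfolding powr_minus_divide powr_divide by simp
      have e4: "(4 * B) powr - crit = 4 powr - crit * B powr - crit" by (rule powr_mult)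
      show ?thesis unfolding e1 e3 e4 e2[symmetric] by (simp only: mult_ac)
    qed
    also have "\<dots> \<le> (real M + 1) powr 2 * (4 * B) powr - crit"
    proof (intro mult_right_mono powr_mono2)
      show "\<rho> * B / (8 * scale) \<le> real M + 1" using x1 M(2) by (simp add: B_def)
    qed (use \<rho> B T in auto)
    also have "\<dots> = real (card C) * (1 / (2 * cmod b)\<^sup>2) powr crit"
    proof -
      have "(real M + 1) powr 2 = real (card C)" by (simp add: card powr_numeral)
      moreover have "(4 * B) powr - crit = (1 / (2 * cmod b)\<^sup>2) powr crit"
        using b0 by (simp add: B_def powr_minus powr_divide power_mult_distrib inverse_eq_divide)
      ultimately show ?thesis by simp
    qed
    finally show ?thesis .
  qed
  also have "\<dots> = (\<Sum>c\<in>C. (1 / (2 * cmod b)\<^sup>2) powr crit)" by simp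
  also have "\<dots> \<le> (\<Sum>c\<in>C. (1 / (cmod c)\<^sup>2) powr crit)"
  proof (intro sum_mono powr_mono2 frac_le power_mono)
    fix c assume cC: "c \<in> C"
    have "cmod c \<le> cmod b + cmod (c - b)" using norm_triangle_ineq[of b "c - b"] by simp
    also have "\<dots> \<le> cmod b + \<rho> * (cmod b)\<^sup>2 / 4" using c(2)[OF cC] Ms by linarith
    also have "\<dots> \<le> 2 * cmod b"
      using mult_right_mono[OF \<rho>(2), of "cmod b"] by (simp add: power2_eq_square mult.assoc)
    finally show "cmod c \<le> 2 * cmod b" .
    show "0 < (cmod c)\<^sup>2" using c(3)[OF cC] b0 by (intro zero_less_power) linarith
  qed (use crit0 in auto)
  finally have "ennreal ((32 * scale) powr - crit * \<rho> powr crit) \<le> esum (\<lambda>c. weight crit [c]) C"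
    using fin by (simp add: esum_finite weight_def deriv0_singleton sum_ennreal ennreal_leI)
  then show ?thesis using that c(1) sub by blast
qed

text \<open>Here the centre is within \<open>\<rho> / 2\<close> of the origin, as are the images
  under all letters of modulus at least \<open>4 / \<rho>\<close>. A block at that height has weight
  of order \<open>\<rho> powr (2 * crit - 2)\<close>, and for \<open>\<rho> \<le> 1\<close> this
  dominates \<open>\<rho> powr crit\<close> because \<open>crit < 2\<close>.\<close>

lemma letters_in_ball_far:
  assumes b: "b \<in> I" and z: "z \<in> X" and \<rho>: "0 < \<rho>" "\<rho> \<le> 1" "4 \<le> \<rho> * cmod b"
  obtains C where "C \<subseteq> I" "\<And>c. c \<in> C \<Longrightarrow> gccf_map c ` X \<subseteq> cball (gccf_map b z) \<rho>"
    "ennreal (5 powr (2 - 2 * crit) * (2 * scale) powr - (2 * crit) * \<rho> powr crit) \<le> esum (\<lambda>c. weight crit [c]) C"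
proof -
  define M where "M = nat \<lceil>4 / \<rho>\<rceil>"
  have r4: "4 \<le> 4 / \<rho>" "1 \<le> 1 / \<rho>" using \<rho> by (auto simp: pos_le_divide_eq)
  then have M: "4 / \<rho> \<le> real M" "real M \<le> 4 / \<rho> + 1" unfolding M_def by linarith+
  have "5 / \<rho> = 4 / \<rho> + 1 / \<rho>" by (simp add: add_divide_distrib[symmetric])
  then have M0: "0 < M" "real M \<le> 5 / \<rho>" using r4 M by auto
  have crit0: "0 \<le> crit" "1 < crit" "crit < 2" using crit_gt_1 crit_lt_2 by auto
  have small: "cmod (gccf_map c z') \<le> \<rho> / 2" if "c \<in> I" "z' \<in> X" "4 / \<rho> \<le> cmod c" for c z'
  proof -
    have "cmod (gccf_map c z') \<le> 2 / cmod c" by (rule cmod_gccf_map_le[OF that(1,2)])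
    also have "\<dots> \<le> 2 / (4 / \<rho>)" using that(3) \<rho> by (intro frac_le) auto
    finally show ?thesis by simp
  qed
  have b4: "4 / \<rho> \<le> cmod b" using \<rho> by (simp add: pos_divide_le_eq mult.commute)
  have sub: "gccf_map c ` X \<subseteq> cball (gccf_map b z) \<rho>" if c: "c \<in> block M" for c
  proof
    have cI: "c \<in> I" using c block_subset[OF M0(1)] by auto
    have cM: "4 / \<rho> \<le> cmod c" using block_bounds(1)[OF c] M by linarith
    fix y assume "y \<in> gccf_map c ` X"
    then obtain z' where z': "z' \<in> X" "y = gccf_map c z'" by blast
    have "cmod (gccf_map b z - y) \<le> \<rho> / 2 + \<rho> / 2"
      unfolding z'(2) using small[OF cI z'(1) cM] small[OF b z b4]
      by (intro order_trans[OF norm_triangle_ineq4] add_mono)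
    then show "y \<in> cball (gccf_map b z) \<rho>" by (simp add: dist_norm)
  qed
  have "5 powr (2 - 2 * crit) * (2 * scale) powr - (2 * crit) * \<rho> powr crit
      \<le> 5 powr (2 - 2 * crit) * (2 * scale) powr - (2 * crit) * \<rho> powr (2 * crit - 2)"
    using \<rho> crit0 by (intro mult_left_mono powr_mono') auto
  also have "\<dots> = (5 / \<rho>) powr (2 - 2 * crit) * (2 * scale) powr - (2 * crit)"
  proof -
    have "\<rho> powr (2 * crit - 2) = \<rho> powr - (2 - 2 * crit)" by simp
    also have "\<dots> = 1 / \<rho> powr (2 - 2 * crit)" by (simp only: powr_minus inverse_eq_divide)
    finally have "\<rho> powr (2 * crit - 2) = 1 / \<rho> powr (2 - 2 * crit)" .
    then show ?thesis by (simp add: powr_divide)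
  qed
  also have "\<dots> \<le> real M powr (2 - 2 * crit) * (2 * scale) powr - (2 * crit)"
    using M0 crit0 by (intro mult_right_mono powr_mono2') auto
  finally have "ennreal (5 powr (2 - 2 * crit) * (2 * scale) powr - (2 * crit) * \<rho> powr crit)
      \<le> esum (\<lambda>c. weight crit [c]) (block M)"
    using block_weight_ge[OF M0(1) crit0(1)] by (meson ennreal_leI order_trans)
  then show ?thesis using that block_subset[OF M0(1)] sub by blast
qed

definition letter_const :: real where
  "letter_const = min ((32 * scale) powr - crit) (5 powr (2 - 2 * crit) * (2 * scale) powr - (2 * crit))"

lemma letter_const_pos: "0 < letter_const"
  using scale_ge_1 by (simp add: letter_const_def)

lemma letters_in_ball:
  assumes "b \<in> I" "z \<in> X" "0 < \<rho>" "\<rho> \<le> 1" "8 * scale \<le> \<rho> * (cmod b)\<^sup>2"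
  obtains C where "C \<subseteq> I" "\<And>c. c \<in> C \<Longrightarrow> gccf_map c ` X \<subseteq> cball (gccf_map b z) \<rho>"
    "ennreal (letter_const * \<rho> powr crit) \<le> esum (\<lambda>c. weight crit [c]) C"
proof (cases "\<rho> * cmod b \<le> 4")
  case True
  have "ennreal (letter_const * \<rho> powr crit) \<le> ennreal ((32 * scale) powr - crit * \<rho> powr crit)"
    by (intro ennreal_leI mult_right_mono) (auto simp: letter_const_def)
  then show ?thesis
    by (rule_tac letters_in_ball_near[OF assms(1-3) True assms(5)]) (rule that, assumption+, rule order_trans)
next
  case False
  then have ge: "4 \<le> \<rho> * cmod b" by simp
  have "ennreal (letter_const * \<rho> powr crit) \<le> ennreal (5 powr (2 - 2 * crit) * (2 * scale) powr - (2 * crit) * \<rho> powr crit)"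
    by (intro ennreal_leI mult_right_mono) (auto simp: letter_const_def)
  then show ?thesis
    by (rule_tac letters_in_ball_far[OF assms(1-4) ge]) (rule that, assumption+, rule order_trans)
qed

definition mass_const :: real where
  "mass_const = min ((128 * scale) powr - crit) (letter_const * (1/4) powr crit)"

lemma mass_const_pos: "0 < mass_const"
  using scale_ge_1 letter_const_pos by (simp add: mass_const_def)

text \<open>Let \<open>u\<close> be the prefix of the code of \<open>x\<close> one letter before its
  derivative drops below \<open>r / (128 * scale)\<close>. Either the cylinder of \<open>u\<close>
  lies in the ball, or the dropping letter \<open>b\<close> is large, and \<open>cf u\<close> maps a
  ball about \<open>gccf_map b z\<close> into the given one; there \<open>letters_in_ball\<close>
  finds enough letters. Having the bound for all large \<open>N\<close> lets several balls share one
  word length.\<close>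

lemma ball_mass_ge:
  assumes x: "x \<in> J" and r: "0 < r" "r \<le> 1"
  shows "\<exists>N0. \<forall>N\<ge>N0. ennreal (mass_const * r powr crit)
    \<le> distort crit ^ 3 * esum (weight crit) {w \<in> words I N. cf w ` X \<subseteq> cball x r}"
proof -
  let ?D = "distort crit"
  have crit0: "0 \<le> crit" using crit_gt_1 by simp
  obtain \<alpha> where \<alpha>: "range \<alpha> \<subseteq> I" "\<And>n. x \<in> cf (map \<alpha> [0..<n]) ` X"
    using x mem_limit_set_iff by blast
  \<comment> \<open>\<open>128 = 4 * 4 * 8\<close>: a 4 from \<open>deriv0_append\<close>, a 4 from
    \<open>cf_lipschitz\<close> and the 8 in the hypothesis of \<open>letters_in_ball\<close> that
    \<rho> has to meet.\<close>
  define r' where "r' = r / (128 * scale)"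
  have r': "0 < r'" "r' \<le> 1" using r scale_ge_1 by (auto simp: r'_def)
  obtain n' where n': "map \<alpha> [0..<n'] \<in> stopping_words I r'"
    using stopping_prefix_exists[OF \<alpha>(1) order_refl r'(1)] by blast
  have "n' \<noteq> 0"
  proof
    assume "n' = 0"
    then show False using n' r' by (simp add: stopping_words_def)
  qed
  then obtain n where n: "n' = Suc n" by (cases n') auto
  define u b where "u = map \<alpha> [0..<n]" and "b = \<alpha> n"
  have ub: "map \<alpha> [0..<n'] = u @ [b]" by (simp add: u_def b_def n)
  have u: "u \<in> lists I" and b: "b \<in> I" using \<alpha>(1) prefix_in_lists[OF \<alpha>(1)] by (auto simp: u_def b_def)
  have bl: "[b] \<in> lists I" using b by simp
  define g where "g = deriv0 u"
  have g0: "0 < g" unfolding g_def by (rule deriv0_pos[OF u])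
  have lu: "length u = n" by (simp add: u_def)
  have *: "\<forall>k<length (u @ [b]). r' \<le> deriv0 (take k (u @ [b]))"
    using n' unfolding ub stopping_words_def by blast
  have rg: "r' \<le> g" using *[rule_format, of n] by (simp add: g_def lu)
  have less: "deriv0 (u @ [b]) < r'" using n' unfolding ub by (simp add: stopping_words_def)
  have D1: "1 \<le> ?D" by (rule one_le_distort[OF crit0])
  show ?thesis
  proof (cases "4 * g \<le> r")
    case True
    show ?thesis
    proof (intro exI[of _ n] allI impI)
      fix N assume N: "n \<le> N"
      let ?S = "{w \<in> words I N. cf w ` X \<subseteq> cball x r}"
      have sub: "(\<lambda>v. u @ v) ` words I (N - n) \<subseteq> ?S"
      proof (safe)
        fix v assume v: "v \<in> words I (N - n)"
        then show "u @ v \<in> words I N" using u N by (simp add: words_def lu)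
        fix y assume "y \<in> X"
        then have "cf (u @ v) y \<in> cf u ` X"
          using v by (auto simp: cf_append words_def intro!: imageI cf_in_disc)
        then have "dist x (cf (u @ v) y) \<le> 4 * g"
          unfolding g_def using \<alpha>(2)[of n] by (intro cf_dist_le[OF u]) (auto simp: u_def)
        then show "cf (u @ v) y \<in> cball x r" using True by simp
      qed
      have "ennreal (mass_const * r powr crit) \<le> ennreal (g powr crit)"
      proof (rule ennreal_leI)
        have "mass_const * r powr crit \<le> (128 * scale) powr - crit * r powr crit"
          by (intro mult_right_mono) (auto simp: mass_const_def)
        also have "\<dots> = r' powr crit"
          by (simp add: r'_def powr_divide powr_minus_divide)
        also have "\<dots> \<le> g powr crit" using rg r' crit0 by (intro powr_mono2) auto
        finally show "mass_const * r powr crit \<le> g powr crit" .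
      qed
      also have "\<dots> = weight crit u * 1" by (simp add: weight_def g_def)
      also have "\<dots> \<le> weight crit u * (?D * part_sum I crit (N - n))"
        by (intro mult_left_mono part_sum_crit_ge) auto
      also have "\<dots> = ?D * esum (\<lambda>v. weight crit u * weight crit v) (words I (N - n))"
        by (simp add: part_sum_def esum_cmult mult.left_commute)
      also have "\<dots> \<le> ?D * esum (\<lambda>v. ?D * weight crit (u @ v)) (words I (N - n))"
        using u crit0 by (intro mult_left_mono esum_mono weight_append) (auto simp: words_def)
      also have "\<dots> = 1 * (?D * (?D * esum (weight crit) ((\<lambda>v. u @ v) ` words I (N - n))))"
        by (subst esum_image) (auto simp: esum_cmult inj_on_def)
      also have "\<dots> \<le> ?D * (?D * (?D * esum (weight crit) ?S))"
        by (intro mult_mono D1 esum_subset_mono sub) auto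
      finally show "ennreal (mass_const * r powr crit) \<le> ?D ^ 3 * esum (weight crit) ?S"
        by (simp add: power3_eq_cube mult.assoc)
    qed
  next
    case False
    define \<rho> where "\<rho> = r / (4 * g)"
    have \<rho>: "0 < \<rho>" "\<rho> \<le> 1" using r g0 False by (auto simp: \<rho>_def)
    have \<rho>b: "8 * scale \<le> \<rho> * (cmod b)\<^sup>2"
    proof -
      have b0: "0 < (cmod b)\<^sup>2" using index_bounds[OF b] by auto
      have "g * (1 / (cmod b)\<^sup>2) \<le> 4 * deriv0 (u @ [b])"
        using deriv0_append(2)[OF u bl] by (simp add: g_def deriv0_singleton)
      also have "\<dots> \<le> 4 * (r / (128 * scale))" using less by (simp add: r'_def)
      finally have "g / (cmod b)\<^sup>2 \<le> r / (32 * scale)" by simp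
      then have "g * (32 * scale) \<le> r * (cmod b)\<^sup>2"
        using scale_ge_1 b0 by (simp add: pos_divide_le_eq pos_le_divide_eq)
      then have "8 * scale * (4 * g) \<le> r * (cmod b)\<^sup>2" by (simp add: algebra_simps)
      then show ?thesis using g0 by (simp add: \<rho>_def pos_le_divide_eq)
    qed
    obtain z where z: "z \<in> X" "x = cf (u @ [b]) z" using \<alpha>(2)[of n'] unfolding ub by blast
    obtain C where C: "C \<subseteq> I" "\<And>c. c \<in> C \<Longrightarrow> gccf_map c ` X \<subseteq> cball (gccf_map b z) \<rho>"
      and Cw: "ennreal (letter_const * \<rho> powr crit) \<le> esum (\<lambda>c. weight crit [c]) C"
      using letters_in_ball[OF b z(1) \<rho> \<rho>b] by blast
    have y: "gccf_map b z \<in> X" using cf_in_disc[of "[b]" z] b z by simp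
    have xy: "x = cf u (gccf_map b z)" using z(2) by (simp add: cf_append)
    show ?thesis
    proof (intro exI[of _ "Suc n"] allI impI)
      fix N assume N: "Suc n \<le> N"
      let ?S = "{w \<in> words I N. cf w ` X \<subseteq> cball x r}"
      let ?P = "C \<times> words I (N - Suc n)"
      let ?h = "\<lambda>(c, v). u @ c # v"
      have sub: "?h ` ?P \<subseteq> ?S"
      proof (safe)
        fix c v assume c: "c \<in> C" and v: "v \<in> words I (N - Suc n)"
        then show "u @ c # v \<in> words I N" using u N C(1) by (auto simp: words_def lu)
        fix t assume t: "t \<in> X"
        define s where "s = gccf_map c (cf v t)"
        have cv: "cf v t \<in> X" using v t by (intro cf_in_disc) (auto simp: words_def)
        then have s1: "s \<in> cball (gccf_map b z) \<rho>" using C(2)[OF c] by (auto simp: s_def)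
        have s2: "s \<in> X" using cf_in_disc[of "[c]" "cf v t"] c C(1) cv by (auto simp: s_def)
        have "dist x (cf (u @ c # v) t) = dist (cf u (gccf_map b z)) (cf u s)"
          by (simp add: xy cf_append s_def)
        also have "\<dots> \<le> 4 * g * dist (gccf_map b z) s"
          unfolding g_def by (rule cf_lipschitz[OF u y s2])
        also have "\<dots> \<le> 4 * g * \<rho>" using s1 g0 by (intro mult_left_mono) auto
        also have "\<dots> = r" using g0 by (simp add: \<rho>_def)
        finally show "cf (u @ c # v) t \<in> cball x r" by simp
      qed
      have "ennreal (mass_const * r powr crit) \<le> ennreal (g powr crit * (letter_const * \<rho> powr crit))"
      proof (rule ennreal_leI)
        have "mass_const * r powr crit \<le> letter_const * (1/4) powr crit * r powr crit"
          by (intro mult_right_mono) (auto simp: mass_const_def)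
        also have "\<dots> = letter_const * ((1/4) powr crit * r powr crit)" by (rule mult.assoc)
        also have "(1/4) powr crit * r powr crit = g powr crit * \<rho> powr crit"
          using g0 by (simp add: \<rho>_def flip: powr_mult)
        also have "letter_const * (g powr crit * \<rho> powr crit) = g powr crit * (letter_const * \<rho> powr crit)"
          by (rule mult.left_commute)
        finally show "mass_const * r powr crit \<le> g powr crit * (letter_const * \<rho> powr crit)" .
      qed
      also have "\<dots> = weight crit u * (ennreal (letter_const * \<rho> powr crit) * 1)"
        using letter_const_pos by (simp add: weight_def g_def ennreal_mult)
      also have "\<dots> \<le> weight crit u * (esum (\<lambda>c. weight crit [c]) C * (?D * part_sum I crit (N - Suc n)))"
        by (intro mult_left_mono mult_mono part_sum_crit_ge Cw) auto
      also have "\<dots> = ?D * esum (\<lambda>c. esum (\<lambda>v. weight crit u * (weight crit [c] * weight crit v)) (words I (N - Suc n))) C"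
        by (simp add: part_sum_def esum_cmult esum_multc ac_simps)
      also have "\<dots> \<le> ?D * esum (\<lambda>c. esum (\<lambda>v. ?D * (?D * weight crit (u @ c # v))) (words I (N - Suc n))) C"
      proof (intro mult_left_mono esum_mono)
        fix c v assume c: "c \<in> C" and v: "v \<in> words I (N - Suc n)"
        then show "weight crit u * (weight crit [c] * weight crit v) \<le> ?D * (?D * weight crit (u @ c # v))"
          using u C(1) crit0 by (intro weight_append_Cons) (auto simp: words_def)
      qed auto
      also have "\<dots> = ?D * (?D * (?D * esum (weight crit) (?h ` ?P)))"
      proof -
        have "inj_on ?h ?P" by (auto simp: inj_on_def)
        then have "esum (weight crit) (?h ` ?P) = esum (\<lambda>c. esum (\<lambda>v. weight crit (u @ c # v)) (words I (N - Suc n))) C"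
          by (simp add: esum_image esum_Sigma)
        then show ?thesis by (simp add: esum_cmult)
      qed
      also have "\<dots> \<le> ?D * (?D * (?D * esum (weight crit) ?S))"
        by (intro mult_left_mono esum_subset_mono sub) auto
      finally show "ennreal (mass_const * r powr crit) \<le> ?D ^ 3 * esum (weight crit) ?S"
        by (simp add: power3_eq_cube mult.assoc)
    qed
  qed
qed

text \<open>Disjoint balls contain the cylinders of disjoint sets of words of one common length
  \<open>N\<close>, and all words of that length weigh at most \<open>distort crit\<close>. Finite
  subfamilies are considered so that a single \<open>N\<close> serves all balls.\<close>

lemma packing_sum_le:
  assumes B: "B \<in> packings 1 (J)"
  shows "(\<Sum>\<^sub>\<infinity>(x, r)\<in>B. ennreal ((2 * r) powr crit)) \<le> ennreal (2 powr crit / mass_const) * distort crit ^ 4"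
  unfolding esum_eq_infsum esum_le_iff
proof (intro allI impI)
  let ?D = "distort crit"
  fix S assume S: "finite S" "S \<subseteq> B"
  have BJ: "fst p \<in> J" "0 < snd p" "snd p \<le> 1" if "p \<in> S" for p
    using B S that by (auto simp: packings_def)
  let ?W = "\<lambda>N p. {w \<in> words I N. cf w ` X \<subseteq> cball (fst p) (snd p)}"
  define m where "m p N = esum (weight crit) (?W N p)" for p N
  have "\<exists>N0. \<forall>N\<ge>N0. ennreal (mass_const * snd p powr crit) \<le> ?D ^ 3 * m p N" if p: "p \<in> S" for p
    unfolding m_def by (rule ball_mass_ge[OF BJ[OF p]])
  then obtain N0 where N0: "\<And>p N. p \<in> S \<Longrightarrow> N0 p \<le> N \<Longrightarrow> ennreal (mass_const * snd p powr crit) \<le> ?D ^ 3 * m p N"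
    by metis
  define N where "N = Max (insert 0 (N0 ` S))"
  have N: "N0 p \<le> N" if "p \<in> S" for p unfolding N_def using S that by (intro Max_ge) auto
  have disj: "disjoint_family_on (?W N) S"
  proof (unfold disjoint_family_on_def, intro ballI impI equals0I)
    fix p q w assume pq: "p \<in> S" "q \<in> S" "p \<noteq> q" and w: "w \<in> ?W N p \<inter> ?W N q"
    have "disjoint_family_on (\<lambda>(x, r). cball x r) B" using B by (simp add: packings_def)
    then have "(\<lambda>(x, r). cball x r) p \<inter> (\<lambda>(x, r). cball x r) q = {}"
      using pq S unfolding disjoint_family_on_def by blast
    then have "cball (fst p) (snd p) \<inter> cball (fst q) (snd q) = {}"
      by (simp only: split_beta)
    moreover have "cf w 0 \<in> cball (fst p) (snd p) \<inter> cball (fst q) (snd q)"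
      using w zero_in_disc by blast
    ultimately show False by blast
  qed
  have "(\<Sum>p\<in>S. case p of (x, r) \<Rightarrow> ennreal ((2 * r) powr crit))
      = (\<Sum>p\<in>S. ennreal (2 powr crit / mass_const) * ennreal (mass_const * snd p powr crit))"
  proof (rule sum.cong[OF refl])
    fix p assume "p \<in> S"
    then show "(case p of (x, r) \<Rightarrow> ennreal ((2 * r) powr crit))
      = ennreal (2 powr crit / mass_const) * ennreal (mass_const * snd p powr crit)"
      using mass_const_pos by (simp add: split_beta powr_mult flip: ennreal_mult)
  qed
  also have "\<dots> \<le> (\<Sum>p\<in>S. ennreal (2 powr crit / mass_const) * (?D ^ 3 * m p N))"
    using N0 N by (intro sum_mono mult_left_mono) auto
  also have "\<dots> = ennreal (2 powr crit / mass_const) * (?D ^ 3 * (\<Sum>p\<in>S. m p N))"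
    by (simp add: sum_distrib_left)
  also have "\<dots> \<le> ennreal (2 powr crit / mass_const) * (?D ^ 3 * ?D)"
  proof (intro mult_left_mono)
    have "(\<Sum>p\<in>S. m p N) = esum (weight crit) (\<Union>p\<in>S. ?W N p)"
      using S(1) unfolding m_def by (subst esum_UN_disjoint[OF disj]) (simp add: esum_finite)
    also have "\<dots> \<le> part_sum I crit N"
      unfolding part_sum_def by (intro esum_subset_mono) auto
    also have "\<dots> \<le> ?D" by (rule part_sum_crit_le)
    finally show "(\<Sum>p\<in>S. m p N) \<le> ?D" .
  qed auto
  also have "?D ^ 3 * ?D = ?D ^ 4" by (simp add: power_numeral_reduce ac_simps)
  finally show "(\<Sum>p\<in>S. case p of (x, r) \<Rightarrow> ennreal ((2 * r) powr crit)) \<le> ennreal (2 powr crit / mass_const) * ?D ^ 4" .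
qed


lemma packing_premeasure_le_crit_finite: "packing_premeasure_le crit 1 (J) < \<infinity>"
proof -
  have "packing_premeasure_le crit 1 (J) \<le> ennreal (2 powr crit / mass_const) * distort crit ^ 4"
    unfolding packing_premeasure_le_def by (intro SUP_least packing_sum_le)
  also have "\<dots> < \<infinity>"
    using mass_const_pos by (simp add: distort_def ennreal_power flip: ennreal_mult)
  finally show ?thesis .
qed

lemma packing_measure_crit_finite: "packing_measure crit (J) < \<infinity>"
proof -
  have "packing_measure crit (J) \<le> packing_premeasure crit (J)"
    by (rule packing_measure_le_premeasure)
  also have "\<dots> \<le> packing_premeasure_le crit 1 (J)"
    unfolding packing_premeasure_def by (rule INF_lower) simp
  finally show ?thesis using packing_premeasure_le_crit_finite by (rule le_less_trans)
qed

section \<open>Positivity of the packing measure and the packing dimension\<close>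

text \<open>Unlike \<open>1 + \<tau>\<close>, which for \<open>Re \<tau> = 0\<close> maps a boundary point of the disc to a boundary point, this
  letter maps the closed disc into its interior.\<close>

definition inner_letter :: complex where
  "inner_letter = lattice (2, 1)"

lemma inner_letter_in_index: "inner_letter \<in> I"
  unfolding index_eq inner_letter_def by (intro imageI) auto

lemma inner_letter_ball:
  obtains \<eta> where "0 < \<eta>" "\<eta> \<le> 1"
    "\<forall>z\<in>X. ball (gccf_map inner_letter z) \<eta> \<subseteq> ball (1/2) (1/2)"
proof -
  define R where "R = cmod inner_letter + 1"
  have "2 \<le> cmod inner_letter"
    using lattice_bounds(1)[of "(2, 1)"] complex_Re_le_cmod[of inner_letter]
    by (simp add: inner_letter_def)
  then have R: "3 \<le> R" by (simp add: R_def)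
  \<comment> \<open>For \<open>y = 1 / Z\<close> with \<open>Re Z \<ge> 2\<close> the quantity
    \<open>(cmod y)^2 - Re y\<close>, which vanishes on the boundary of the disc, is at most
    \<open>- 1 / (cmod Z)^2 \<le> - \<eta>\<close>.\<close>
  define \<eta> where "\<eta> = 1 / R\<^sup>2"
  have "9 \<le> R\<^sup>2" using power_mono[OF R, of 2] by simp
  then have \<eta>: "0 < \<eta>" "\<eta> \<le> 1/9" unfolding \<eta>_def using R by (auto intro!: frac_le)
  have "ball (gccf_map inner_letter z) \<eta> \<subseteq> ball (1/2) (1/2)" if z: "z \<in> X" for z
  proof
    define Z where "Z = z + inner_letter"
    define y where "y = gccf_map inner_letter z"
    have y: "y = 1 / Z" by (simp add: y_def Z_def gccf_map_def)
    have re: "2 \<le> Re Z"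
      using disc_bounds(2)[OF z] lattice_bounds(1)[of "(2, 1)"] by (simp add: Z_def inner_letter_def)
    then have Z0: "0 < cmod Z" by auto
    have "cmod Z \<le> R" using norm_triangle_ineq[of z inner_letter] disc_bounds(1)[OF z] by (simp add: Z_def R_def)
    then have "\<eta> \<le> 1 / (cmod Z)\<^sup>2" unfolding \<eta>_def using Z0 by (intro frac_le power_mono) auto
    moreover have "(cmod y)\<^sup>2 = 1 / (cmod Z)\<^sup>2" by (simp add: y norm_divide power_divide)
    moreover have "2 / (cmod Z)\<^sup>2 \<le> Re y" unfolding y Re_one_divide using re by (intro divide_right_mono) auto
    ultimately have "(cmod y)\<^sup>2 - Re y \<le> - \<eta>" by linarith
    then have "(cmod (y - 1/2))\<^sup>2 \<le> (1/2)\<^sup>2 - \<eta>" unfolding cmod_minus_half by linarith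
    also have "\<dots> \<le> (1/2 - \<eta>)\<^sup>2" by (simp add: power2_eq_square algebra_simps)
    finally have "cmod (y - 1/2) \<le> 1/2 - \<eta>" using \<eta> by (rule_tac power2_le_imp_le) auto
    then have d: "dist (1/2) y \<le> 1/2 - \<eta>" by (simp add: dist_norm norm_minus_commute)
    fix t assume "t \<in> ball (gccf_map inner_letter z) \<eta>"
    then show "t \<in> ball (1/2) (1/2)"
      using d dist_triangle[of "1/2" t y] by (simp add: y_def)
  qed
  then show ?thesis using that[of \<eta>] \<eta> by auto
qed

lemma ball_subset_cylinder:
  assumes \<alpha>: "range \<alpha> \<subseteq> I" "\<And>n. x \<in> cf (map \<alpha> [0..<n]) ` X" and n: "\<alpha> n = inner_letter"
    and \<eta>: "0 < \<eta>" "\<eta> \<le> 1" "\<forall>z\<in>X. ball (gccf_map inner_letter z) \<eta> \<subseteq> ball (1/2) (1/2)"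
  shows "ball x (\<eta> * deriv0 (map \<alpha> [0..<n]) / 8) \<subseteq> cf (map \<alpha> [0..<n]) ` ball (1/2) (1/2)"
    and "x \<in> cf (map \<alpha> [0..<n]) ` ball (1/2) (1/2)"
proof -
  obtain z where z: "z \<in> X" "x = cf (map \<alpha> [0..<Suc n]) z" using \<alpha>(2)[of "Suc n"] by blast
  define y where "y = gccf_map inner_letter z"
  have x: "x = cf (map \<alpha> [0..<n]) y" using z(2) by (simp add: cf_append y_def n)
  have sub: "ball y \<eta> \<subseteq> ball (1/2) (1/2)" unfolding y_def using \<eta>(3) z(1) by blast
  have "ball x (\<eta> * deriv0 (map \<alpha> [0..<n]) / 8) \<subseteq> cf (map \<alpha> [0..<n]) ` ball y \<eta>"
    unfolding x by (rule ball_subset_cf_image[OF prefix_in_lists[OF \<alpha>(1)] order_trans[OF sub open_disc_subset] \<eta>(1,2)])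
  then show "ball x (\<eta> * deriv0 (map \<alpha> [0..<n]) / 8) \<subseteq> cf (map \<alpha> [0..<n]) ` ball (1/2) (1/2)"
    using sub by blast
  have "y \<in> ball y \<eta>" using \<eta>(1) by simp
  then show "x \<in> cf (map \<alpha> [0..<n]) ` ball (1/2) (1/2)" unfolding x using sub by blast
qed

text \<open>Recovers a word from a single point, which is possible because the point lies in the
  interior images of both words; on boundaries different codes may meet.\<close>

lemma prefix_of_sequence:
  assumes \<alpha>: "range \<alpha> \<subseteq> I" and u: "u \<in> lists I" "length u \<le> m"
    and x: "x \<in> cf u ` ball (1/2) (1/2)" "x \<in> cf (map \<alpha> [0..<m]) ` ball (1/2) (1/2)"
  shows "map \<alpha> [0..<length u] = u"
proof -
  have "prefix u (map \<alpha> [0..<m]) \<or> prefix (map \<alpha> [0..<m]) u"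
    using x cf_eq_imp_comparable[OF u(1) prefix_in_lists[OF \<alpha>]] by blast
  then have "prefix u (map \<alpha> [0..<m])"
    using u(2) prefix_length_le[of "map \<alpha> [0..<m]" u] by (auto simp: prefix_def)
  then have "take (length u) (map \<alpha> [0..<m]) = u" by (auto simp: prefix_def)
  then show ?thesis using u(2) by (simp add: take_map)
qed

text \<open>Only codes returning to \<open>inner_letter\<close> infinitely often are tested: each
  return places a ball about \<open>x\<close> inside a cylinder, at arbitrarily small scales and
  after any given prefix length.\<close>

definition captures :: "complex list set \<Rightarrow> complex set \<Rightarrow> bool" where
  "captures W A \<longleftrightarrow> (\<forall>\<alpha> x. range \<alpha> \<subseteq> I \<longrightarrow> (\<forall>n. x \<in> cf (map \<alpha> [0..<n]) ` X) \<longrightarrow> x \<in> A \<longrightarrow>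
    (\<forall>k. \<exists>n\<ge>k. \<alpha> n = inner_letter) \<longrightarrow> (\<exists>n. map \<alpha> [0..<n] \<in> W))"

text \<open>Vitali's covering lemma applied to balls inside the cylinders of words followed by
  \<open>inner_letter\<close>.\<close>

lemma cylinders_from_packings:
  assumes \<eta>: "0 < \<eta>" "\<eta> \<le> 1" "\<forall>z\<in>X. ball (gccf_map inner_letter z) \<eta> \<subseteq> ball (1/2) (1/2)"
    and \<delta>: "0 < \<delta>"
  shows "\<exists>W\<subseteq>lists I. esum (weight crit) W \<le> ennreal ((40 / \<eta>) powr crit) * packing_premeasure_le crit \<delta> A
    \<and> captures W A"
proof -
  \<comment> \<open>A tenth of the radius \<open>\<eta> * deriv0 (snd p) / 8\<close> of the ball
    known to lie in the cylinder, so that the fivefold Vitali enlargement stays inside it. Then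
    \<open>deriv0 (snd p) = 40 / \<eta> * (2 * r p)\<close>.\<close>
  define r where "r p = \<eta> * deriv0 (snd p) / 80" for p :: "complex \<times> complex list"
  define K where "K = {p. fst p \<in> A \<and> snd p \<in> lists I \<and> r p \<le> \<delta> \<and>
    ball (fst p) (\<eta> * deriv0 (snd p) / 8) \<subseteq> cf (snd p) ` ball (1/2) (1/2)}"
  have r0: "0 < r p" if "p \<in> K" for p
    using that \<eta> deriv0_pos[of "snd p"] by (auto simp: r_def K_def)
  then have rK: "0 < r p \<and> r p \<le> \<delta>" if "p \<in> K" for p using that by (auto simp: K_def)
  obtain C where C: "countable C" "C \<subseteq> K"
      "pairwise (\<lambda>i j. disjnt (cball (fst i) (r i)) (cball (fst j) (r j))) C"
      "(\<Union>p\<in>K. cball (fst p) (r p)) \<subseteq> (\<Union>i\<in>C. cball (fst i) (5 * r i))"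
    by (rule Vitali_covering_lemma_cballs[where S = "\<Union>p\<in>K. cball (fst p) (r p)" and a = fst and r = r and K = K,
          OF order_refl rK])
  define h where "h p = (fst p, r p)" for p
  have inj: "inj_on h C"
  proof (rule inj_onI, rule ccontr)
    fix p q assume pq: "p \<in> C" "q \<in> C" "h p = h q" "p \<noteq> q"
    then have "disjnt (cball (fst p) (r p)) (cball (fst q) (r q))"
      using C(3) unfolding pairwise_def by blast
    moreover have "fst p = fst q" "r p = r q" using pq(3) by (auto simp: h_def)
    moreover have "0 < r p" using pq(1) C(2) by (auto intro: r0)
    ultimately show False by simp
  qed
  have "h ` C \<in> packings \<delta> A"
    unfolding packings_def
  proof (intro CollectI conjI)
    show "countable (h ` C)" using C(1) by simp
    show "h ` C \<subseteq> A \<times> {0<..\<delta>}"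
    proof
      fix q assume "q \<in> h ` C"
      then obtain p where p: "p \<in> K" "q = h p" using C(2) by blast
      then show "q \<in> A \<times> {0<..\<delta>}" using rK[OF p(1)] by (simp add: h_def K_def)
    qed
    show "disjoint_family_on (\<lambda>(x, r). cball x r) (h ` C)"
    proof (unfold disjoint_family_on_def, intro ballI impI)
      fix s t assume "s \<in> h ` C" "t \<in> h ` C" "s \<noteq> t"
      then obtain p q where pq: "p \<in> C" "q \<in> C" "s = h p" "t = h q" "p \<noteq> q" by blast
      then have "disjnt (cball (fst p) (r p)) (cball (fst q) (r q))"
        using C(3) unfolding pairwise_def by blast
      then show "(\<lambda>(x, r). cball x r) s \<inter> (\<lambda>(x, r). cball x r) t = {}"
        by (simp add: pq h_def disjnt_def)
    qed
  qed
  then have le: "esum (\<lambda>(x, r). ennreal ((2 * r) powr crit)) (h ` C) \<le> packing_premeasure_le crit \<delta> A"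
    unfolding packing_premeasure_le_def esum_eq_infsum[symmetric] by (rule SUP_upper)
  have "esum (weight crit) (snd ` C) \<le> esum (\<lambda>p. weight crit (snd p)) C"
    by (rule esum_image_le)
  also have "\<dots> = esum (\<lambda>p. ennreal ((40 / \<eta>) powr crit) * ennreal ((2 * r p) powr crit)) C"
  proof (rule esum_cong[OF refl])
    fix p assume "p \<in> C"
    have "deriv0 (snd p) = 40 / \<eta> * (2 * r p)" using \<eta>(1) by (simp add: r_def)
    then show "weight crit (snd p) = ennreal ((40 / \<eta>) powr crit) * ennreal ((2 * r p) powr crit)"
      by (simp only: weight_def powr_mult ennreal_mult powr_ge_zero mult_nonneg_nonneg)
  qed
  also have "\<dots> = ennreal ((40 / \<eta>) powr crit) * esum (\<lambda>(x, r). ennreal ((2 * r) powr crit)) (h ` C)"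
  proof -
    have "esum (\<lambda>(x, r). ennreal ((2 * r) powr crit)) (h ` C) = esum (\<lambda>p. ennreal ((2 * r p) powr crit)) C"
      by (subst esum_image[OF inj]) (simp add: h_def)
    then show ?thesis by (simp add: esum_cmult)
  qed
  also have "\<dots> \<le> ennreal ((40 / \<eta>) powr crit) * packing_premeasure_le crit \<delta> A"
    by (intro mult_left_mono le) simp
  finally have small: "esum (weight crit) (snd ` C) \<le> ennreal ((40 / \<eta>) powr crit) * packing_premeasure_le crit \<delta> A" .
  have "\<exists>n. map \<alpha> [0..<n] \<in> snd ` C"
    if \<alpha>: "range \<alpha> \<subseteq> I" and x: "\<forall>n. x \<in> cf (map \<alpha> [0..<n]) ` X" "x \<in> A"
      and io: "\<forall>k. \<exists>n\<ge>k. \<alpha> n = inner_letter" for \<alpha> x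
  proof -
    have x': "x \<in> cf (map \<alpha> [0..<n]) ` X" for n using x by blast
    have "\<exists>k. (4/5) ^ k < \<delta>" using \<delta> by (intro real_arch_pow_inv) auto
    then obtain k where k: "(4/5) ^ k < \<delta>" by blast
    obtain n where n: "k \<le> n" "\<alpha> n = inner_letter" using io by blast
    let ?p = "(x, map \<alpha> [0..<n])"
    have sp: "0 < deriv0 (map \<alpha> [0..<n])" by (rule deriv0_pos[OF prefix_in_lists[OF \<alpha>]])
    have "r ?p \<le> deriv0 (map \<alpha> [0..<n])"
      using \<eta> sp mult_mono[OF \<eta>(2) order_refl, of "deriv0 (map \<alpha> [0..<n])"] by (simp add: r_def)
    also have "\<dots> \<le> (4/5) ^ n" using deriv0_le_power[OF prefix_in_lists[OF \<alpha>], of n] by simp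
    also have "\<dots> \<le> (4/5) ^ k" using n(1) by (intro power_decreasing) auto
    finally have "r ?p \<le> \<delta>" using k by simp
    then have K: "?p \<in> K"
      using x ball_subset_cylinder(1)[OF \<alpha> x' n(2) \<eta>] prefix_in_lists[OF \<alpha>, of n] by (simp add: K_def)
    then have "x \<in> (\<Union>p\<in>K. cball (fst p) (r p))" using r0[OF K] by (intro UN_I[OF K]) simp
    then obtain p where p: "p \<in> C" "x \<in> cball (fst p) (5 * r p)" using C(4) by blast
    define u where "u = snd p"
    have u: "u \<in> lists I" "ball (fst p) (\<eta> * deriv0 u / 8) \<subseteq> cf u ` ball (1/2) (1/2)"
      using p(1) C(2) by (auto simp: K_def u_def)
    have "5 * r p < \<eta> * deriv0 u / 8"
      using deriv0_pos[OF u(1)] \<eta> by (simp add: r_def u_def)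
    then have xu: "x \<in> cf u ` ball (1/2) (1/2)" using p(2) u(2) by auto
    \<comment> \<open>A return after position \<open>length u\<close> makes \<open>x\<close> an
      interior point of one of its own longer cylinders, so that \<open>u\<close> must be a prefix
      of \<alpha>.\<close>
    obtain m where m: "length u \<le> m" "\<alpha> m = inner_letter" using io by blast
    have "map \<alpha> [0..<length u] = u"
      by (rule prefix_of_sequence[OF \<alpha> u(1) m(1) xu ball_subset_cylinder(2)[OF \<alpha> x' m(2) \<eta>]])
    then show ?thesis using p(1) by (auto simp: u_def intro!: exI[of _ "length u"] image_eqI[of _ snd p])
  qed
  then have "captures (snd ` C) A" unfolding captures_def by blast
  moreover have "snd ` C \<subseteq> lists I" using C(2) by (auto simp: K_def)
  ultimately show ?thesis using small by blast
qed

text \<open>If the measure were tiny, the pieces of a cheap cover would give families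
  \<open>W i\<close> of small weight through \<open>cylinders_from_packings\<close>. A sequence
  avoiding them, and made to return to \<open>inner_letter\<close> infinitely often by avoiding the
  \<open>V k\<close> too, codes a limit point in some piece \<open>U i\<close>, although
  \<open>W i\<close> captures all such codes.\<close>

lemma packing_measure_crit_pos: "0 < packing_measure crit (J)"
proof -
  let ?D = "distort crit"
  have crit0: "0 \<le> crit" using crit_gt_1 by simp
  obtain \<eta> where \<eta>: "0 < \<eta>" "\<eta> \<le> 1"
    "\<forall>z\<in>X. ball (gccf_map inner_letter z) \<eta> \<subseteq> ball (1/2) (1/2)"
    by (rule inner_letter_ball)
  have c: "ennreal (1 / 4 powr crit) \<le> part_sum I crit n" for n
  proof -
    have "ennreal (1 / 4 powr crit) * 1 \<le> ennreal (1 / 4 powr crit) * (?D * part_sum I crit n)"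
      by (intro mult_left_mono part_sum_crit_ge) simp
    also have "\<dots> = (ennreal (1 / 4 powr crit) * ?D) * part_sum I crit n" by (simp add: mult.assoc)
    also have "ennreal (1 / 4 powr crit) * ?D = 1" by (simp add: distort_def flip: ennreal_mult)
    finally show ?thesis by simp
  qed
  have c0: "0 < 1 / (4::real) powr crit" by simp
  obtain \<kappa> where \<kappa>: "0 < \<kappa>"
    "\<And>W. W \<subseteq> lists I \<Longrightarrow> esum (weight crit) W < ennreal \<kappa> \<Longrightarrow>
        \<exists>\<alpha>. range \<alpha> \<subseteq> I \<and> (\<forall>n. map \<alpha> [0..<n] \<notin> W)"
    using exists_sequence_avoiding_small[OF order_refl crit0 c0 c part_sum_1_finite[OF crit_gt_1]] by blast
  define L where "L = (40 / \<eta>) powr crit"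
  have L: "0 < L" using \<eta> by (simp add: L_def)
  \<comment> \<open>The premeasures and the slack in choosing the scales each total at most
    \<open>e\<close>, so the \<open>W i\<close> weigh at most
    \<open>2 * L * e = \<kappa> / 4\<close>.\<close>
  define e where "e = \<kappa> / (8 * L)"
  have e: "0 < e" using \<kappa>(1) L by (simp add: e_def)
  have "\<not> packing_measure crit J < ennreal e"
  proof
    assume "packing_measure crit J < ennreal e"
    then obtain U :: "nat \<Rightarrow> complex set" where cover: "J \<subseteq> (\<Union>i. U i)"
      and sumU: "(\<Sum>i. packing_premeasure crit (U i)) < ennreal e"
      unfolding packing_measure_def by (auto simp: INF_less_iff)
    have "\<exists>\<delta>>0. packing_premeasure_le crit \<delta> (U i) \<le> packing_premeasure crit (U i) + ennreal (e * (1/2) ^ Suc i)" for i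
    proof -
      have "packing_premeasure crit (U i) \<le> (\<Sum>i. packing_premeasure crit (U i))"
        unfolding esum_nat[symmetric] by (rule esum_member_le) simp
      also have "\<dots> < top" using sumU by (rule less_trans) simp
      finally obtain a where "packing_premeasure crit (U i) = ennreal a" "0 \<le> a"
        by (cases "packing_premeasure crit (U i)") auto
      then have "packing_premeasure crit (U i) < packing_premeasure crit (U i) + ennreal (e * (1/2) ^ Suc i)"
        using e by (simp add: ennreal_less_iff flip: ennreal_plus)
      then obtain \<delta> where "\<delta> \<in> {0<..}" "packing_premeasure_le crit \<delta> (U i) < packing_premeasure crit (U i) + ennreal (e * (1/2) ^ Suc i)"
        unfolding packing_premeasure_def[of crit "U i"] INF_less_iff by blast
      then show ?thesis by (intro exI[of _ \<delta>]) auto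
    qed
    then obtain \<delta> where \<delta>: "\<And>i. 0 < \<delta> i"
      "\<And>i. packing_premeasure_le crit (\<delta> i) (U i) \<le> packing_premeasure crit (U i) + ennreal (e * (1/2) ^ Suc i)"
      by metis
    have "\<exists>W. \<forall>i. W i \<subseteq> lists I \<and>
        esum (weight crit) (W i) \<le> ennreal L * packing_premeasure_le crit (\<delta> i) (U i) \<and> captures (W i) (U i)"
      unfolding L_def by (intro choice allI cylinders_from_packings[OF \<eta> \<delta>(1)])
    then obtain W where W: "\<And>i. W i \<subseteq> lists I"
      "\<And>i. esum (weight crit) (W i) \<le> ennreal L * packing_premeasure_le crit (\<delta> i) (U i)"
      "\<And>i. captures (W i) (U i)"
      by metis
    have geo: "(\<Sum>i. ennreal (a * (1/2) ^ Suc i)) = ennreal a" if "0 \<le> a" for a :: real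
      using sums_mult[OF power_half_series, of a] that by (intro suminf_ennreal_eq) auto
    have sumW: "esum (weight crit) (\<Union>i. W i) \<le> ennreal (\<kappa> / 4)"
    proof -
      have "esum (weight crit) (\<Union>i. W i) \<le> (\<Sum>i. esum (weight crit) (W i))"
        using esum_UN_le[of "weight crit" W UNIV] by (simp add: esum_nat)
      also have "\<dots> \<le> (\<Sum>i. ennreal L * (packing_premeasure crit (U i) + ennreal (e * (1/2) ^ Suc i)))"
        by (intro suminf_le summableI order_trans[OF W(2)] mult_left_mono \<delta>(2)) auto
      also have "\<dots> = ennreal L * ((\<Sum>i. packing_premeasure crit (U i)) + (\<Sum>i. ennreal (e * (1/2) ^ Suc i)))"
        unfolding ennreal_suminf_cmult by (subst suminf_add) auto
      also have "\<dots> \<le> ennreal L * (ennreal e + ennreal e)"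
        using sumU geo[OF less_imp_le[OF e]] by (intro mult_left_mono add_mono) (simp_all only: less_imp_le order_refl zero_le)
      also have "\<dots> = ennreal (\<kappa> / 4)"
        using L e \<kappa>(1) by (simp add: e_def flip: ennreal_plus ennreal_mult)
      finally show ?thesis .
    qed
    let ?F = "I - {inner_letter}"
    have F: "?F \<subseteq> I" "?F \<noteq> I" using inner_letter_in_index by auto
    have "\<exists>m. part_sum ?F crit m < ennreal (\<kappa> / 2 / (4 powr crit * 4 powr crit) * (1/2) ^ Suc k)" for k
    proof -
      have "0 < ennreal (\<kappa> / 2 / (4 powr crit * 4 powr crit) * (1/2) ^ Suc k)" using \<kappa>(1) by simp
      then show ?thesis using subsystem_partition_sum_small[OF F] by blast
    qed
    then obtain m where m: "\<And>k. part_sum ?F crit (m k) < ennreal (\<kappa> / 2 / (4 powr crit * 4 powr crit) * (1/2) ^ Suc k)"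
      by metis
    \<comment> \<open>A sequence without \<open>inner_letter\<close> from position \<open>k\<close>
      on has a prefix in \<open>V k\<close>. The lengths \<open>m k\<close> bring the total weight
      of all \<open>V k\<close> down to \<open>\<kappa> / 2\<close>, which together with
      \<open>\<kappa> / 4\<close> stays below \<kappa>.\<close>
    define V where "V k = (\<lambda>(u, v). u @ v) ` (words I k \<times> words ?F (m k))" for k
    have VI: "V k \<subseteq> lists I" for k by (auto simp: V_def words_def)
    have Vle: "esum (weight crit) (V k) \<le> ennreal (\<kappa> / 2 * (1/2) ^ Suc k)" for k
    proof -
      have "esum (weight crit) (V k) \<le> ?D * (part_sum I crit k * part_sum ?F crit (m k))"
        unfolding V_def by (rule esum_weight_concat_le[OF F(1) crit0])
      also have "\<dots> \<le> ?D * (?D * ennreal (\<kappa> / 2 / (4 powr crit * 4 powr crit) * (1/2) ^ Suc k))"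
        by (intro mult_left_mono mult_mono part_sum_crit_le less_imp_le[OF m]) auto
      also have "\<dots> = ennreal (4 powr crit * (4 powr crit * (\<kappa> / 2 / (4 powr crit * 4 powr crit) * (1/2) ^ Suc k)))"
        using \<kappa>(1) by (simp add: distort_def flip: ennreal_mult)
      also have "4 powr crit * (4 powr crit * (\<kappa> / 2 / (4 powr crit * 4 powr crit) * (1/2) ^ Suc k)) = \<kappa> / 2 * (1/2) ^ Suc k"
        by simp
      finally show ?thesis .
    qed
    have sumV: "esum (weight crit) (\<Union>k. V k) \<le> ennreal (\<kappa> / 2)"
    proof -
      have "esum (weight crit) (\<Union>k. V k) \<le> (\<Sum>k. esum (weight crit) (V k))"
        using esum_UN_le[of "weight crit" V UNIV] by (simp add: esum_nat)
      also have "\<dots> \<le> (\<Sum>k. ennreal (\<kappa> / 2 * (1/2) ^ Suc k))" by (intro suminf_le summableI Vle)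
      also have "\<dots> = ennreal (\<kappa> / 2)" using \<kappa>(1) by (intro geo) simp
      finally show ?thesis .
    qed
    have "esum (weight crit) ((\<Union>i. W i) \<union> (\<Union>k. V k)) \<le> ennreal (\<kappa> / 4) + ennreal (\<kappa> / 2)"
      using esum_Un_le add_mono[OF sumW sumV] by (rule order_trans)
    also have "\<dots> < ennreal \<kappa>" using \<kappa>(1) by (simp add: ennreal_less_iff flip: ennreal_plus)
    finally have small: "esum (weight crit) ((\<Union>i. W i) \<union> (\<Union>k. V k)) < ennreal \<kappa>" .
    have "(\<Union>i. W i) \<union> (\<Union>k. V k) \<subseteq> lists I" using W(1) VI by blast
    then obtain \<alpha> where \<alpha>: "range \<alpha> \<subseteq> I" "\<And>n. map \<alpha> [0..<n] \<notin> (\<Union>i. W i) \<union> (\<Union>k. V k)"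
      using \<kappa>(2)[OF _ small] by blast
    have io: "\<exists>n\<ge>k. \<alpha> n = inner_letter" for k
    proof (rule ccontr)
      assume no: "\<not> ?thesis"
      have "map \<alpha> [0..<k + m k] = map \<alpha> [0..<k] @ map \<alpha> [k..<k + m k]"
        using upt_add_eq_append[of 0 k "m k"] by simp
      also have "\<dots> \<in> V k"
        unfolding V_def
      proof (intro image_eqI[of _ _ "(map \<alpha> [0..<k], map \<alpha> [k..<k + m k])"])
        have nF: "\<alpha> n \<in> ?F" if "k \<le> n" for n using no that \<alpha>(1) by blast
        have "\<alpha> ` {k..<k + m k} \<subseteq> ?F" by (rule image_subsetI, rule nF) simp
        moreover have "\<alpha> ` {0..<k} \<subseteq> I" using \<alpha>(1) by blast
        ultimately show "(map \<alpha> [0..<k], map \<alpha> [k..<k + m k]) \<in> words I k \<times> words ?F (m k)"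
          unfolding words_def lists_eq_set by simp
      qed simp
      finally show False using \<alpha>(2)[of "k + m k"] by blast
    qed
    obtain x where x: "\<And>n. x \<in> cf (map \<alpha> [0..<n]) ` X"
      using limit_point_exists[OF \<alpha>(1)] by blast
    then have "x \<in> J" using \<alpha>(1) mem_limit_set_iff by blast
    then obtain i where i: "x \<in> U i" using cover by blast
    have "\<exists>n. map \<alpha> [0..<n] \<in> W i"
      using W(3)[of i, unfolded captures_def, rule_format, of \<alpha> x] \<alpha>(1) x i io by simp
    then show False using \<alpha>(2) by blast
  qed
  then have "ennreal e \<le> packing_measure crit J" by simp
  then show ?thesis using e by (meson ennreal_less_zero_iff order_less_le_trans)
qed

lemma packing_dim_eq_crit: "packing_dim (J) = crit"
  unfolding packing_dim_def
\<comment> \<open>The infimum is not attained, since the packing measure at \<open>crit\<close> is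
  positive; the set only accumulates at \<open>crit\<close> from the right.\<close>
proof (rule cInf_eq_non_empty)
  let ?S = "{s. 0 \<le> s \<and> packing_measure s J = 0}"
  have above: "s \<in> ?S" if "crit < s" for s
  proof -
    have "packing_premeasure s J = 0"
      using packing_premeasure_le_crit_finite that by (rule packing_premeasure_eq_0)
    then show ?thesis using packing_measure_le_premeasure[of s J] that crit_gt_1 by simp
  qed
  show "?S \<noteq> {}" using above[of "crit + 1"] by auto
  show "crit \<le> s" if "s \<in> ?S" for s
    using that packing_measure_antimono[of s crit J] packing_measure_crit_pos by (auto simp: not_less[symmetric])
  show "y \<le> crit" if y: "\<And>s. s \<in> ?S \<Longrightarrow> y \<le> s" for y
    by (rule field_le_epsilon) (rule y, rule above, simp)
qed

end

theorem corollary1p5: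
  fixes \<tau> :: complex
  assumes "\<tau> \<in> gccf_param"
  shows "hausdorff_measure (gccf_dim \<tau>) (gccf_limit_set \<tau>) = 0
       \<and> 0 < packing_measure (gccf_dim \<tau>) (gccf_limit_set \<tau>)
       \<and> packing_measure (gccf_dim \<tau>) (gccf_limit_set \<tau>) < \<infinity>
       \<and> packing_dim (gccf_limit_set \<tau>) = gccf_dim \<tau>"
proof -
  interpret gccf \<tau> by unfold_locales (rule assms)
  show ?thesis
    unfolding gccf_dim_eq_crit
    using hausdorff_measure_crit packing_measure_crit_pos packing_measure_crit_finite packing_dim_eq_crit
    by blast
qed

end
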